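(* Assume the density estimation setting, sieve prior $\tilde\pi=\sum_{j\in J}a_j\tilde\pi_j$ and notation described in the context. Suppose the following six assumptions hold. (1) For each $j\in J$ there exist constants $A_j\ge 0.0056$ and $m_j\ge 1$ such that for any $r>0$, $0<\delta\le 0.0056\,r$ and $\theta\in\Theta_j$, $$N(B_{d_H,j}(\theta,r),\delta,d_{j,\infty})\le\left(\frac{A_jr}{\delta}\right)^{m_j}.$$ With these $A_j,m_j$, and constants $C_j\ge 0$ with $\sum_{j\in J}e^{-C_j}\le 1$, put $$\eta_j=\frac{4m_j}{1-4\gamma}\log\left(\frac{46.2A_j\sqrt{1-4\gamma}}{\gamma}\right)+\frac{8C_j}{1-4\gamma},\qquad a_j=\alpha\exp\left(-\left(1+\frac{1-4\gamma}{8}\right)\eta_j\right),$$ where $\alpha$ is the normalizing constant such that $\sum_{j\in J} a_j=1$ and $\gamma\in(0,1/4)$ is the solution of $0.13\gamma/\sqrt{1-4\gamma}=0.0056$. (2) There exist $j_n\in J$, $\beta_n\in\Theta_{j_n}$ and a sequence $\{\varepsilon_n\}$ of positive numbers such that $$\max\bigl(D(f_o\|f_{\beta_n,j_n}),V(f_o\|f_{\beta_n,j_n})\bigr)+\frac{\eta_{j_n}}{n}\le\varepsilon_n^2 .$$ (3) For each such $j_n$ there exists a metric $d_{j_n}$ on $\Theta_{j_n}$ such that $$\int f_o\left(\log\frac{f_{\eta,j_n}}{f_{\theta,j_n}}\right)^2d\mu\le K_0'\,d_{j_n}^2(\eta,\theta)\quad\text{for all }\eta,\theta\in\Theta_{j_n},$$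 and $D(f_o\|f_{\theta,j_n})\le K_0''\,V(f_o\|f_{\theta,j_n})$ for all $\theta\in\Theta_{j_n}$, where $K_0',K_0''$ are constants independent of $n$. (4) There exist constants $b_1\ge0$ and $K_4$, independent of $n$, such that $N(\Theta_{j_n},\varepsilon_n,d_{j_n})\le(A_{j_n}^{b_1}K_4)^{m_{j_n}}$. (5) There exist constants $b_2\ge0$ and $K_5$, independent of $n$, such that for any $\theta_1\in\Theta_{j_n}$, $$\frac{\pi_{j_n}(B_{d_{j_n},j_n}(\theta_1,\varepsilon_n))}{\pi_{j_n}(B_{d_{j_n},j_n}(\beta_n,\varepsilon_n))}\le(A_{j_n}^{b_2}K_5)^{m_{j_n}} .$$ (6) $\varepsilon_n\to0$ and $n\varepsilon_n^2\to\infty$ as $n\to\infty$. Then, with the weights $a_j=\alpha\exp\left(-\left(1+\frac{1-4\gamma}{8}\right)\eta_j\right)$, $j\in J$, in the sieve prior $\tilde\pi=\sum_{j\in J}a_j\tilde\pi_j$, there exist positive constants $c,K_1,K_2$ independent of $n$ such that $$\tilde\pi\bigl(\tilde B_{d_H}(K_1\varepsilon_n)^c\mid X_1,\dots,X_n\bigr)\le c\exp(-K_2n\varepsilon_n^2)$$ except on a set of $P_{f_o}^n$-probability converging to zero as $n\to\infty$.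
   Context: Setting. $X_1,\dots,X_n$ are i.i.d. from a distribution with true density $f_o$ with respect to a measure $\mu$ on a sample space $(\mathcal S,\mathcal B)$; $P_{f_o}^n$ denotes their joint law. $J$ is a countable index set. For each $j\in J$, $\Theta_j$ is a (finite-dimensional) parameter space and $\{f_{\theta,j}:\theta\in\Theta_j\}$ is a family of probability densities with respect to $\mu$; $\pi_j$ is a prior probability measure on $\Theta_j$ and $\tilde\pi_j$ is the prior it induces on densities via $\theta\mapsto f_{\theta,j}$. The sieve prior is $\tilde\pi=\sum_{j\in J}a_j\tilde\pi_j$ with $a_j\ge0$, $\sum_ja_j=1$. Hellinger distance: $d_H(f,g)=\sqrt{\int(\sqrt f-\sqrt g)^2d\mu}$. $\tilde B_{d_H}(s)=\{f: d_H(f,f_o)\le s\}$ (among the densities in $\bigcup_j\{f_{\theta,j}:\theta\in\Theta_j\}$), and the posterior probability of its complement is $$\tilde\pi(\tilde B_{d_H}(s)^c\mid X_1,\dots,X_n)=\frac{\sum_ja_j\int_{\{\theta\in\Theta_j:\,d_H(f_{\theta,j},f_o)>s\}}\prod_{i=1}^n\frac{f_{\theta,j}(X_i)}{f_o(X_i)}\,d\pi_j(\theta)}{\sum_ja_j\int_{\Theta_j}\prod_{i=1}^n\frac{f_{\theta,j}(X_i)}{f_o(X_i)}\,d\pi_j(\theta)} .$$ Notation. $B_{d_H,j}(\eta,r)=\{\theta\in\Theta_j:d_H(f_{\eta,j},f_{\theta,j})\le r\}$. $d_{j,\infty}(\theta,\eta)=\|\log f_{\theta,j}-\log f_{\eta,j}\|_\infty$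 (sup norm). For a metric $d'$, $N(B,\delta,d')$ is the $\delta$-covering number: the smallest number of $d'$-balls of radius $\delta$ needed to cover $B$. $D(f\|g)=\int f\log(f/g)\,d\mu$ and $V(f\|g)=\int f(\log(f/g))^2d\mu$. For a metric $d_{j_n}$ on $\Theta_{j_n}$, $B_{d_{j_n},j_n}(\theta,\varepsilon)$ is the $d_{j_n}$-ball in $\Theta_{j_n}$ centered at $\theta$ with radius $\varepsilon$. *)

theory Defs
  imports "HOL-Probability.Probability"
begin

definition prob_density :: "'s measure \<Rightarrow> ('s \<Rightarrow> real) \<Rightarrow> bool" where
  "prob_density M f \<longleftrightarrow>
     f \<in> borel_measurable M \<and> (\<forall>x\<in>space M. 0 \<le> f x) \<and> (\<integral>\<^sup>+x. ennreal (f x) \<partial>M) = 1"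

definition sample_law :: "'s measure \<Rightarrow> ('s \<Rightarrow> real) \<Rightarrow> nat \<Rightarrow> (nat \<Rightarrow> 's) measure" where
  "sample_law M f n = (\<Pi>\<^sub>M i\<in>{..<n}. density M (\<lambda>x. ennreal (f x)))"

definition hellinger :: "'s measure \<Rightarrow> ('s \<Rightarrow> real) \<Rightarrow> ('s \<Rightarrow> real) \<Rightarrow> real" where
  "hellinger M f g = sqrt (\<integral>x. (sqrt (f x) - sqrt (g x))\<^sup>2 \<partial>M)"

text \<open>
  The logarithm of \<open>a / b\<close> for nonnegative \<open>a\<close>, \<open>b\<close>. Densities may vanish, and the
  library's \<open>ln 0 = 0\<close> would make densities with different supports look close, so the
  value is extended real, with \<open>log (0/0) = 0\<close>, \<open>log (a/0) = \<infinity>\<close> and \<open>log (0/b) = -\<infinity>\<close>.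
\<close>

definition log_ratio :: "real \<Rightarrow> real \<Rightarrow> ereal" where
  "log_ratio a b =
     (if a = b then 0 else if b = 0 then \<infinity> else if a = 0 then - \<infinity> else ereal (ln (a / b)))"

definition sup_log_dist :: "'s measure \<Rightarrow> ('s \<Rightarrow> real) \<Rightarrow> ('s \<Rightarrow> real) \<Rightarrow> ereal" where
  "sup_log_dist M f g = (SUP x\<in>space M. \<bar>log_ratio (f x) (g x)\<bar>)"

text \<open>
  The integrals below are extended real, so that a divergent integral is infinite rather
  than \<open>0\<close>. In \<open>KL_div\<close> the integral of the negative part is at most \<open>1\<close> when \<open>f\<close> and \<open>g\<close>
  are probability densities, so the difference is well defined. Where \<open>f\<close> vanishes
  the integrand is \<open>0 * (-\<infinity>) = 0\<close>.
\<close>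

definition KL_div :: "'s measure \<Rightarrow> ('s \<Rightarrow> real) \<Rightarrow> ('s \<Rightarrow> real) \<Rightarrow> ereal" where
  "KL_div M f g =
     enn2ereal (\<integral>\<^sup>+x. e2ennreal (ereal (f x) * log_ratio (f x) (g x)) \<partial>M)
   - enn2ereal (\<integral>\<^sup>+x. e2ennreal (- (ereal (f x) * log_ratio (f x) (g x))) \<partial>M)"

definition sq_log_integral ::
  "'s measure \<Rightarrow> ('s \<Rightarrow> real) \<Rightarrow> ('s \<Rightarrow> real) \<Rightarrow> ('s \<Rightarrow> real) \<Rightarrow> ereal" where
  "sq_log_integral M h f g =
     enn2ereal (\<integral>\<^sup>+x. e2ennreal (ereal (h x) * (log_ratio (f x) (g x))\<^sup>2) \<partial>M)"

definition KL_var :: "'s measure \<Rightarrow> ('s \<Rightarrow> real) \<Rightarrow> ('s \<Rightarrow> real) \<Rightarrow> ereal" where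
  "KL_var M f g = sq_log_integral M f f g"

text \<open>
  Covering by closed balls with centres in the whole space \<open>T\<close>, not necessarily in \<open>B\<close>.
  The value is \<open>\<infinity>\<close> if there is no finite cover.
\<close>

definition covering_number ::
  "'t set \<Rightarrow> ('t \<Rightarrow> 't \<Rightarrow> ereal) \<Rightarrow> 't set \<Rightarrow> real \<Rightarrow> enat" where
  "covering_number T d B \<delta> =
     (INF S\<in>{S. finite S \<and> S \<subseteq> T \<and> B \<subseteq> (\<Union>c\<in>S. {\<theta>\<in>T. d c \<theta> \<le> ereal \<delta>})}. enat (card S))"

definition hellinger_param_ball ::
  "'s measure \<Rightarrow> 't set \<Rightarrow> ('t \<Rightarrow> 's \<Rightarrow> real) \<Rightarrow> 't \<Rightarrow> real \<Rightarrow> 't set" where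
  "hellinger_param_ball M T f \<eta> r = {\<theta>\<in>T. hellinger M (f \<eta>) (f \<theta>) \<le> r}"

definition sieve_eta ::
  "real \<Rightarrow> ('j \<Rightarrow> real) \<Rightarrow> ('j \<Rightarrow> real) \<Rightarrow> ('j \<Rightarrow> real) \<Rightarrow> 'j \<Rightarrow> real" where
  "sieve_eta \<gamma> A m C j =
     4 * m j / (1 - 4 * \<gamma>) * ln (46.2 * A j * sqrt (1 - 4 * \<gamma>) / \<gamma>) + 8 * C j / (1 - 4 * \<gamma>)"

definition sieve_weight ::
  "real \<Rightarrow> real \<Rightarrow> ('j \<Rightarrow> real) \<Rightarrow> ('j \<Rightarrow> real) \<Rightarrow> ('j \<Rightarrow> real) \<Rightarrow> 'j \<Rightarrow> real" where
  "sieve_weight \<gamma> \<alpha> A m C j = \<alpha> * exp (- (1 + (1 - 4 * \<gamma>) / 8) * sieve_eta \<gamma> A m C j)"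

text \<open>
  \<open>sieve_mass\<close> integrates the likelihood ratio against the sieve prior over all parameters
  (of any index) whose density satisfies \<open>P\<close>; the sum over \<open>J\<close> is an integral with respect
  to counting measure. A factor with \<open>f\<^sub>o (X i) = 0\<close> is immaterial, since such samples
  form a null set of the law of the sample.
\<close>

definition sieve_mass ::
  "('s \<Rightarrow> real) \<Rightarrow> 'j set \<Rightarrow> ('j \<Rightarrow> 't set) \<Rightarrow> ('j \<Rightarrow> 't \<Rightarrow> 's \<Rightarrow> real) \<Rightarrow> ('j \<Rightarrow> 't measure) \<Rightarrow>
   ('j \<Rightarrow> real) \<Rightarrow> nat \<Rightarrow> (nat \<Rightarrow> 's) \<Rightarrow> (('s \<Rightarrow> real) \<Rightarrow> bool) \<Rightarrow> ennreal" where
  "sieve_mass f\<^sub>o J \<Theta> f \<pi> a n X P =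
     (\<integral>\<^sup>+j. ennreal (a j) *
        (\<integral>\<^sup>+\<theta>\<in>{\<theta>\<in>\<Theta> j. P (f j \<theta>)}. ennreal (\<Prod>i<n. f j \<theta> (X i) / f\<^sub>o (X i)) \<partial>\<pi> j)
      \<partial>count_space J)"

text \<open>
  In \<open>ennreal\<close>, \<open>0 / 0 = 0\<close> and \<open>x / \<infinity> = 0\<close>. The denominator below has expectation at most
  \<open>1\<close> under the law of the sample, so it is almost surely finite; it is almost surely
  positive if the prior charges the set of densities that are positive wherever \<open>f\<^sub>o\<close> is.
\<close>

definition sieve_posterior ::
  "('s \<Rightarrow> real) \<Rightarrow> 'j set \<Rightarrow> ('j \<Rightarrow> 't set) \<Rightarrow> ('j \<Rightarrow> 't \<Rightarrow> 's \<Rightarrow> real) \<Rightarrow> ('j \<Rightarrow> 't measure) \<Rightarrow>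
   ('j \<Rightarrow> real) \<Rightarrow> nat \<Rightarrow> (nat \<Rightarrow> 's) \<Rightarrow> (('s \<Rightarrow> real) \<Rightarrow> bool) \<Rightarrow> ennreal" where
  "sieve_posterior f\<^sub>o J \<Theta> f \<pi> a n X P =
     sieve_mass f\<^sub>o J \<Theta> f \<pi> a n X P / sieve_mass f\<^sub>o J \<Theta> f \<pi> a n X (\<lambda>_. True)"

end

theory Submission
  imports Defs
begin

text \<open>
  Idea. A likelihood ratio test of \<open>f\<^sub>o\<close> against a density \<open>f\<^sub>c\<close> at Hellinger distance of
  order \<open>s\<close> from \<open>f\<^sub>o\<close> also has exponentially small error \<open>exp (- n s\<^sup>2 / 8)\<close> at every density within
  sup-log distance \<open>0.0224 s\<close> of \<open>f\<^sub>c\<close>. Assumption (1) therefore bounds, uniformly in \<open>s\<close>, the number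
  of tests needed for the Hellinger shell \<open>s < d\<^sub>H \<le> 2 s\<close> of the model \<open>j\<close> by
  \<open>(A\<^sub>j / 0.0056) powr m\<^sub>j \<le> exp \<eta>\<^sub>j\<close>, and no chaining is needed. With \<open>s = K\<^sub>1 \<epsilon>\<^sub>n\<close>, the models with
  \<open>\<eta>\<^sub>j\<close> at most a small multiple of \<open>n s\<^sup>2\<close> are handled by tests (the union over \<open>j\<close> is controlled by
  \<open>\<Sum> exp (- \<eta>\<^sub>j) \<le> \<Sum> exp (- C\<^sub>j) \<le> 1\<close>), the others by their prior weight. For the denominator,
  Chebyshev's inequality holds for each parameter in the ball around \<open>\<beta>\<^sub>n\<close>, so by Markov's
  inequality most of the prior mass of the ball has a likelihood ratio at least \<open>exp (- K n \<epsilon>\<^sub>n\<^sup>2)\<close>;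
  (4) and (5) bound this prior mass from below.
\<close>

section \<open>Independent samples\<close>

text \<open>A cover of radius proportional to \<open>s\<close> is what frees the number of tests
  from \<open>s\<close>. The price is that replacing a density by its centre changes each factor of
  the likelihood ratio by up to \<open>exp \<delta>\<close> with \<delta> of order \<open>s\<close>;
  over \<open>n\<close> observations such factors would swamp the gain
  \<open>exp (- n * s^2 / 8)\<close>. So the comparison is made under the integral: both densities
  have mass 1, the first-order term cancels, and an error of order \<open>s^2\<close> with a small
  constant remains. The exponent \<open>(1 + \<kappa>) * \<eta> j\<close> of the weights, with
  \<open>\<kappa> = (1 - 4 * \<gamma>) / 8\<close>, splits in two: \<open>exp (- \<eta> j)\<close>
  makes the sum over models converge, and \<open>exp (- \<kappa> * \<eta> j)\<close> is the decay
  available for models without tests. With \<open>x = n * \<epsilon>^2\<close> the denominator is at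
  least a constant times \<open>exp (- K * x)\<close>, and \<open>K1\<close> is taken so large that
  the integral of the numerator is of order \<open>exp (- 2 * (K + 1) * x)\<close>. Half of this
  exponent pays for Markov's inequality, the other half beats the denominator by
  \<open>exp (- x)\<close>.\<close>

lemma nn_integral_PiM_power:
  assumes "prob_space P" "h \<in> borel_measurable P" "finite I"
  shows "(\<integral>\<^sup>+X. (\<Prod>i\<in>I. h (X i)) \<partial>Pi\<^sub>M I (\<lambda>_. P)) = (integral\<^sup>N P h) ^ card I"
proof -
  interpret prob_space P by fact
  interpret product_sigma_finite "\<lambda>_. P" by unfold_locales
  show ?thesis
    using product_nn_integral_prod[of I "\<lambda>_. h"] assms by simp
qed

lemma
  fixes Y :: "'s \<Rightarrow> real" and I :: "'i set"
  assumes P: "prob_space P" and Y: "integrable P Y" "integrable P (\<lambda>x. (Y x)\<^sup>2)"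
    and zero: "(\<integral>x. Y x \<partial>P) = 0" and I: "finite I"
  shows integrable_sum_square_PiM: "integrable (Pi\<^sub>M I (\<lambda>_. P)) (\<lambda>X. (\<Sum>i\<in>I. Y (X i))\<^sup>2)"
    and integral_sum_square_PiM:
      "(\<integral>X. (\<Sum>i\<in>I. Y (X i))\<^sup>2 \<partial>Pi\<^sub>M I (\<lambda>_. P)) = real (card I) * (\<integral>x. (Y x)\<^sup>2 \<partial>P)"
proof -
  interpret prob_space P by fact
  interpret product_sigma_finite "\<lambda>_. P" by unfold_locales
  \<comment> \<open>\<open>F i k l\<close> is the factor that coordinate \<open>l\<close>
    contributes to \<open>Y (X i) * Y (X k)\<close>. Padding with the constant 1 gives a product
    over all of \<open>I\<close>, the form in which the product-measure lemmas express
    independence.\<close>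
  define F where "F i k l x = (if i = k then if l = i then (Y x)\<^sup>2 else 1
      else if l = i \<or> l = k then Y x else 1)" for i k l :: 'i and x
  have F: "(\<Prod>l\<in>I. F i k l (X l)) = Y (X i) * Y (X k)" if "i \<in> I" "k \<in> I" for i k :: 'i and X :: "'i \<Rightarrow> 's"
  proof (cases "i = k")
    case True
    then show ?thesis using that I by (simp add: F_def prod.delta power2_eq_square)
  next
    case False
    have "(\<Prod>l\<in>I. F i k l (X l)) = (\<Prod>l\<in>{i,k}. Y (X l))"
      using False that I by (intro prod.mono_neutral_cong_right) (auto simp: F_def)
    then show ?thesis using False by simp
  qed
  have Fint: "integrable P (F i k l)" for i k l
    using Y by (cases "i = k"; cases "l = i"; cases "l = k") (simp_all add: F_def [abs_def])
  have int: "integrable (Pi\<^sub>M I (\<lambda>_. P)) (\<lambda>X. Y (X i) * Y (X k))" if "i \<in> I" "k \<in> I" for i k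
    using product_integrable_prod[of I "F i k"] I Fint by (simp add: F that)
  have val: "(\<integral>X. Y (X i) * Y (X k) \<partial>Pi\<^sub>M I (\<lambda>_. P)) = (if i = k then \<integral>x. (Y x)\<^sup>2 \<partial>P else 0)"
    if "i \<in> I" "k \<in> I" for i k
  proof -
    have "(\<integral>X. Y (X i) * Y (X k) \<partial>Pi\<^sub>M I (\<lambda>_. P)) = (\<Prod>l\<in>I. integral\<^sup>L P (F i k l))"
      using product_integral_prod[of I "F i k"] I Fint by (simp add: F that)
    also have "\<dots> = (if i = k then \<integral>x. (Y x)\<^sup>2 \<partial>P else 0)"
    proof (cases "i = k")
      case True
      then have "integral\<^sup>L P (F i k l) = (if l = i then \<integral>x. (Y x)\<^sup>2 \<partial>P else 1)" for l
        by (simp add: F_def [abs_def] prob_space)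
      then show ?thesis using True I that by simp
    next
      case False
      then have "integral\<^sup>L P (F i k i) = 0" by (simp add: F_def [abs_def] zero)
      then show ?thesis using False I that by (auto simp: prod_zero_iff)
    qed
    finally show ?thesis .
  qed
  have sq: "(\<Sum>i\<in>I. Y (X i))\<^sup>2 = (\<Sum>i\<in>I. \<Sum>k\<in>I. Y (X i) * Y (X k))" for X
    by (simp add: power2_eq_square sum_product)
  show "integrable (Pi\<^sub>M I (\<lambda>_. P)) (\<lambda>X. (\<Sum>i\<in>I. Y (X i))\<^sup>2)"
    unfolding sq using int by (intro Bochner_Integration.integrable_sum) auto
  have "(\<integral>X. (\<Sum>i\<in>I. Y (X i))\<^sup>2 \<partial>Pi\<^sub>M I (\<lambda>_. P)) =
      (\<Sum>i\<in>I. \<Sum>k\<in>I. if i = k then \<integral>x. (Y x)\<^sup>2 \<partial>P else 0)"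
    unfolding sq using int val
    by (subst Bochner_Integration.integral_sum, force, intro sum.cong refl)
       (subst Bochner_Integration.integral_sum, auto intro!: sum.cong)
  also have "\<dots> = real (card I) * (\<integral>x. (Y x)\<^sup>2 \<partial>P)" using I by simp
  finally show "(\<integral>X. (\<Sum>i\<in>I. Y (X i))\<^sup>2 \<partial>Pi\<^sub>M I (\<lambda>_. P)) = real (card I) * (\<integral>x. (Y x)\<^sup>2 \<partial>P)" .
qed

text \<open>Chebyshev's inequality for the centred sum: the mean may lie below \<open>D\<close>,
  which only helps, and the variance is at most the second moment, hence at most \<open>V\<close>.
  Upper bounds on both are all that the evidence estimate has at hand.\<close>

lemma iid_sum_deviation:
  fixes L :: "'s \<Rightarrow> real" and n :: nat and D V t :: real
  assumes P: "prob_space P" and L: "integrable P L" "integrable P (\<lambda>x. (L x)\<^sup>2)"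
    and D: "(\<integral>x. L x \<partial>P) \<le> D" and V: "(\<integral>x. (L x)\<^sup>2 \<partial>P) \<le> V"
    and "0 < t" "0 < n"
  shows "measure (Pi\<^sub>M {..<n} (\<lambda>_. P))
      {X \<in> space (Pi\<^sub>M {..<n} (\<lambda>_. P)). (\<Sum>i<n. L (X i)) \<ge> n * (D + t)} \<le> V / (n * t\<^sup>2)"
proof -
  interpret prob_space P by fact
  let ?S = "Pi\<^sub>M {..<n} (\<lambda>_. P)"
  interpret S: prob_space ?S by (intro prob_space_PiM) (rule P)
  have [measurable]: "L \<in> borel_measurable P" using L by auto
  define Y where "Y x = L x - (\<integral>x. L x \<partial>P)" for x
  have Y: "integrable P Y" using L by (simp add: Y_def [abs_def])
  have Y_sq: "(Y x)\<^sup>2 = (L x)\<^sup>2 - 2 * (\<integral>x. L x \<partial>P) * L x + (\<integral>x. L x \<partial>P)\<^sup>2" for x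
    by (simp add: Y_def power2_eq_square algebra_simps)
  have Y2: "integrable P (\<lambda>x. (Y x)\<^sup>2)" unfolding Y_sq using L by auto
  have Y0: "(\<integral>x. Y x \<partial>P) = 0" using L by (simp add: Y_def [abs_def] prob_space)
  have "(\<integral>x. (Y x)\<^sup>2 \<partial>P) = (\<integral>x. (L x)\<^sup>2 \<partial>P) - (\<integral>x. L x \<partial>P)\<^sup>2"
    unfolding Y_sq using L by (simp add: prob_space power2_eq_square)
  also have "\<dots> \<le> V" using V by (smt (verit) zero_le_power2)
  finally have YV: "(\<integral>x. (Y x)\<^sup>2 \<partial>P) \<le> V" .
  note Ysum = integrable_sum_square_PiM[OF P Y Y2 Y0, of "{..<n}"]
    integral_sum_square_PiM[OF P Y Y2 Y0, of "{..<n}"]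
  have "measure ?S {X \<in> space ?S. (\<Sum>i<n. L (X i)) \<ge> n * (D + t)}
      \<le> measure ?S {X \<in> space ?S. (\<Sum>i<n. Y (X i))\<^sup>2 \<ge> (n * t)\<^sup>2}"
  proof (rule S.finite_measure_mono)
    show "{X \<in> space ?S. (\<Sum>i<n. Y (X i))\<^sup>2 \<ge> (n * t)\<^sup>2} \<in> sets ?S"
      unfolding Y_def by measurable
    show "{X \<in> space ?S. (\<Sum>i<n. L (X i)) \<ge> n * (D + t)}
        \<subseteq> {X \<in> space ?S. (\<Sum>i<n. Y (X i))\<^sup>2 \<ge> (n * t)\<^sup>2}"
    proof safe
      fix X assume "(\<Sum>i<n. L (X i)) \<ge> n * (D + t)"
      moreover have "(\<Sum>i<n. Y (X i)) = (\<Sum>i<n. L (X i)) - n * (\<integral>x. L x \<partial>P)"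
        by (simp add: Y_def sum_subtractf)
      moreover have "n * (\<integral>x. L x \<partial>P) \<le> n * D" using D by (simp add: mult_left_mono)
      ultimately have "n * t \<le> (\<Sum>i<n. Y (X i))" by (simp add: distrib_left)
      then show "(\<Sum>i<n. Y (X i))\<^sup>2 \<ge> (n * t)\<^sup>2" using \<open>0 < t\<close> by (intro power_mono) auto
    qed
  qed
  also have "\<dots> \<le> (\<integral>X. (\<Sum>i<n. Y (X i))\<^sup>2 \<partial>?S) / (n * t)\<^sup>2"
    using \<open>0 < t\<close> \<open>0 < n\<close> Ysum(1) by (intro integral_Markov_inequality_measure[where A="space ?S"]) auto
  also have "\<dots> = (\<integral>x. (Y x)\<^sup>2 \<partial>P) / (n * t\<^sup>2)"
    using Ysum(2) \<open>0 < n\<close> by (simp add: power2_eq_square)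
  also have "\<dots> \<le> V / (n * t\<^sup>2)"
    using YV \<open>0 < t\<close> by (intro divide_right_mono) auto
  finally show ?thesis .
qed

lemma AE_PiM_all:
  assumes "prob_space P" "AE x in P. Q x" "finite I"
  shows "AE X in Pi\<^sub>M I (\<lambda>_. P). \<forall>i\<in>I. Q (X i)"
  using assms by (intro AE_finite_allI) (auto intro!: AE_PiM_component[where M="\<lambda>_. P"])

text \<open>For each \<theta> Chebyshev's inequality yields an event that depends on \<theta>, and a
  union over \<open>B\<close> would be uncontrolled. Fubini averages instead: the expected
  \<nu>-mass of the bad parameters is at most \<open>V / (n * t^2)\<close> times that of
  \<open>B\<close>, so outside a single event less than half of \<open>B\<close> is bad, and the
  good part alone gives the bound. The logarithm is applied for one \<theta> at a time, never to the
  average.\<close>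

lemma evidence_lower_bound:
  fixes q :: "'t \<Rightarrow> 's \<Rightarrow> real" and \<nu> :: "'t measure" and n :: nat and D V t :: real
  assumes P: "prob_space P" and \<nu>: "prob_space \<nu>" and B: "B \<in> sets \<nu>"
    and q_meas: "case_prod q \<in> borel_measurable (\<nu> \<Otimes>\<^sub>M P)"
    and pos: "\<And>\<theta>. \<theta> \<in> B \<Longrightarrow> AE x in P. q \<theta> x > 0"
    and int: "\<And>\<theta>. \<theta> \<in> B \<Longrightarrow> integrable P (\<lambda>x. - ln (q \<theta> x))"
      "\<And>\<theta>. \<theta> \<in> B \<Longrightarrow> integrable P (\<lambda>x. (- ln (q \<theta> x))\<^sup>2)"
    and D: "\<And>\<theta>. \<theta> \<in> B \<Longrightarrow> (\<integral>x. - ln (q \<theta> x) \<partial>P) \<le> D"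
    and V: "\<And>\<theta>. \<theta> \<in> B \<Longrightarrow> (\<integral>x. (- ln (q \<theta> x))\<^sup>2 \<partial>P) \<le> V"
    and t: "0 < t" and n: "0 < n" and B_pos: "measure \<nu> B > 0"
  obtains E where "E \<in> sets (Pi\<^sub>M {..<n} (\<lambda>_. P))"
    "measure (Pi\<^sub>M {..<n} (\<lambda>_. P)) E \<le> 2 * V / (n * t\<^sup>2)"
    "\<And>X. X \<in> space (Pi\<^sub>M {..<n} (\<lambda>_. P)) - E \<Longrightarrow>
       ennreal (measure \<nu> B / 2 * exp (- real n * (D + t))) \<le>
         (\<integral>\<^sup>+\<theta>\<in>B. ennreal (\<Prod>i<n. q \<theta> (X i)) \<partial>\<nu>)"
proof -
  let ?S = "Pi\<^sub>M {..<n} (\<lambda>_. P)"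
  interpret P: prob_space P by fact
  interpret \<nu>: prob_space \<nu> by fact
  interpret S: prob_space ?S by (intro prob_space_PiM) (rule P)
  interpret pair_sigma_finite ?S \<nu> by unfold_locales
  note [measurable] = B
  have qi[measurable]: "(\<lambda>(X, \<theta>). q \<theta> (X i)) \<in> borel_measurable (?S \<Otimes>\<^sub>M \<nu>)" if "i < n" for i
  proof -
    have [measurable]: "(\<lambda>X. X i) \<in> ?S \<rightarrow>\<^sub>M P"
      using that by (intro measurable_component_singleton) simp
    have "(\<lambda>(X, \<theta>). (\<theta>, X i)) \<in> ?S \<Otimes>\<^sub>M \<nu> \<rightarrow>\<^sub>M \<nu> \<Otimes>\<^sub>M P" by measurable
    from measurable_compose[OF this q_meas] show ?thesis by (simp add: case_prod_beta)
  qed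
  define e where "e = exp (- real n * (D + t))"
  define bad where "bad X \<theta> \<longleftrightarrow> \<theta> \<in> B \<and> (\<Prod>i<n. q \<theta> (X i)) < e" for X \<theta>
  have prod_meas[measurable]: "(\<lambda>(X, \<theta>). \<Prod>i<n. q \<theta> (X i)) \<in> borel_measurable (?S \<Otimes>\<^sub>M \<nu>)"
    unfolding case_prod_beta using qi by (intro borel_measurable_prod) (simp add: case_prod_beta)
  have bad_meas[measurable]: "Measurable.pred (?S \<Otimes>\<^sub>M \<nu>) (\<lambda>(X, \<theta>). bad X \<theta>)"
    unfolding bad_def by measurable
  have bad_prob: "emeasure ?S {X \<in> space ?S. bad X \<theta>} \<le> ennreal (V / (n * t\<^sup>2))" if "\<theta> \<in> B" for \<theta>
  proof -
    have "\<theta> \<in> space \<nu>" using sets.sets_into_space[OF B] that by auto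
    then have qm[measurable]: "q \<theta> \<in> borel_measurable P"
      using measurable_Pair2[OF q_meas] by simp
    have "measure ?S {X \<in> space ?S. bad X \<theta>}
        \<le> measure ?S {X \<in> space ?S. (\<Sum>i<n. - ln (q \<theta> (X i))) \<ge> n * (D + t)}"
    \<comment> \<open>The factors are positive only almost surely, and without positivity
      \<open>ln\<close> does not turn the product into a sum.\<close>
    proof (rule S.finite_measure_mono_AE)
      show "{X \<in> space ?S. (\<Sum>i<n. - ln (q \<theta> (X i))) \<ge> n * (D + t)} \<in> sets ?S" by measurable
      have "AE X in ?S. \<forall>i\<in>{..<n}. q \<theta> (X i) > 0"
        by (intro AE_PiM_all P pos that) auto
      then show "AE X in ?S. X \<in> {X \<in> space ?S. bad X \<theta>} \<longrightarrow>
          X \<in> {X \<in> space ?S. (\<Sum>i<n. - ln (q \<theta> (X i))) \<ge> n * (D + t)}"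
      proof eventually_elim
        case (elim X)
        show ?case
        proof (intro impI CollectI conjI)
          assume b: "X \<in> {X \<in> space ?S. bad X \<theta>}"
          then show "X \<in> space ?S" by simp
          have p: "0 < (\<Prod>i<n. q \<theta> (X i))" using elim by (intro prod_pos) auto
          have "ln (\<Prod>i<n. q \<theta> (X i)) < ln e"
            using b p by (subst ln_less_cancel_iff) (auto simp: bad_def e_def)
          then have "ln (\<Prod>i<n. q \<theta> (X i)) < - real n * (D + t)"
            by (simp add: e_def)
          moreover have "ln (\<Prod>i<n. q \<theta> (X i)) = (\<Sum>i<n. ln (q \<theta> (X i)))"
            using elim by (intro ln_prod finite_lessThan) (metis less_irrefl)
          ultimately show "(\<Sum>i<n. - ln (q \<theta> (X i))) \<ge> n * (D + t)"
            by (simp add: sum_negf)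
        qed
      qed
    qed
    also have "\<dots> \<le> V / (n * t\<^sup>2)"
      using int[OF that] D[OF that] V[OF that] by (intro iid_sum_deviation P t n) auto
    finally show ?thesis by (simp add: S.emeasure_eq_measure ennreal_leI)
  qed
  define g where "g X = emeasure \<nu> {\<theta> \<in> space \<nu>. bad X \<theta>}" for X
  have g_eq: "g X = (\<integral>\<^sup>+\<theta>. indicator {(X, \<theta>). bad X \<theta>} (X, \<theta>) \<partial>\<nu>)" if "X \<in> space ?S" for X
  proof -
    have "{\<theta> \<in> space \<nu>. bad X \<theta>} \<in> sets \<nu>" using bad_meas that by measurable
    then have "g X = (\<integral>\<^sup>+\<theta>. indicator {\<theta> \<in> space \<nu>. bad X \<theta>} \<theta> \<partial>\<nu>)" by (simp add: g_def)
    also have "\<dots> = (\<integral>\<^sup>+\<theta>. indicator {(X, \<theta>). bad X \<theta>} (X, \<theta>) \<partial>\<nu>)"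
      by (intro nn_integral_cong) (auto split: split_indicator)
    finally show ?thesis .
  qed
  have ind_meas: "(\<lambda>(X, \<theta>). indicator {(X, \<theta>). bad X \<theta>} (X, \<theta>) :: ennreal) \<in> borel_measurable (?S \<Otimes>\<^sub>M \<nu>)"
    unfolding indicator_def of_bool_def case_prod_beta' mem_Collect_eq
    using bad_meas by (intro measurable_If) (auto simp: case_prod_beta' pred_def)
  have [measurable]: "g \<in> borel_measurable ?S"
    using \<nu>.borel_measurable_nn_integral[OF ind_meas] by (simp add: g_eq cong: measurable_cong)
  define b where "b = measure \<nu> B"
  have b: "emeasure \<nu> B = ennreal b" "0 < b"
    using B_pos by (auto simp: b_def \<nu>.emeasure_eq_measure)
  \<comment> \<open>The condition says that bad parameters fill at least half of \<open>B\<close>;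
    it is scaled to the form of Markov's inequality.\<close>
  define E where "E = {X \<in> space ?S. 1 \<le> ennreal (2 / b) * g X}"
  have E_sets: "E \<in> sets ?S" unfolding E_def by measurable
  have sec_meas[measurable]: "{\<theta> \<in> space \<nu>. bad X \<theta>} \<in> sets \<nu>" if "X \<in> space ?S" for X
    using bad_meas that by measurable
  have "(\<integral>\<^sup>+X. g X \<partial>?S) = (\<integral>\<^sup>+X. (\<integral>\<^sup>+\<theta>. indicator {(X, \<theta>). bad X \<theta>} (X, \<theta>) \<partial>\<nu>) \<partial>?S)"
    by (intro nn_integral_cong g_eq)
  also have "\<dots> = (\<integral>\<^sup>+\<theta>. (\<integral>\<^sup>+X. indicator {(X, \<theta>). bad X \<theta>} (X, \<theta>) \<partial>?S) \<partial>\<nu>)"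
    using ind_meas by (intro Fubini'[symmetric])
  also have "\<dots> \<le> (\<integral>\<^sup>+\<theta>. ennreal (V / (n * t\<^sup>2)) * indicator B \<theta> \<partial>\<nu>)"
  proof (intro nn_integral_mono)
    fix \<theta> assume th: "\<theta> \<in> space \<nu>"
    have "{X \<in> space ?S. bad X \<theta>} \<in> sets ?S"
      using bad_meas th by measurable
    then have "emeasure ?S {X \<in> space ?S. bad X \<theta>} = (\<integral>\<^sup>+X. indicator {X \<in> space ?S. bad X \<theta>} X \<partial>?S)"
      by (rule nn_integral_indicator[symmetric])
    also have "\<dots> = (\<integral>\<^sup>+X. indicator {(X, \<theta>). bad X \<theta>} (X, \<theta>) \<partial>?S)"
      by (intro nn_integral_cong) (auto split: split_indicator)
    finally have "(\<integral>\<^sup>+X. indicator {(X, \<theta>). bad X \<theta>} (X, \<theta>) \<partial>?S) = emeasure ?S {X \<in> space ?S. bad X \<theta>}" ..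
    also have "\<dots> \<le> ennreal (V / (n * t\<^sup>2)) * indicator B \<theta>"
      using bad_prob[of \<theta>] by (cases "\<theta> \<in> B") (auto simp: bad_def)
    finally show "(\<integral>\<^sup>+X. indicator {(X, \<theta>). bad X \<theta>} (X, \<theta>) \<partial>?S) \<le> ennreal (V / (n * t\<^sup>2)) * indicator B \<theta>" .
  qed
  also have "\<dots> = ennreal (V / (n * t\<^sup>2)) * ennreal b" by (simp add: nn_integral_cmult_indicator b)
  finally have g_int: "(\<integral>\<^sup>+X. g X \<partial>?S) \<le> ennreal (V / (n * t\<^sup>2)) * ennreal b" .
  \<comment> \<open>A point of \<open>B\<close> shows that \<open>V\<close>, an upper bound for the
    integral of a square, is nonnegative; products in \<open>ennreal\<close> rely on this.\<close>
  obtain \<theta>0 where "\<theta>0 \<in> B" using B_pos by (metis less_irrefl measure_empty equals0I)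
  have "0 \<le> (\<integral>x. (- ln (q \<theta>0 x))\<^sup>2 \<partial>P)" by simp
  then have V0: "0 \<le> V" using V[OF \<open>\<theta>0 \<in> B\<close>] by linarith
  have "emeasure ?S E \<le> ennreal (2 / b) * (\<integral>\<^sup>+X. g X * indicator (space ?S) X \<partial>?S)"
    unfolding E_def by (intro order.trans[OF nn_integral_Markov_inequality[where A="space ?S"]]) auto
  also have "(\<integral>\<^sup>+X. g X * indicator (space ?S) X \<partial>?S) = (\<integral>\<^sup>+X. g X \<partial>?S)"
    by (intro nn_integral_cong) simp
  also have "ennreal (2 / b) * (\<integral>\<^sup>+X. g X \<partial>?S) \<le> ennreal (2 / b) * (ennreal (V / (n * t\<^sup>2)) * ennreal b)"
    by (intro mult_left_mono g_int) auto
  also have "\<dots> = ennreal (2 * V / (n * t\<^sup>2))"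
    using b(2) V0 by (simp add: ennreal_mult[symmetric])
  finally have E_prob: "measure ?S E \<le> 2 * V / (n * t\<^sup>2)"
    using V0 by (simp add: S.emeasure_eq_measure)
  show thesis
  proof (rule that[OF E_sets E_prob])
    fix X assume X: "X \<in> space ?S - E"
    define G where "G = B - {\<theta> \<in> space \<nu>. bad X \<theta>}"
    have G[measurable]: "G \<in> sets \<nu>" unfolding G_def using X by auto
    define w where "w = measure \<nu> {\<theta> \<in> space \<nu>. bad X \<theta>}"
    have "ennreal (2 / b) * ennreal w < 1"
      using X by (auto simp: E_def g_def w_def \<nu>.emeasure_eq_measure)
    then have "2 / b * w < 1"
      using b(2) by (simp add: ennreal_mult[symmetric] w_def)
    then have "w < b / 2" using b(2) by (simp add: field_simps)
    moreover have "measure \<nu> G = b - w"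
      unfolding G_def b_def w_def using X B sets.sets_into_space[OF B]
      by (intro \<nu>.finite_measure_Diff) (auto simp: bad_def)
    ultimately have G_ge: "b / 2 \<le> measure \<nu> G" by simp
    have "ennreal (b / 2 * e) \<le> ennreal e * ennreal (measure \<nu> G)"
      using G_ge by (simp add: ennreal_mult[symmetric] e_def mult.commute)
    also have "\<dots> = (\<integral>\<^sup>+\<theta>. ennreal e * indicator G \<theta> \<partial>\<nu>)"
      by (simp add: nn_integral_cmult_indicator \<nu>.emeasure_eq_measure)
    also have "\<dots> \<le> (\<integral>\<^sup>+\<theta>\<in>B. ennreal (\<Prod>i<n. q \<theta> (X i)) \<partial>\<nu>)"
      by (intro nn_integral_mono) (auto simp: G_def bad_def split: split_indicator intro!: ennreal_leI)
    finally show "ennreal (measure \<nu> B / 2 * exp (- real n * (D + t))) \<le>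
         (\<integral>\<^sup>+\<theta>\<in>B. ennreal (\<Prod>i<n. q \<theta> (X i)) \<partial>\<nu>)" by (simp add: b_def e_def)
  qed
qed

section \<open>Hellinger distance and tests\<close>

lemma prob_densityD:
  assumes "prob_density M f"
  shows "f \<in> borel_measurable M" "\<And>x. x \<in> space M \<Longrightarrow> 0 \<le> f x" "integrable M f" "(\<integral>x. f x \<partial>M) = 1"
proof -
  show m: "f \<in> borel_measurable M" and nn: "\<And>x. x \<in> space M \<Longrightarrow> 0 \<le> f x"
    using assms by (auto simp: prob_density_def)
  have "(\<integral>\<^sup>+x. ennreal (f x) \<partial>M) = ennreal 1" using assms by (simp add: prob_density_def)
  then have "has_bochner_integral M f 1"
    by (intro has_bochner_integral_nn_integral m) (auto intro: AE_I2 nn)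
  then show "integrable M f" "(\<integral>x. f x \<partial>M) = 1"
    by (auto simp: has_bochner_integral_iff)
qed

lemma prob_space_prob_density:
  assumes "prob_density M f" shows "prob_space (density M (\<lambda>x. ennreal (f x)))"
  using assms by (intro prob_spaceI) (simp add: prob_density_def emeasure_density cong: nn_integral_cong)

text \<open>The integral of \<open>sqrt (f * g)\<close> is the Hellinger affinity. The inequality of
  arithmetic and geometric means makes it finite, and expanding the square with both masses equal to
  1 ties it to the distance. Expectations of products over independent observations factor, so test
  errors come out as \<open>n\<close>-th powers of such integrals.\<close>

lemma
  assumes f: "prob_density M f" and g: "prob_density M g"
  shows integrable_sqrt_mult_density: "integrable M (\<lambda>x. sqrt (f x * g x))"
    and integrable_sqrt_diff_sq: "integrable M (\<lambda>x. (sqrt (f x) - sqrt (g x))\<^sup>2)"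
    and integral_sqrt_mult_density: "(\<integral>x. sqrt (f x * g x) \<partial>M) = 1 - (hellinger M f g)\<^sup>2 / 2"
proof -
  note [measurable] = prob_densityD(1)[OF f] prob_densityD(1)[OF g]
  note nn = prob_densityD(2)[OF f] prob_densityD(2)[OF g]
  note int = prob_densityD(3,4)[OF f] prob_densityD(3,4)[OF g]
  show *: "integrable M (\<lambda>x. sqrt (f x * g x))"
  proof (rule Bochner_Integration.integrable_bound[of M "\<lambda>x. (f x + g x) / 2"])
    show "integrable M (\<lambda>x. (f x + g x) / 2)" using int by simp
    show "AE x in M. norm (sqrt (f x * g x)) \<le> norm ((f x + g x) / 2)"
    proof (rule AE_I2)
      fix x assume "x \<in> space M"
      from arith_geo_mean_sqrt[OF nn[OF this]] nn[OF this]
      show "norm (sqrt (f x * g x)) \<le> norm ((f x + g x) / 2)" by simp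
    qed
  qed simp
  have eq: "(sqrt (f x) - sqrt (g x))\<^sup>2 = f x + g x - 2 * sqrt (f x * g x)" if "x \<in> space M" for x
    using nn[OF that] by (simp add: power2_diff real_sqrt_mult)
  show **: "integrable M (\<lambda>x. (sqrt (f x) - sqrt (g x))\<^sup>2)"
    using * int by (subst Bochner_Integration.integrable_cong[OF refl eq]) auto
  have "(\<integral>x. (sqrt (f x) - sqrt (g x))\<^sup>2 \<partial>M) = 2 - 2 * (\<integral>x. sqrt (f x * g x) \<partial>M)"
    using * int by (subst Bochner_Integration.integral_cong[OF refl eq]) auto
  moreover have "(hellinger M f g)\<^sup>2 = (\<integral>x. (sqrt (f x) - sqrt (g x))\<^sup>2 \<partial>M)"
    unfolding hellinger_def by (intro real_sqrt_pow2 integral_nonneg_AE) auto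
  ultimately show "(\<integral>x. sqrt (f x * g x) \<partial>M) = 1 - (hellinger M f g)\<^sup>2 / 2" by linarith
qed

lemma hellinger_sq: "(hellinger M f g)\<^sup>2 = (\<integral>x. (sqrt (f x) - sqrt (g x))\<^sup>2 \<partial>M)"
  unfolding hellinger_def by (intro real_sqrt_pow2 integral_nonneg_AE) auto

lemma hellinger_nonneg: "0 \<le> hellinger M f g"
  unfolding hellinger_def by (intro real_sqrt_ge_zero integral_nonneg_AE) auto

lemma hellinger_commute: "hellinger M f g = hellinger M g f"
  by (simp add: hellinger_def power2_commute)

lemma hellinger_sq_le_2:
  assumes "prob_density M f" "prob_density M g"
  shows "(hellinger M f g)\<^sup>2 \<le> 2"
proof -
  have "0 \<le> (\<integral>x. sqrt (f x * g x) \<partial>M)"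
    using assms by (intro integral_nonneg_AE AE_I2) (simp add: prob_densityD(2))
  then show ?thesis using integral_sqrt_mult_density[OF assms] by simp
qed

text \<open>Integrating \<open>(a - c)^2 \<le> 2 * (a - b)^2 + 2 * (b - c)^2\<close> pointwise
  bypasses Minkowski's inequality. Nothing is lost when both distances have the same bound, as for
  two points of a shell; the lower bound for a test centre loses a factor of about 2 in the squared
  distance, which the constants can afford.\<close>

lemma hellinger_sq_triangle:
  assumes "prob_density M f" "prob_density M g" "prob_density M h"
  shows "(hellinger M f g)\<^sup>2 \<le> 2 * (hellinger M f h)\<^sup>2 + 2 * (hellinger M h g)\<^sup>2"
proof -
  note int = integrable_sqrt_diff_sq[OF assms(1,2)] integrable_sqrt_diff_sq[OF assms(1,3)]
    integrable_sqrt_diff_sq[OF assms(3,2)]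
  have "(\<integral>x. (sqrt (f x) - sqrt (g x))\<^sup>2 \<partial>M)
      \<le> (\<integral>x. 2 * (sqrt (f x) - sqrt (h x))\<^sup>2 + 2 * (sqrt (h x) - sqrt (g x))\<^sup>2 \<partial>M)"
  proof (intro integral_mono)
    fix x
    have "2 * (a - b)\<^sup>2 + 2 * (b - c)\<^sup>2 - (a - c)\<^sup>2 = (a - 2 * b + c)\<^sup>2" for a b c :: real
      by (simp add: power2_eq_square algebra_simps)
    then show "(sqrt (f x) - sqrt (g x))\<^sup>2 \<le> 2 * (sqrt (f x) - sqrt (h x))\<^sup>2 + 2 * (sqrt (h x) - sqrt (g x))\<^sup>2"
      by (smt (verit) zero_le_power2)
  qed (use int in auto)
  then show ?thesis
    using int by (simp add: hellinger_sq)
qed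

section \<open>Sup-log distance and the tilted likelihood ratio\<close>

text \<open>The extended value of \<open>log_ratio\<close> does the work: a finite bound excludes
  points at which exactly one of the densities vanishes, so densities in one ball of the cover have
  the same zeros.\<close>

lemma sup_log_dist_leD:
  assumes "sup_log_dist M f g \<le> ereal \<delta>" "x \<in> space M" "0 \<le> f x" "0 \<le> g x" "0 \<le> \<delta>"
  shows "f x = 0 \<longleftrightarrow> g x = 0" "f x \<le> exp \<delta> * g x" "g x \<le> exp \<delta> * f x"
proof -
  have *: "\<bar>log_ratio (f x) (g x)\<bar> \<le> ereal \<delta>"
    using assms(1,2) unfolding sup_log_dist_def by (metis SUP_upper order_trans)
  show iff: "f x = 0 \<longleftrightarrow> g x = 0" using * by (auto simp: log_ratio_def split: if_splits)
  have "f x \<le> exp \<delta> * g x \<and> g x \<le> exp \<delta> * f x"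
  proof (cases "f x = 0 \<or> f x = g x")
    case True
    then have eq: "g x = f x" using iff by metis
    show ?thesis
      unfolding eq using mult_right_mono[of 1 "exp \<delta>" "f x"] assms(3,5) by simp
  next
    case False
    then have p: "0 < f x" "0 < g x" using iff assms by auto
    have "\<bar>ln (f x / g x)\<bar> \<le> \<delta>" using * False iff by (simp add: log_ratio_def)
    then have "ln (f x) \<le> \<delta> + ln (g x)" "ln (g x) \<le> \<delta> + ln (f x)" using p by (auto simp: ln_div)
    then have "exp (ln (f x)) \<le> exp (\<delta> + ln (g x))" "exp (ln (g x)) \<le> exp (\<delta> + ln (f x))" by auto
    then show ?thesis using p by (simp add: exp_add)
  qed
  then show "f x \<le> exp \<delta> * g x" "g x \<le> exp \<delta> * f x" by auto
qed

lemma hellinger_le_sup_log_dist: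
  assumes f: "prob_density M f" and g: "prob_density M g"
    and le: "sup_log_dist M f g \<le> ereal \<delta>" and "0 \<le> \<delta>"
  shows "(hellinger M f g)\<^sup>2 \<le> (exp \<delta> - 1)\<^sup>2"
proof -
  have "(hellinger M f g)\<^sup>2 \<le> (\<integral>x. (exp \<delta> - 1)\<^sup>2 * f x \<partial>M)"
    unfolding hellinger_sq
  proof (rule integral_mono)
    fix x assume x: "x \<in> space M"
    have nn: "0 \<le> f x" "0 \<le> g x" using x f g by (auto dest: prob_densityD(2))
    note b = sup_log_dist_leD[OF le x nn \<open>0 \<le> \<delta>\<close>]
    have e1: "1 \<le> exp \<delta>" using \<open>0 \<le> \<delta>\<close> by simp
    \<comment> \<open>The ratio of the square roots is within \<open>exp (\<delta> / 2)\<close>;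
      weakening this to \<open>exp \<delta>\<close> lets the single quantity
      \<open>exp \<delta> - 1\<close> measure all errors caused by the cover.\<close>
    have sqe: "sqrt (exp \<delta>) \<le> exp \<delta>"
      using e1 by (intro real_le_lsqrt) (auto simp: power2_eq_square)
    have "sqrt (g x) \<le> sqrt (exp \<delta>) * sqrt (f x)" "sqrt (f x) \<le> sqrt (exp \<delta>) * sqrt (g x)"
      using b(2,3) by (auto simp flip: real_sqrt_mult)
    then have gf: "sqrt (g x) \<le> exp \<delta> * sqrt (f x)" "sqrt (f x) \<le> exp \<delta> * sqrt (g x)"
      using sqe nn by (meson mult_right_mono order_trans real_sqrt_ge_zero)+
    have "sqrt (f x) - sqrt (g x) \<le> (exp \<delta> - 1) * sqrt (f x)"
    proof (cases "sqrt (g x) \<le> sqrt (f x)")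
      case True
      have "sqrt (f x) - sqrt (g x) \<le> (exp \<delta> - 1) * sqrt (g x)" using gf by (simp add: algebra_simps)
      also have "\<dots> \<le> (exp \<delta> - 1) * sqrt (f x)" using True e1 by (intro mult_left_mono) auto
      finally show ?thesis .
    next
      case False
      then show ?thesis using e1 nn by (smt (verit) mult_nonneg_nonneg real_sqrt_ge_zero)
    qed
    moreover have "sqrt (g x) - sqrt (f x) \<le> (exp \<delta> - 1) * sqrt (f x)" using gf by (simp add: algebra_simps)
    ultimately have "\<bar>sqrt (f x) - sqrt (g x)\<bar> \<le> (exp \<delta> - 1) * sqrt (f x)" by auto
    then have "(sqrt (f x) - sqrt (g x))\<^sup>2 \<le> ((exp \<delta> - 1) * sqrt (f x))\<^sup>2"
      by (metis abs_ge_zero power2_abs power_mono)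
    then show "(sqrt (f x) - sqrt (g x))\<^sup>2 \<le> (exp \<delta> - 1)\<^sup>2 * f x"
      using nn by (simp add: power_mult_distrib)
  qed (use integrable_sqrt_diff_sq[OF f g] prob_densityD(3)[OF f] in auto)
  then show ?thesis using prob_densityD(3,4)[OF f] by simp
qed

text \<open>
  With \<open>r = w / b\<close> the left side is \<open>r * sqrt (a * b)\<close>; the cross term
  \<open>(r - 1) * sqrt b * (sqrt a - sqrt b)\<close> is split by the inequality of arithmetic and geometric
  means. After integration \<open>w - b\<close> cancels, so the error is quadratic in \<open>\<delta>'\<close>.
\<close>

lemma tilted_ratio_pointwise:
  fixes a b w \<delta>' :: real
  assumes "0 \<le> a" "0 \<le> b" "0 \<le> w" "0 \<le> \<delta>'" "w \<le> (1 + \<delta>') * b" "b \<le> (1 + \<delta>') * w"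
  shows "a * (w / sqrt (a * b)) \<le>
    (a + b) / 2 - 3 / 8 * (sqrt a - sqrt b)\<^sup>2 + 2 * \<delta>'\<^sup>2 * b + (w - b)"
proof (cases "b = 0")
  case True
  then have "w = 0" using assms(3,5) by simp
  have "0 \<le> a / 2 - 3 / 8 * a" using assms(1) by simp
  then show ?thesis using True \<open>w = 0\<close> assms(1) by simp
next
  case False
  define u v r where "u = sqrt a" and "v = sqrt b" and "r = w / b"
  have uv: "a = u\<^sup>2" "b = v\<^sup>2" "0 \<le> u" "0 < v" "w = r * v\<^sup>2" using assms False by (auto simp: u_def v_def r_def)
  have "r \<le> 1 + \<delta>'" using assms False by (simp add: r_def field_simps)
  moreover have "1 \<le> (1 + \<delta>') * r" using assms False by (simp add: r_def field_simps)
  then have "1 - \<delta>' \<le> r"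
  proof -
    have "1 - \<delta>' \<le> 1 / (1 + \<delta>')" using assms by (simp add: field_simps)
    also have "\<dots> \<le> r" using \<open>1 \<le> (1 + \<delta>') * r\<close> assms by (simp add: field_simps)
    finally show ?thesis .
  qed
  ultimately have "\<bar>r - 1\<bar> \<le> \<bar>\<delta>'\<bar>" by auto
  then have r: "(r - 1)\<^sup>2 \<le> \<delta>'\<^sup>2" by (simp only: abs_le_square_iff)
  have "a * (w / sqrt (a * b)) = r * (u * v)"
    using uv by (cases "u = 0") (auto simp: real_sqrt_mult power2_eq_square)
  \<comment> \<open>Completing the square: with \<open>p = (r - 1) * v\<close> and
    \<open>q = u - v\<close>, the cross term is
    \<open>p * q = 2 * p^2 + q^2 / 8 - 2 * (p - q / 4)^2\<close>. The \<open>q^2 / 8\<close> lowers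
    the coefficient 1/2 of the affinity to 3/8.\<close>
  also have "\<dots> = (u\<^sup>2 + v\<^sup>2) / 2 - 3 / 8 * (u - v)\<^sup>2 + 2 * (r - 1)\<^sup>2 * v\<^sup>2 + (r * v\<^sup>2 - v\<^sup>2)
      - 2 * ((r - 1) * v - (u - v) / 4)\<^sup>2"
    by (simp add: power2_eq_square algebra_simps) (simp add: field_simps)
  also have "\<dots> \<le> (u\<^sup>2 + v\<^sup>2) / 2 - 3 / 8 * (u - v)\<^sup>2 + 2 * \<delta>'\<^sup>2 * v\<^sup>2 + (r * v\<^sup>2 - v\<^sup>2)"
  proof -
    have "2 * (r - 1)\<^sup>2 * v\<^sup>2 \<le> 2 * \<delta>'\<^sup>2 * v\<^sup>2" using r by (intro mult_right_mono) auto
    moreover have "0 \<le> 2 * ((r - 1) * v - (u - v) / 4)\<^sup>2" by simp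
    ultimately show ?thesis by linarith
  qed
  finally show ?thesis unfolding uv(1,2,5) using uv(3,4) by simp
qed

text \<open>The tilted ratio \<open>ft / sqrt (fo * fc)\<close> is \<open>ft / fo\<close> times
  \<open>sqrt (fo / fc)\<close>: the likelihood ratio of \<open>ft\<close>, weighted against the
  region where the test at \<open>fc\<close> rejects. For \<open>ft = fc\<close> its expectation is
  the affinity \<open>1 - h^2 / 2\<close>, with \<open>h\<close> the distance of \<open>fc\<close>
  from \<open>fo\<close>; moving to a nearby \<open>ft\<close> weakens 1/2 to 3/8 and adds an error
  quadratic in \<open>exp \<delta> - 1\<close>.\<close>

lemma tilted_ratio_integral:
  assumes fc: "prob_density M fc" and ft: "prob_density M ft" and fo: "prob_density M fo"
    and le: "sup_log_dist M fc ft \<le> ereal \<delta>" and "0 \<le> \<delta>"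
  shows "(\<integral>\<^sup>+x. ennreal (fo x) * ennreal (ft x / sqrt (fo x * fc x)) \<partial>M)
    \<le> ennreal (1 - 3 / 8 * (hellinger M fc fo)\<^sup>2 + 2 * (exp \<delta> - 1)\<^sup>2)"
proof -
  let ?h = "\<lambda>x. (fo x + fc x) / 2 - 3 / 8 * (sqrt (fo x) - sqrt (fc x))\<^sup>2 + 2 * (exp \<delta> - 1)\<^sup>2 * fc x
    + (ft x - fc x)"
  note int = prob_densityD(3)[OF fc] prob_densityD(3)[OF ft] prob_densityD(3)[OF fo]
    integrable_sqrt_diff_sq[OF fo fc]
  have pw: "fo x * (ft x / sqrt (fo x * fc x)) \<le> ?h x" and nn: "0 \<le> fo x" "0 \<le> fc x" "0 \<le> ft x"
    if x: "x \<in> space M" for x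
  proof -
    show nn: "0 \<le> fo x" "0 \<le> fc x" "0 \<le> ft x" using x fc ft fo by (auto dest: prob_densityD(2))
    show "fo x * (ft x / sqrt (fo x * fc x)) \<le> ?h x"
      using sup_log_dist_leD[OF le x nn(2,3) \<open>0 \<le> \<delta>\<close>] nn \<open>0 \<le> \<delta>\<close> by (intro tilted_ratio_pointwise) auto
  qed
  have "(\<integral>\<^sup>+x. ennreal (fo x) * ennreal (ft x / sqrt (fo x * fc x)) \<partial>M) \<le> (\<integral>\<^sup>+x. ennreal (?h x) \<partial>M)"
    using pw nn by (intro nn_integral_mono) (auto simp flip: ennreal_mult intro!: ennreal_leI)
  also have "\<dots> = ennreal (\<integral>x. ?h x \<partial>M)"
  proof (rule nn_integral_eq_integral)
    show "integrable M ?h" using int by auto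
    show "AE x in M. 0 \<le> ?h x"
    proof (rule AE_I2)
      fix x assume x: "x \<in> space M"
      have "0 \<le> fo x * (ft x / sqrt (fo x * fc x))" using nn[OF x] by simp
      then show "0 \<le> ?h x" using pw[OF x] by linarith
    qed
  qed
  also have "(\<integral>x. ?h x \<partial>M) = 1 - 3 / 8 * (hellinger M fc fo)\<^sup>2 + 2 * (exp \<delta> - 1)\<^sup>2"
    using int prob_densityD(4)[OF fc] prob_densityD(4)[OF ft] prob_densityD(4)[OF fo]
    by (simp add: hellinger_sq hellinger_commute[of M fc fo])
  finally show ?thesis .
qed

section \<open>Tests for a single Hellinger shell\<close>

text \<open>Since \<open>enat\<close> is well-ordered, the infimum is attained as soon as the family
  of finite covers is nonempty; a finite bound guarantees that, because the infimum of the empty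
  family is infinite.\<close>

lemma covering_numberE:
  assumes "ereal_of_enat (covering_number T d B \<delta>) \<le> ereal N"
  obtains S where "finite S" "S \<subseteq> T" "B \<subseteq> (\<Union>c\<in>S. {\<theta>\<in>T. d c \<theta> \<le> ereal \<delta>})" "real (card S) \<le> N"
proof -
  let ?F = "{S. finite S \<and> S \<subseteq> T \<and> B \<subseteq> (\<Union>c\<in>S. {\<theta>\<in>T. d c \<theta> \<le> ereal \<delta>})}"
  let ?I = "(\<lambda>S. enat (card S)) ` ?F"
  have ne: "?I \<noteq> {}"
  proof
    assume "?I = {}"
    then have "covering_number T d B \<delta> = \<infinity>" by (simp only: covering_number_def) (simp add: top_enat_def)
    then show False using assms by simp
  qed
  then obtain k where k: "k \<in> ?I" by (meson ex_in_conv)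
  have "covering_number T d B \<delta> \<in> ?I"
    unfolding covering_number_def by (rule wellorder_InfI[OF k])
  then obtain S where "S \<in> ?F" "covering_number T d B \<delta> = enat (card S)" by auto
  then show thesis using assms by (intro that[of S]) auto
qed

text \<open>One list of centres serves both errors: the affinity bound limits false rejection of
  \<open>fo\<close>, and the tilted integral limits false acceptance at every \<theta> near a
  centre. Zeros of \<open>f c\<close> have to be zeros of \<open>f \<theta>\<close> because the
  tilted ratio divides by \<open>f c\<close>.\<close>

lemma hellinger_shell_tests:
  fixes f :: "'t \<Rightarrow> 's \<Rightarrow> real" and A m s :: real
  assumes f: "\<And>\<theta>. \<theta> \<in> T \<Longrightarrow> prob_density M (f \<theta>)" and fo: "prob_density M fo" and s: "0 < s"
    and cov: "\<And>r \<delta> \<theta>. r > 0 \<Longrightarrow> 0 < \<delta> \<Longrightarrow> \<delta> \<le> 0.0056 * r \<Longrightarrow> \<theta> \<in> T \<Longrightarrow>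
      ereal_of_enat (covering_number T (\<lambda>\<theta> \<eta>. sup_log_dist M (f \<theta>) (f \<eta>)) (hellinger_param_ball M T f \<theta> r) \<delta>)
      \<le> ereal ((A * r / \<delta>) powr m)"
  obtains S where "finite S" "S \<subseteq> T" "real (card S) \<le> (A / 0.0056) powr m"
    "\<And>c. c \<in> S \<Longrightarrow> (\<integral>x. sqrt (f c x * fo x) \<partial>M) \<le> 1 - s\<^sup>2 / 8"
    "\<And>\<theta>. \<theta> \<in> T \<Longrightarrow> s < hellinger M (f \<theta>) fo \<Longrightarrow> hellinger M (f \<theta>) fo \<le> 2 * s \<Longrightarrow>
       \<exists>c\<in>S. (\<forall>x\<in>space M. f c x = 0 \<longrightarrow> f \<theta> x = 0) \<and>
         (\<integral>\<^sup>+x. ennreal (fo x) * ennreal (f \<theta> x / sqrt (fo x * f c x)) \<partial>M) \<le> ennreal (1 - s\<^sup>2 / 8)"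
proof (cases "\<exists>\<theta>\<in>T. s < hellinger M (f \<theta>) fo \<and> hellinger M (f \<theta>) fo \<le> 2 * s")
  case False
  then show thesis by (intro that[of "{}"]) auto
next
  case True
  \<comment> \<open>Covering numbers are controlled only for balls centred in \<open>T\<close>, and
    \<open>fo\<close> need not belong to the model; hence the ball is centred at a point of the
    shell.\<close>
  then obtain \<theta>0 where \<theta>0: "\<theta>0 \<in> T" "s < hellinger M (f \<theta>0) fo" "hellinger M (f \<theta>0) fo \<le> 2 * s" by auto
  \<comment> \<open>This is \<open>0.0056 * (4 * s)\<close>, the largest radius that the covering
    bound admits for the ball of radius \<open>4 * s\<close> that contains the shell.\<close>
  define \<delta> where "\<delta> = 0.0224 * s"
  \<comment> \<open>A nonempty shell bounds \<open>s\<close>, since squared Hellinger distances are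
    at most 2; so \<delta> is at most 1, as the quadratic bound for \<open>exp\<close>
    requires.\<close>
  have "s\<^sup>2 \<le> (hellinger M (f \<theta>0) fo)\<^sup>2" using \<theta>0 s by (intro power_mono) auto
  also have "\<dots> \<le> 2" using f fo \<theta>0 by (intro hellinger_sq_le_2) auto
  finally have s2: "s\<^sup>2 \<le> 2" .
  then have "s\<^sup>2 \<le> 2\<^sup>2" by simp
  then have "s \<le> 2" using s by (meson power2_le_imp_le zero_le_numeral)
  then have \<delta>: "0 < \<delta>" "\<delta> \<le> 1" using s by (auto simp: \<delta>_def)
  have "exp \<delta> \<le> 1 + \<delta> + \<delta>\<^sup>2" using \<delta> by (intro exp_bound) auto
  also have "\<delta>\<^sup>2 \<le> \<delta>" using \<delta> by (simp add: power2_eq_square mult_left_le)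
  \<comment> \<open>The bound \<open>2 * \<delta> = 0.0448 * s\<close> is rounded up to
    \<open>s / 20\<close>, whose square is \<open>s^2 / 400\<close>.\<close>
  finally have "exp \<delta> - 1 \<le> 0.05 * s" using s by (simp add: \<delta>_def)
  moreover have "0 \<le> exp \<delta> - 1" using \<delta> by simp
  ultimately have "(exp \<delta> - 1)\<^sup>2 \<le> (0.05 * s)\<^sup>2" by (intro power_mono)
  then have d': "(exp \<delta> - 1)\<^sup>2 \<le> s\<^sup>2 / 400" by (simp add: power_mult_distrib power2_eq_square)
  let ?sh = "{\<theta>\<in>T. s < hellinger M (f \<theta>) fo \<and> hellinger M (f \<theta>) fo \<le> 2 * s}"
  have "ereal_of_enat (covering_number T (\<lambda>\<theta> \<eta>. sup_log_dist M (f \<theta>) (f \<eta>)) (hellinger_param_ball M T f \<theta>0 (4 * s)) \<delta>)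
      \<le> ereal ((A * (4 * s) / \<delta>) powr m)"
    using s \<delta> \<theta>0 by (intro cov) (auto simp: \<delta>_def)
  also have "A * (4 * s) / \<delta> = A / 0.0056" using s by (simp add: \<delta>_def field_simps)
  finally obtain S' where S': "finite S'" "S' \<subseteq> T" "real (card S') \<le> (A / 0.0056) powr m"
    "hellinger_param_ball M T f \<theta>0 (4 * s) \<subseteq> (\<Union>c\<in>S'. {\<theta>\<in>T. sup_log_dist M (f c) (f \<theta>) \<le> ereal \<delta>})"
    by (rule covering_numberE)
  \<comment> \<open>The centres need not lie in the shell; those whose ball misses it are dropped, since
    nothing bounds their distance to \<open>fo\<close> from below.\<close>
  define S where "S = {c\<in>S'. \<exists>\<theta>\<in>?sh. sup_log_dist M (f c) (f \<theta>) \<le> ereal \<delta>}"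
  have shell_ball: "?sh \<subseteq> hellinger_param_ball M T f \<theta>0 (4 * s)"
  proof
    fix \<theta> assume th: "\<theta> \<in> ?sh"
    have "(hellinger M (f \<theta>0) (f \<theta>))\<^sup>2 \<le> 2 * (hellinger M (f \<theta>0) fo)\<^sup>2 + 2 * (hellinger M fo (f \<theta>))\<^sup>2"
      using f fo \<theta>0 th by (intro hellinger_sq_triangle) auto
    also have "\<dots> \<le> 2 * (2 * s)\<^sup>2 + 2 * (2 * s)\<^sup>2"
      using \<theta>0 th hellinger_nonneg by (intro add_mono mult_left_mono power_mono) (auto simp: hellinger_commute)
    also have "\<dots> = (4 * s)\<^sup>2" by (simp add: power2_eq_square)
    finally have "hellinger M (f \<theta>0) (f \<theta>) \<le> 4 * s" using s by (meson power2_le_imp_le mult_nonneg_nonneg zero_le_numeral less_imp_le)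
    then show "\<theta> \<in> hellinger_param_ball M T f \<theta>0 (4 * s)" using th by (simp add: hellinger_param_ball_def)
  qed
  have H: "(hellinger M (f c) fo)\<^sup>2 \<ge> s\<^sup>2 / 2 - s\<^sup>2 / 400"
    if th: "\<theta> \<in> ?sh" and c: "c \<in> T" "sup_log_dist M (f c) (f \<theta>) \<le> ereal \<delta>" for c \<theta>
  proof -
    have "s\<^sup>2 \<le> (hellinger M (f \<theta>) fo)\<^sup>2" using th s by (intro power_mono) auto
    also have "\<dots> \<le> 2 * (hellinger M (f \<theta>) (f c))\<^sup>2 + 2 * (hellinger M (f c) fo)\<^sup>2"
      using f fo c th by (intro hellinger_sq_triangle) auto
    also have "(hellinger M (f \<theta>) (f c))\<^sup>2 \<le> (exp \<delta> - 1)\<^sup>2"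
      using f c th \<delta> by (subst hellinger_commute) (intro hellinger_le_sup_log_dist, auto)
    finally show ?thesis using d' by simp
  qed
  show thesis
  proof (rule that)
    show "finite S" "S \<subseteq> T" using S' by (auto simp: S_def)
    have "card S \<le> card S'" using S' by (intro card_mono) (auto simp: S_def)
    then show "real (card S) \<le> (A / 0.0056) powr m" using S'(3) by linarith
  next
    fix c assume c: "c \<in> S"
    then have cT: "c \<in> T" using S' by (auto simp: S_def)
    have "(hellinger M (f c) fo)\<^sup>2 \<ge> s\<^sup>2 / 2 - s\<^sup>2 / 400" using c cT H by (auto simp: S_def)
    then show "(\<integral>x. sqrt (f c x * fo x) \<partial>M) \<le> 1 - s\<^sup>2 / 8"
      unfolding integral_sqrt_mult_density[OF f[OF cT] fo] using zero_le_power2[of s] by linarith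
  next
    fix \<theta> assume th: "\<theta> \<in> T" "s < hellinger M (f \<theta>) fo" "hellinger M (f \<theta>) fo \<le> 2 * s"
    then have "\<theta> \<in> ?sh" by simp
    then obtain c where c: "c \<in> S'" "sup_log_dist M (f c) (f \<theta>) \<le> ereal \<delta>"
      using S'(4) shell_ball by blast
    then have cT: "c \<in> T" and cS: "c \<in> S" using S' \<open>\<theta> \<in> ?sh\<close> by (auto simp: S_def)
    show "\<exists>c\<in>S. (\<forall>x\<in>space M. f c x = 0 \<longrightarrow> f \<theta> x = 0) \<and>
         (\<integral>\<^sup>+x. ennreal (fo x) * ennreal (f \<theta> x / sqrt (fo x * f c x)) \<partial>M) \<le> ennreal (1 - s\<^sup>2 / 8)"
    proof (intro bexI[OF _ cS] conjI ballI impI)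
      fix x assume "x \<in> space M" "f c x = 0"
      then show "f \<theta> x = 0"
        using sup_log_dist_leD(1)[OF c(2), of x] f[OF cT] f[OF th(1)] \<delta> by (auto dest: prob_densityD(2))
    next
      have "(\<integral>\<^sup>+x. ennreal (fo x) * ennreal (f \<theta> x / sqrt (fo x * f c x)) \<partial>M)
        \<le> ennreal (1 - 3 / 8 * (hellinger M (f c) fo)\<^sup>2 + 2 * (exp \<delta> - 1)\<^sup>2)"
        using \<delta> by (intro tilted_ratio_integral f fo cT th c) auto
      \<comment> \<open>Numerically, \<open>3 / 8 * (1 / 2 - 1 / 400) - 2 / 400\<close> exceeds
        0.18, well above the required 1/8.\<close>
      also have "\<dots> \<le> ennreal (1 - s\<^sup>2 / 8)"
        using H[OF \<open>\<theta> \<in> ?sh\<close> cT c(2)] d' zero_le_power2[of s] by (intro ennreal_leI) linarith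
      finally show "(\<integral>\<^sup>+x. ennreal (fo x) * ennreal (f \<theta> x / sqrt (fo x * f c x)) \<partial>M) \<le> ennreal (1 - s\<^sup>2 / 8)" .
    qed
  qed
qed

section \<open>Countable sums, and expectations under the law of the sample\<close>

lemma nn_integral_count_space_has_sum:
  fixes g :: "'j \<Rightarrow> real"
  assumes "(g has_sum s) J" "\<And>j. j \<in> J \<Longrightarrow> 0 \<le> g j"
  shows "(\<integral>\<^sup>+j. ennreal (g j) \<partial>count_space J) = ennreal s"
proof -
  have "g summable_on J" using assms(1) by (rule has_sum_imp_summable)
  then have "(\<lambda>j. norm (g j)) summable_on J"
    using assms(2) by (subst summable_on_cong[of J _ g]) auto
  then have "Infinite_Set_Sum.abs_summable_on g J"
    by (simp only: abs_summable_equivalent)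
  then have "(\<integral>\<^sup>+j. ennreal (g j) \<partial>count_space J) = ennreal (infsum g J)"
    using assms(2) by (simp add: nn_integral_conv_infsetsum infsetsum_infsum)
  then show ?thesis using infsumI[OF assms(1)] by simp
qed

text \<open>Countable subadditivity as an integral over counting measure, so that the index set need
  not be enumerated: the indicator of a union is at most the sum of the indicators, and this sum
  commutes with the integral.\<close>

lemma emeasure_UN_le_nn_integral:
  assumes "countable I" "\<And>i. i \<in> I \<Longrightarrow> E i \<in> sets M"
  shows "emeasure M (\<Union>i\<in>I. E i) \<le> (\<integral>\<^sup>+i. emeasure M (E i) \<partial>count_space I)"
proof -
  have U: "(\<Union>i\<in>I. E i) \<in> sets M" using assms by (intro sets.countable_UN') auto
  have "emeasure M (\<Union>i\<in>I. E i) = (\<integral>\<^sup>+x. indicator (\<Union>i\<in>I. E i) x \<partial>M)"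
    using U by simp
  also have "\<dots> \<le> (\<integral>\<^sup>+x. (\<integral>\<^sup>+i. indicator (E i) x \<partial>count_space I) \<partial>M)"
  proof (intro nn_integral_mono)
    fix x
    show "indicator (\<Union>i\<in>I. E i) x \<le> (\<integral>\<^sup>+i. indicator (E i) x \<partial>count_space I :: ennreal)"
    proof (cases "x \<in> (\<Union>i\<in>I. E i)")
      case True
      then obtain i where i: "i \<in> I" "x \<in> E i" by auto
      have "(1::ennreal) = (\<integral>\<^sup>+k. indicator {i} k \<partial>count_space I)"
        using i by (subst nn_integral_indicator) auto
      also have "\<dots> \<le> (\<integral>\<^sup>+k. indicator (E k) x \<partial>count_space I)"
        using i by (intro nn_integral_mono) (auto split: split_indicator)
      finally show ?thesis using True by simp
    qed simp
  qed
  also have "\<dots> = (\<integral>\<^sup>+i. (\<integral>\<^sup>+x. indicator (E i) x \<partial>M) \<partial>count_space I)"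
    using assms by (intro nn_integral_count_space_nn_integral) auto
  also have "\<dots> = (\<integral>\<^sup>+i. emeasure M (E i) \<partial>count_space I)"
    using assms by (intro nn_integral_cong) auto
  finally show ?thesis .
qed

lemma nn_integral_sample_law_prod:
  assumes "prob_density M fo" "h \<in> borel_measurable M"
  shows "(\<integral>\<^sup>+X. (\<Prod>i<n. h (X i)) \<partial>sample_law M fo n) = (\<integral>\<^sup>+x. ennreal (fo x) * h x \<partial>M) ^ n"
proof -
  have [measurable]: "fo \<in> borel_measurable M" using assms(1) by (rule prob_densityD)
  have "(\<integral>\<^sup>+X. (\<Prod>i<n. h (X i)) \<partial>sample_law M fo n)
      = (integral\<^sup>N (density M (\<lambda>x. ennreal (fo x))) h) ^ n"
    using nn_integral_PiM_power[OF prob_space_prob_density[OF assms(1)], of h "{..<n}"] assms(2)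
    by (simp add: sample_law_def)
  then show ?thesis using assms(2) by (simp add: nn_integral_density)
qed

lemma prob_space_sample_law: "prob_density M fo \<Longrightarrow> prob_space (sample_law M fo n)"
  unfolding sample_law_def by (intro prob_space_PiM prob_space_prob_density)

lemma space_sample_law: "X \<in> space (sample_law M fo n) \<Longrightarrow> i < n \<Longrightarrow> X i \<in> space M"
  by (auto simp: sample_law_def space_PiM)

lemma measurable_sample_component:
  "i < n \<Longrightarrow> (\<lambda>X. X i) \<in> sample_law M fo n \<rightarrow>\<^sub>M M"
  using measurable_component_singleton[of i "{..<n}" "\<lambda>_. density M (\<lambda>x. ennreal (fo x))"]
  by (simp add: sample_law_def cong: measurable_cong_sets)

text \<open>When \<open>u > 1\<close>, the negative number \<open>1 - u\<close> is truncated to 0 by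
  \<open>ennreal\<close>; otherwise this is \<open>1 - u \<le> exp (- u)\<close>.\<close>

lemma ennreal_one_minus_power_le: "ennreal (1 - u) ^ n \<le> ennreal (exp (- (real n * u)))"
proof -
  have "ennreal (1 - u) ^ n \<le> ennreal (exp (- u)) ^ n"
    using exp_ge_add_one_self[of "- u"] by (intro power_mono ennreal_leI) auto
  also have "\<dots> = ennreal (exp (- (real n * u)))"
    by (simp add: ennreal_power exp_of_nat_mult[symmetric])
  finally show ?thesis .
qed

section \<open>From one shell to the exterior of a Hellinger ball\<close>

text \<open>\<open>E\<close> is the event that some centre has a larger likelihood than
  \<open>fo\<close>. Markov's inequality for the square root of the likelihood ratio bounds its
  probability by powers of affinities. Off \<open>E\<close> that root is at most 1, so the
  likelihood ratio of \<theta> is at most the product of tilted ratios at the centre near \<theta>.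
  The second bound is uniform in \<theta>, ready to be averaged over a prior.\<close>

lemma hellinger_shell_exceptional_set:
  fixes f :: "'t \<Rightarrow> 's \<Rightarrow> real" and A m s :: real
  assumes f: "\<And>\<theta>. \<theta> \<in> T \<Longrightarrow> prob_density M (f \<theta>)" and fo: "prob_density M fo" and s: "0 < s"
    and cov: "\<And>r \<delta> \<theta>. r > 0 \<Longrightarrow> 0 < \<delta> \<Longrightarrow> \<delta> \<le> 0.0056 * r \<Longrightarrow> \<theta> \<in> T \<Longrightarrow>
      ereal_of_enat (covering_number T (\<lambda>\<theta> \<eta>. sup_log_dist M (f \<theta>) (f \<eta>)) (hellinger_param_ball M T f \<theta> r) \<delta>)
      \<le> ereal ((A * r / \<delta>) powr m)"
  obtains E where "E \<in> sets (sample_law M fo n)"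
    "emeasure (sample_law M fo n) E \<le> ennreal ((A / 0.0056) powr m) * ennreal (exp (- (real n * (s\<^sup>2 / 8))))"
    "\<And>\<theta>. \<theta> \<in> T \<Longrightarrow> s < hellinger M (f \<theta>) fo \<Longrightarrow> hellinger M (f \<theta>) fo \<le> 2 * s \<Longrightarrow>
       (\<integral>\<^sup>+X. ennreal (\<Prod>i<n. f \<theta> (X i) / fo (X i)) * indicator (space (sample_law M fo n) - E) X \<partial>sample_law M fo n)
       \<le> ennreal (exp (- (real n * (s\<^sup>2 / 8))))"
proof -
  let ?S = "sample_law M fo n" and ?e = "ennreal (exp (- (real n * (s\<^sup>2 / 8))))"
  obtain S where S: "finite S" "S \<subseteq> T" "real (card S) \<le> (A / 0.0056) powr m"
    and aff: "\<And>c. c \<in> S \<Longrightarrow> (\<integral>x. sqrt (f c x * fo x) \<partial>M) \<le> 1 - s\<^sup>2 / 8"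
    and tilt: "\<And>\<theta>. \<theta> \<in> T \<Longrightarrow> s < hellinger M (f \<theta>) fo \<Longrightarrow> hellinger M (f \<theta>) fo \<le> 2 * s \<Longrightarrow>
       \<exists>c\<in>S. (\<forall>x\<in>space M. f c x = 0 \<longrightarrow> f \<theta> x = 0) \<and>
         (\<integral>\<^sup>+x. ennreal (fo x) * ennreal (f \<theta> x / sqrt (fo x * f c x)) \<partial>M) \<le> ennreal (1 - s\<^sup>2 / 8)"
    by (rule hellinger_shell_tests[OF f fo s cov]; (assumption | rule that))
  have fom[measurable]: "fo \<in> borel_measurable M" using fo by (rule prob_densityD)
  have fm: "f c \<in> borel_measurable M" if "c \<in> T" for c using f[OF that] by (rule prob_densityD)
  have comp[measurable]: "(\<lambda>X. X i) \<in> ?S \<rightarrow>\<^sub>M M" if "i < n" for i using that by (rule measurable_sample_component)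
  have nn: "0 \<le> fo x" if "x \<in> space M" for x using fo that by (rule prob_densityD)
  have fnn: "0 \<le> f c x" if "c \<in> T" "x \<in> space M" for c x using f[OF that(1)] that(2) by (rule prob_densityD)
  define L where "L c X = (\<Prod>i<n. ennreal (sqrt (f c (X i) / fo (X i))))" for c X
  have L_meas: "L c \<in> borel_measurable ?S" if "c \<in> T" for c
  proof -
    have [measurable]: "f c \<in> borel_measurable M" using that by (rule fm)
    have "(\<lambda>x. ennreal (sqrt (f c x / fo x))) \<in> borel_measurable M" by measurable
    then show ?thesis
      unfolding L_def by (intro borel_measurable_prod_ennreal measurable_compose[OF comp]) simp_all
  qed
  define E where "E = (\<Union>c\<in>S. {X \<in> space ?S. 1 < L c X})"
  have Ec: "{X \<in> space ?S. 1 < L c X} \<in> sets ?S" if "c \<in> S" for c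
    using L_meas[of c] that S(2) by (intro borel_measurable_less) auto
  have Ec_prob: "emeasure ?S {X \<in> space ?S. 1 < L c X} \<le> ?e" if c: "c \<in> S" for c
  proof -
    have cT: "c \<in> T" using c S by auto
    note [measurable] = fm[OF cT]
    have "emeasure ?S {X \<in> space ?S. 1 < L c X} = (\<integral>\<^sup>+X. indicator {X \<in> space ?S. 1 < L c X} X \<partial>?S)"
      using Ec[OF c] by simp
    also have "\<dots> \<le> (\<integral>\<^sup>+X. L c X \<partial>?S)"
      by (intro nn_integral_mono) (auto split: split_indicator)
    also have "\<dots> = (\<integral>\<^sup>+x. ennreal (fo x) * ennreal (sqrt (f c x / fo x)) \<partial>M) ^ n"
      unfolding L_def by (intro nn_integral_sample_law_prod fo) measurable
    also have "(\<integral>\<^sup>+x. ennreal (fo x) * ennreal (sqrt (f c x / fo x)) \<partial>M) \<le> (\<integral>\<^sup>+x. ennreal (sqrt (f c x * fo x)) \<partial>M)"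
    proof (intro nn_integral_mono)
      fix x assume x: "x \<in> space M"
      have "fo x * sqrt (f c x / fo x) = sqrt (f c x * fo x)"
      proof -
        have "fo x * sqrt (f c x / fo x) = sqrt (f c x) * (fo x / sqrt (fo x))" by (simp add: real_sqrt_divide)
        also have "\<dots> = sqrt (f c x * fo x)" using nn[OF x] by (simp add: real_div_sqrt real_sqrt_mult)
        finally show ?thesis .
      qed
      then show "ennreal (fo x) * ennreal (sqrt (f c x / fo x)) \<le> ennreal (sqrt (f c x * fo x))"
        using nn[OF x] fnn[OF cT x] by (simp flip: ennreal_mult)
    qed
    also have "(\<integral>\<^sup>+x. ennreal (sqrt (f c x * fo x)) \<partial>M) = ennreal (\<integral>x. sqrt (f c x * fo x) \<partial>M)"
      using integrable_sqrt_mult_density[OF f[OF cT] fo] nn fnn[OF cT] by (intro nn_integral_eq_integral) auto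
    also have "\<dots> \<le> ennreal (1 - s\<^sup>2 / 8)" using aff[OF c] by (rule ennreal_leI)
    also have "ennreal (1 - s\<^sup>2 / 8) ^ n \<le> ?e" by (rule ennreal_one_minus_power_le)
    finally show ?thesis by (simp add: power_mono)
  qed
  show thesis
  proof (rule that[of E])
    show "E \<in> sets ?S" unfolding E_def using Ec S by (intro sets.finite_UN) auto
    have "emeasure ?S E \<le> (\<Sum>c\<in>S. emeasure ?S {X \<in> space ?S. 1 < L c X})"
      unfolding E_def using Ec S by (intro emeasure_subadditive_finite) auto
    also have "\<dots> \<le> (\<Sum>c\<in>S. ?e)" using Ec_prob by (rule sum_mono)
    also have "\<dots> = ennreal (real (card S)) * ?e" by (simp add: ennreal_of_nat_eq_real_of_nat)
    also have "\<dots> \<le> ennreal ((A / 0.0056) powr m) * ?e" using S(3) by (intro mult_right_mono ennreal_leI) auto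
    finally show "emeasure ?S E \<le> ennreal ((A / 0.0056) powr m) * ?e" .
  next
    fix \<theta> assume th: "\<theta> \<in> T" "s < hellinger M (f \<theta>) fo" "hellinger M (f \<theta>) fo \<le> 2 * s"
    from tilt[OF this] obtain c where c: "c \<in> S" and z: "\<And>x. x \<in> space M \<Longrightarrow> f c x = 0 \<Longrightarrow> f \<theta> x = 0"
      and le: "(\<integral>\<^sup>+x. ennreal (fo x) * ennreal (f \<theta> x / sqrt (fo x * f c x)) \<partial>M) \<le> ennreal (1 - s\<^sup>2 / 8)" by auto
    have cT: "c \<in> T" using c S by auto
    note [measurable] = fm[OF cT] fm[OF th(1)]
    have "(\<integral>\<^sup>+X. ennreal (\<Prod>i<n. f \<theta> (X i) / fo (X i)) * indicator (space ?S - E) X \<partial>?S)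
      \<le> (\<integral>\<^sup>+X. (\<Prod>i<n. ennreal (f \<theta> (X i) / sqrt (fo (X i) * f c (X i)))) \<partial>?S)"
    proof (intro nn_integral_mono)
      fix X assume X: "X \<in> space ?S"
      have XM: "X i \<in> space M" if "i < n" for i using X that by (rule space_sample_law)
      show "ennreal (\<Prod>i<n. f \<theta> (X i) / fo (X i)) * indicator (space ?S - E) X
        \<le> (\<Prod>i<n. ennreal (f \<theta> (X i) / sqrt (fo (X i) * f c (X i))))"
      proof (cases "X \<in> E \<or> (\<exists>i<n. fo (X i) = 0 \<or> f c (X i) = 0)")
        case True
        \<comment> \<open>If \<open>f c (X i) = 0\<close>, then \<open>f \<theta> (X i) = 0\<close>
          by the common zeros; if \<open>fo (X i) = 0\<close>, the quotient is 0 because division by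
          0 gives 0. Either way the likelihood ratio vanishes.\<close>
        then have "(\<Prod>i<n. f \<theta> (X i) / fo (X i)) = 0 \<or> X \<in> E"
          using z XM by (auto simp: prod_zero_iff)
        then have "ennreal (\<Prod>i<n. f \<theta> (X i) / fo (X i)) * indicator (space ?S - E) X = 0"
          by (elim disjE) (simp only: ennreal_0 mult_zero_left, simp)
        then show ?thesis by (simp only: zero_le)
      next
        case False
        then have p: "0 < fo (X i)" "0 < f c (X i)" if "i < n" for i
          using nn[OF XM[OF that]] fnn[OF cT XM[OF that]] that by force+
        have q: "0 \<le> f \<theta> (X i) / sqrt (fo (X i) * f c (X i))" if "i < n" for i
          using p[OF that] fnn[OF th(1) XM[OF that]]
          by (intro divide_nonneg_nonneg real_sqrt_ge_zero mult_nonneg_nonneg) auto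
        have "\<not> 1 < L c X" using False X c by (auto simp: E_def)
        moreover have "L c X = ennreal (\<Prod>i<n. sqrt (f c (X i) / fo (X i)))"
          unfolding L_def using p by (intro prod_ennreal) (auto intro: less_imp_le)
        ultimately have "(\<Prod>i<n. sqrt (f c (X i) / fo (X i))) \<le> 1"
          by (metis ennreal_1 ennreal_less_iff linorder_not_less zero_le_one)
        \<comment> \<open>The likelihood ratio of \<theta> is the tilted product times the square
          root of the likelihood ratio of \<open>c\<close>, which is at most 1 off
          \<open>E\<close>.\<close>
        have "(\<Prod>i<n. f \<theta> (X i) / fo (X i))
            = (\<Prod>i<n. f \<theta> (X i) / sqrt (fo (X i) * f c (X i))) * (\<Prod>i<n. sqrt (f c (X i) / fo (X i)))"
          unfolding prod.distrib[symmetric]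
        proof (intro prod.cong refl)
          fix i assume "i \<in> {..<n}"
          then show "f \<theta> (X i) / fo (X i) = f \<theta> (X i) / sqrt (fo (X i) * f c (X i)) * sqrt (f c (X i) / fo (X i))"
            using p[of i] by (simp add: real_sqrt_mult real_sqrt_divide field_simps)
        qed
        also have "\<dots> \<le> (\<Prod>i<n. f \<theta> (X i) / sqrt (fo (X i) * f c (X i)))"
          using \<open>_ \<le> 1\<close> q by (intro mult_left_le prod_nonneg) auto
        finally have "ennreal (\<Prod>i<n. f \<theta> (X i) / fo (X i))
            \<le> ennreal (\<Prod>i<n. f \<theta> (X i) / sqrt (fo (X i) * f c (X i)))" by (rule ennreal_leI)
        also have "\<dots> = (\<Prod>i<n. ennreal (f \<theta> (X i) / sqrt (fo (X i) * f c (X i))))"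
          using q by (intro prod_ennreal[symmetric]) auto
        finally show ?thesis by (auto split: split_indicator)
      qed
    qed
    also have "\<dots> = (\<integral>\<^sup>+x. ennreal (fo x) * ennreal (f \<theta> x / sqrt (fo x * f c x)) \<partial>M) ^ n"
      by (intro nn_integral_sample_law_prod fo) measurable
    also have "\<dots> \<le> ennreal (1 - s\<^sup>2 / 8) ^ n" using le by (intro power_mono) auto
    also have "\<dots> \<le> ?e" by (rule ennreal_one_minus_power_le)
    finally show "(\<integral>\<^sup>+X. ennreal (\<Prod>i<n. f \<theta> (X i) / fo (X i)) * indicator (space ?S - E) X \<partial>?S) \<le> ?e" .
  qed
qed


text \<open>As \<open>4 ^ k \<ge> 1 + k\<close>, the series is dominated by a geometric one with
  ratio \<open>exp (- y) \<le> 1 / 2\<close>. The powers of 4 are the squares of the dyadic radii of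
  the shells.\<close>

lemma geometric_tail_bound:
  fixes y :: real
  assumes "1 \<le> y"
  shows "(\<Sum>k. ennreal (exp (- (y * 4 ^ k)))) \<le> ennreal (2 * exp (- y))"
proof -
  have lt: "exp (- y) < 1" using assms by simp
  have "exp (- y) \<le> exp (- 1)" using assms by simp
  also have "exp (- 1 :: real) \<le> 1 / 2"
    using exp_ge_add_one_self[of 1] by (simp add: exp_minus field_simps)
  finally have half: "exp (- y) \<le> 1 / 2" .
  have "(\<Sum>k. ennreal (exp (- (y * 4 ^ k)))) \<le> (\<Sum>k. ennreal (exp (- y) * exp (- y) ^ k))"
  proof (intro suminf_le summableI ennreal_leI)
    fix k :: nat
    have "1 + real k \<le> 4 ^ k"
    proof (induction k)
      case (Suc k)
      have "1 + real (Suc k) \<le> 4 * (1 + real k)" by simp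
      also have "\<dots> \<le> 4 * 4 ^ k" using Suc by (intro mult_left_mono) auto
      finally show ?case by simp
    qed simp
    then have "y * (1 + real k) \<le> y * 4 ^ k" using assms by (intro mult_left_mono) auto
    then have "exp (- (y * 4 ^ k)) \<le> exp (- (y * (1 + real k)))" by simp
    also have "\<dots> = exp (- y) * exp (- y) ^ k"
      by (simp add: exp_of_nat_mult[symmetric] exp_add[symmetric] algebra_simps)
    finally show "exp (- (y * 4 ^ k)) \<le> exp (- y) * exp (- y) ^ k" .
  qed
  also have "\<dots> = ennreal (\<Sum>k. exp (- y) * exp (- y) ^ k)"
    using lt by (intro suminf_ennreal_eq summable_sums summable_mult summable_geometric) auto
  also have "(\<Sum>k. exp (- y) * exp (- y) ^ k) = exp (- y) * (1 / (1 - exp (- y)))"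
    using lt by (subst suminf_mult) (auto simp: suminf_geometric summable_geometric)
  also have "ennreal \<dots> \<le> ennreal (2 * exp (- y))"
  proof (rule ennreal_leI)
    have "1 / (1 - exp (- y)) \<le> 2" using half lt by (simp add: divide_le_eq)
    then have "exp (- y) * (1 / (1 - exp (- y))) \<le> exp (- y) * 2" by (intro mult_left_mono) auto
    then show "exp (- y) * (1 / (1 - exp (- y))) \<le> 2 * exp (- y)" by simp
  qed
  finally show ?thesis .
qed

text \<open>The exterior is cut into shells with radii \<open>2 ^ k * s\<close>. The bound for the
  number of tests is the same in every shell, so the false rejections sum to a geometric tail. False
  acceptances are not summed: each \<theta> lies in one shell, and its bound is at least as good as
  in the innermost one.\<close>

lemma hellinger_exterior_exceptional_set:
  fixes f :: "'t \<Rightarrow> 's \<Rightarrow> real" and A m s :: real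
  assumes f: "\<And>\<theta>. \<theta> \<in> T \<Longrightarrow> prob_density M (f \<theta>)" and fo: "prob_density M fo" and s: "0 < s"
    and cov: "\<And>r \<delta> \<theta>. r > 0 \<Longrightarrow> 0 < \<delta> \<Longrightarrow> \<delta> \<le> 0.0056 * r \<Longrightarrow> \<theta> \<in> T \<Longrightarrow>
      ereal_of_enat (covering_number T (\<lambda>\<theta> \<eta>. sup_log_dist M (f \<theta>) (f \<eta>)) (hellinger_param_ball M T f \<theta> r) \<delta>)
      \<le> ereal ((A * r / \<delta>) powr m)"
    and large: "1 \<le> real n * (s\<^sup>2 / 8)"
  obtains E where "E \<in> sets (sample_law M fo n)"
    "emeasure (sample_law M fo n) E \<le> ennreal ((A / 0.0056) powr m * (2 * exp (- (real n * (s\<^sup>2 / 8)))))"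
    "\<And>\<theta>. \<theta> \<in> T \<Longrightarrow> s < hellinger M (f \<theta>) fo \<Longrightarrow>
       (\<integral>\<^sup>+X. ennreal (\<Prod>i<n. f \<theta> (X i) / fo (X i)) * indicator (space (sample_law M fo n) - E) X \<partial>sample_law M fo n)
       \<le> ennreal (exp (- (real n * (s\<^sup>2 / 8))))"
proof -
  let ?S = "sample_law M fo n" and ?N = "(A / 0.0056) powr m"
  define r where "r k = 2 ^ k * s" for k :: nat
  have r: "0 < r k" for k using s by (simp add: r_def)
  have rsq: "real n * ((r k)\<^sup>2 / 8) = real n * (s\<^sup>2 / 8) * 4 ^ k" for k
  proof -
    have "((2::real) ^ k)\<^sup>2 = 4 ^ k" by (simp add: power2_eq_square flip: power_mult_distrib)
    then show ?thesis by (simp add: r_def power_mult_distrib)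
  qed
  let ?P = "\<lambda>k E. E \<in> sets ?S \<and> emeasure ?S E \<le> ennreal ?N * ennreal (exp (- (real n * ((r k)\<^sup>2 / 8)))) \<and>
    (\<forall>\<theta>\<in>T. r k < hellinger M (f \<theta>) fo \<longrightarrow> hellinger M (f \<theta>) fo \<le> 2 * r k \<longrightarrow>
       (\<integral>\<^sup>+X. ennreal (\<Prod>i<n. f \<theta> (X i) / fo (X i)) * indicator (space ?S - E) X \<partial>?S)
       \<le> ennreal (exp (- (real n * ((r k)\<^sup>2 / 8)))))"
  have ex: "\<exists>E. ?P k E" for k
    by (rule hellinger_shell_exceptional_set[OF f fo r[of k] cov]; (assumption | blast))
  from choice[OF allI[OF ex]] obtain E where E: "\<forall>k. ?P k (E k)" ..
  have Em[measurable]: "E k \<in> sets ?S" for k using E by blast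
  show thesis
  proof (rule that[of "\<Union>k. E k"])
    show "(\<Union>k. E k) \<in> sets ?S" by measurable
    have "emeasure ?S (\<Union>k. E k) \<le> (\<Sum>k. emeasure ?S (E k))"
      by (intro emeasure_subadditive_countably) auto
    also have "\<dots> \<le> (\<Sum>k. ennreal ?N * ennreal (exp (- (real n * (s\<^sup>2 / 8) * 4 ^ k))))"
      using E unfolding rsq by (intro suminf_le summableI) blast
    also have "\<dots> = ennreal ?N * (\<Sum>k. ennreal (exp (- (real n * (s\<^sup>2 / 8) * 4 ^ k))))" by simp
    also have "\<dots> \<le> ennreal ?N * ennreal (2 * exp (- (real n * (s\<^sup>2 / 8))))"
      using large by (intro mult_left_mono geometric_tail_bound) auto
    also have "\<dots> = ennreal (?N * (2 * exp (- (real n * (s\<^sup>2 / 8)))))" by (simp add: ennreal_mult)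
    finally show "emeasure ?S (\<Union>k. E k) \<le> ennreal (?N * (2 * exp (- (real n * (s\<^sup>2 / 8)))))" .
  next
    fix \<theta> assume th: "\<theta> \<in> T" "s < hellinger M (f \<theta>) fo"
    \<comment> \<open>Minimality of \<open>k\<close> gives the lower edge of the shell; for
      \<open>k = 0\<close> that edge is \<open>s\<close> itself.\<close>
    define k where "k = (LEAST k. hellinger M (f \<theta>) fo \<le> 2 * r k)"
    obtain k0 where "hellinger M (f \<theta>) fo / s < 2 ^ k0"
      using real_arch_pow[of 2 "hellinger M (f \<theta>) fo / s"] by auto
    then have "hellinger M (f \<theta>) fo < r k0" using s by (simp add: r_def field_simps)
    then have "hellinger M (f \<theta>) fo \<le> 2 * r k0" using r[of k0] by linarith
    then have k: "hellinger M (f \<theta>) fo \<le> 2 * r k" unfolding k_def by (rule LeastI)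
    have k': "r k < hellinger M (f \<theta>) fo"
    proof (cases k)
      case 0
      then show ?thesis using th by (simp add: r_def)
    next
      case (Suc l)
      then have "l < (LEAST k. hellinger M (f \<theta>) fo \<le> 2 * r k)" by (simp add: k_def)
      then have "\<not> hellinger M (f \<theta>) fo \<le> 2 * r l" by (rule not_less_Least)
      then show ?thesis using Suc by (simp add: r_def)
    qed
    have "(\<integral>\<^sup>+X. ennreal (\<Prod>i<n. f \<theta> (X i) / fo (X i)) * indicator (space ?S - (\<Union>k. E k)) X \<partial>?S)
      \<le> (\<integral>\<^sup>+X. ennreal (\<Prod>i<n. f \<theta> (X i) / fo (X i)) * indicator (space ?S - E k) X \<partial>?S)"
      by (intro nn_integral_mono mult_left_mono) (auto split: split_indicator)
    also have "\<dots> \<le> ennreal (exp (- (real n * ((r k)\<^sup>2 / 8))))" using E k k' th by blast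
    also have "\<dots> \<le> ennreal (exp (- (real n * (s\<^sup>2 / 8))))"
      unfolding rsq using large mult_left_mono[of 1 "4 ^ k :: real" "real n * (s\<^sup>2 / 8)"] by (intro ennreal_leI) simp
    finally show "(\<integral>\<^sup>+X. ennreal (\<Prod>i<n. f \<theta> (X i) / fo (X i)) * indicator (space ?S - (\<Union>k. E k)) X \<partial>?S)
      \<le> ennreal (exp (- (real n * (s\<^sup>2 / 8))))" .
  qed
qed

section \<open>Posterior mass outside a Hellinger ball\<close>

text \<open>
  The measure \<open>M\<close> need not be \<open>\<sigma>\<close>-finite, so the integral is moved to the probability measure
  with density \<open>fo\<close>.
\<close>

lemma borel_measurable_hellinger:
  assumes fo: "prob_density M fo" and f: "\<And>\<theta>. \<theta> \<in> space \<pi> \<Longrightarrow> prob_density M (f \<theta>)"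
    and meas: "(\<lambda>(\<theta>, x). f \<theta> x) \<in> borel_measurable (\<pi> \<Otimes>\<^sub>M M)"
  shows "(\<lambda>\<theta>. hellinger M (f \<theta>) fo) \<in> borel_measurable \<pi>"
proof -
  let ?P = "density M (\<lambda>x. ennreal (fo x))"
  interpret P: prob_space ?P using fo by (rule prob_space_prob_density)
  have [measurable]: "fo \<in> borel_measurable M" using fo by (rule prob_densityD)
  have [measurable_cong]: "sets ?P = sets M" by simp
  note meas[measurable]
  have eq: "hellinger M (f \<theta>) fo =
      sqrt (2 - 2 * enn2real (\<integral>\<^sup>+x. ennreal (sqrt (f \<theta> x / fo x)) \<partial>?P))" if th: "\<theta> \<in> space \<pi>" for \<theta>
  proof -
    have [measurable]: "f \<theta> \<in> borel_measurable M" using f[OF th] by (rule prob_densityD)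
    have nn: "0 \<le> fo x" "0 \<le> f \<theta> x" if "x \<in> space M" for x
      using that prob_densityD(2)[OF fo] prob_densityD(2)[OF f[OF th]] by auto
    have "(\<integral>\<^sup>+x. ennreal (sqrt (f \<theta> x / fo x)) \<partial>?P) = (\<integral>\<^sup>+x. ennreal (fo x) * ennreal (sqrt (f \<theta> x / fo x)) \<partial>M)"
      by (subst nn_integral_density) auto
    also have "\<dots> = (\<integral>\<^sup>+x. ennreal (sqrt (f \<theta> x * fo x)) \<partial>M)"
    proof (intro nn_integral_cong)
      fix x assume x: "x \<in> space M"
      have "fo x * sqrt (f \<theta> x / fo x) = sqrt (f \<theta> x) * (fo x / sqrt (fo x))" by (simp add: real_sqrt_divide)
      also have "\<dots> = sqrt (f \<theta> x * fo x)" using nn[OF x] by (simp add: real_div_sqrt real_sqrt_mult)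
      finally show "ennreal (fo x) * ennreal (sqrt (f \<theta> x / fo x)) = ennreal (sqrt (f \<theta> x * fo x))"
        using nn[OF x] by (simp flip: ennreal_mult)
    qed
    also have "\<dots> = ennreal (\<integral>x. sqrt (f \<theta> x * fo x) \<partial>M)"
      using integrable_sqrt_mult_density[OF f[OF th] fo] nn by (intro nn_integral_eq_integral) auto
    finally have "enn2real (\<integral>\<^sup>+x. ennreal (sqrt (f \<theta> x / fo x)) \<partial>?P) = (\<integral>x. sqrt (f \<theta> x * fo x) \<partial>M)"
      using nn by (simp add: integral_nonneg_AE)
    then have "(hellinger M (f \<theta>) fo)\<^sup>2 = 2 - 2 * enn2real (\<integral>\<^sup>+x. ennreal (sqrt (f \<theta> x / fo x)) \<partial>?P)"
      using integral_sqrt_mult_density[OF f[OF th] fo] by (simp add: field_simps)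
    then show ?thesis using hellinger_nonneg[of M "f \<theta>" fo] by (metis real_sqrt_unique)
  qed
  have "(\<lambda>\<theta>. \<integral>\<^sup>+x. ennreal (sqrt (f \<theta> x / fo x)) \<partial>?P) \<in> borel_measurable \<pi>"
    by (intro P.borel_measurable_nn_integral) measurable
  then have "(\<lambda>\<theta>. sqrt (2 - 2 * enn2real (\<integral>\<^sup>+x. ennreal (sqrt (f \<theta> x / fo x)) \<partial>?P))) \<in> borel_measurable \<pi>"
    by measurable
  then show ?thesis by (subst measurable_cong[OF eq])
qed

lemma borel_measurable_likelihood_ratio:
  assumes fo: "prob_density M fo" and meas: "(\<lambda>(\<theta>, x). f \<theta> x) \<in> borel_measurable (\<pi> \<Otimes>\<^sub>M M)"
  shows "(\<lambda>(\<theta>, X). ennreal (\<Prod>i<n. f \<theta> (X i) / fo (X i))) \<in> borel_measurable (\<pi> \<Otimes>\<^sub>M sample_law M fo n)"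
proof -
  have fom: "fo \<in> borel_measurable M" using fo by (rule prob_densityD)
  have "(\<lambda>z. f (fst z) (snd z i) / fo (snd z i)) \<in> borel_measurable (\<pi> \<Otimes>\<^sub>M sample_law M fo n)" if "i < n" for i
  proof -
    have c: "(\<lambda>z. snd z i) \<in> \<pi> \<Otimes>\<^sub>M sample_law M fo n \<rightarrow>\<^sub>M M"
      using measurable_sample_component[OF that] by (rule measurable_compose[OF measurable_snd])
    have "(\<lambda>z. (fst z, snd z i)) \<in> \<pi> \<Otimes>\<^sub>M sample_law M fo n \<rightarrow>\<^sub>M \<pi> \<Otimes>\<^sub>M M"
      using c by measurable
    from measurable_compose[OF this meas] measurable_compose[OF c fom] show ?thesis
      by simp
  qed
  then show ?thesis
    unfolding case_prod_beta by (intro measurable_compose[OF _ measurable_ennreal] borel_measurable_prod) simp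
qed

text \<open>Fubini's theorem lets a bound that is uniform in the parameter survive averaging over
  the prior, whose total mass is 1.\<close>

lemma
  assumes fo: "prob_density M fo" and \<pi>: "prob_space \<pi>"
    and meas: "(\<lambda>(\<theta>, x). f \<theta> x) \<in> borel_measurable (\<pi> \<Otimes>\<^sub>M M)"
    and A: "A \<in> sets \<pi>"
  shows borel_measurable_model_mass:
      "(\<lambda>X. \<integral>\<^sup>+\<theta>\<in>A. ennreal (\<Prod>i<n. f \<theta> (X i) / fo (X i)) \<partial>\<pi>) \<in> borel_measurable (sample_law M fo n)"
    and model_mass_le: "\<And>E b. E \<in> sets (sample_law M fo n) \<Longrightarrow> (\<And>\<theta>. \<theta> \<in> A \<Longrightarrow>
        (\<integral>\<^sup>+X. ennreal (\<Prod>i<n. f \<theta> (X i) / fo (X i)) * indicator E X \<partial>sample_law M fo n) \<le> b) \<Longrightarrow>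
      (\<integral>\<^sup>+X. (\<integral>\<^sup>+\<theta>\<in>A. ennreal (\<Prod>i<n. f \<theta> (X i) / fo (X i)) \<partial>\<pi>) * indicator E X \<partial>sample_law M fo n) \<le> b"
proof -
  let ?S = "sample_law M fo n" and ?F = "\<lambda>\<theta> X. ennreal (\<Prod>i<n. f \<theta> (X i) / fo (X i))"
  interpret \<pi>: prob_space \<pi> by fact
  interpret S: prob_space ?S using fo by (rule prob_space_sample_law)
  interpret pair_sigma_finite \<pi> ?S by unfold_locales
  note borel_measurable_likelihood_ratio[OF fo meas, measurable]
  note A[measurable]
  show "(\<lambda>X. \<integral>\<^sup>+\<theta>\<in>A. ?F \<theta> X \<partial>\<pi>) \<in> borel_measurable ?S"
    by (intro \<pi>.borel_measurable_nn_integral) measurable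
  fix E b assume E[measurable]: "E \<in> sets ?S"
    and le: "\<And>\<theta>. \<theta> \<in> A \<Longrightarrow> (\<integral>\<^sup>+X. ?F \<theta> X * indicator E X \<partial>?S) \<le> b"
  have "(\<integral>\<^sup>+X. (\<integral>\<^sup>+\<theta>\<in>A. ?F \<theta> X \<partial>\<pi>) * indicator E X \<partial>?S)
      = (\<integral>\<^sup>+X. (\<integral>\<^sup>+\<theta>. ?F \<theta> X * indicator A \<theta> * indicator E X \<partial>\<pi>) \<partial>?S)"
    by (intro nn_integral_cong nn_integral_multc[symmetric]) measurable
  also have "\<dots> = (\<integral>\<^sup>+\<theta>. (\<integral>\<^sup>+X. ?F \<theta> X * indicator A \<theta> * indicator E X \<partial>?S) \<partial>\<pi>)"
    by (intro Fubini') measurable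
  also have "\<dots> \<le> (\<integral>\<^sup>+\<theta>. b \<partial>\<pi>)"
  proof (intro nn_integral_mono)
    fix \<theta>
    show "(\<integral>\<^sup>+X. ?F \<theta> X * indicator A \<theta> * indicator E X \<partial>?S) \<le> b"
      using le[of \<theta>] by (cases "\<theta> \<in> A") auto
  qed
  also have "\<dots> = b" by (simp add: \<pi>.emeasure_space_1)
  finally show "(\<integral>\<^sup>+X. (\<integral>\<^sup>+\<theta>\<in>A. ?F \<theta> X \<partial>\<pi>) * indicator E X \<partial>?S) \<le> b" .
qed

text \<open>Only an inequality, because mass that \<open>g\<close> puts where \<open>fo\<close>
  vanishes is lost: the quotient is 0 there. It is the trivial estimate for models too large to be
  tested.\<close>

lemma likelihood_ratio_expectation_le_1:
  assumes fo: "prob_density M fo" and g: "prob_density M g"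
  shows "(\<integral>\<^sup>+X. ennreal (\<Prod>i<n. g (X i) / fo (X i)) \<partial>sample_law M fo n) \<le> 1"
proof -
  have [measurable]: "fo \<in> borel_measurable M" "g \<in> borel_measurable M"
    using fo g by (auto dest: prob_densityD(1))
  have nn: "0 \<le> fo x" "0 \<le> g x" if "x \<in> space M" for x
    using that prob_densityD(2)[OF fo] prob_densityD(2)[OF g] by auto
  have "(\<integral>\<^sup>+X. ennreal (\<Prod>i<n. g (X i) / fo (X i)) \<partial>sample_law M fo n)
      = (\<integral>\<^sup>+X. (\<Prod>i<n. ennreal (g (X i) / fo (X i))) \<partial>sample_law M fo n)"
  proof (intro nn_integral_cong prod_ennreal[symmetric])
    fix X i assume "X \<in> space (sample_law M fo n)" "i \<in> {..<n}"
    then have "X i \<in> space M" by (auto intro: space_sample_law)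
    then show "0 \<le> g (X i) / fo (X i)" using nn by simp
  qed
  also have "\<dots> = (\<integral>\<^sup>+x. ennreal (fo x) * ennreal (g x / fo x) \<partial>M) ^ n"
    by (intro nn_integral_sample_law_prod fo) measurable
  also have "(\<integral>\<^sup>+x. ennreal (fo x) * ennreal (g x / fo x) \<partial>M) \<le> (\<integral>\<^sup>+x. ennreal (g x) \<partial>M)"
  proof (intro nn_integral_mono)
    fix x assume x: "x \<in> space M"
    have "fo x * (g x / fo x) \<le> g x" using nn[OF x] by simp
    then show "ennreal (fo x) * ennreal (g x / fo x) \<le> ennreal (g x)"
      using nn[OF x] by (simp add: ennreal_leI flip: ennreal_mult)
  qed
  also have "(\<integral>\<^sup>+x. ennreal (g x) \<partial>M) = 1" using g by (simp add: prob_density_def)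
  finally show ?thesis by (simp add: power_mono)
qed

section \<open>Numerator of the posterior under the sieve prior\<close>

context
  fixes M :: "'s measure" and fo :: "'s \<Rightarrow> real" and J :: "'j set" and \<Theta> :: "'j \<Rightarrow> 't set"
    and f :: "'j \<Rightarrow> 't \<Rightarrow> 's \<Rightarrow> real" and \<pi> :: "'j \<Rightarrow> 't measure"
  assumes fo: "prob_density M fo" and J: "countable J"
    and dens: "\<And>j \<theta>. j \<in> J \<Longrightarrow> \<theta> \<in> \<Theta> j \<Longrightarrow> prob_density M (f j \<theta>)"
    and prior: "\<And>j. j \<in> J \<Longrightarrow> prob_space (\<pi> j) \<and> space (\<pi> j) = \<Theta> j"
    and meas: "\<And>j. j \<in> J \<Longrightarrow> (\<lambda>(\<theta>, x). f j \<theta> x) \<in> borel_measurable (\<pi> j \<Otimes>\<^sub>M M)"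
begin

lemma sets_hellinger_gt: "j \<in> J \<Longrightarrow> {\<theta> \<in> \<Theta> j. s < hellinger M (f j \<theta>) fo} \<in> sets (\<pi> j)"
  using borel_measurable_hellinger[OF fo, of "\<pi> j" "f j"] prior[of j] dens[of j] meas[of j]
  by (auto dest!: borel_measurable_less[OF borel_measurable_const[of s]])

lemma borel_measurable_sieve_mass:
  "(\<lambda>X. sieve_mass fo J \<Theta> f \<pi> a n X (\<lambda>g. s < hellinger M g fo)) \<in> borel_measurable (sample_law M fo n)"
proof -
  interpret C: sigma_finite_measure "count_space J" using J by (rule sigma_finite_measure_count_space_countable)
  show ?thesis
    unfolding sieve_mass_def
  proof (intro C.borel_measurable_nn_integral)
    have "(\<lambda>z. ennreal (a (fst z)) * (\<integral>\<^sup>+\<theta>\<in>{\<theta> \<in> \<Theta> (fst z). s < hellinger M (f (fst z) \<theta>) fo}.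
        ennreal (\<Prod>i<n. f (fst z) \<theta> (snd z i) / fo (snd z i)) \<partial>\<pi> (fst z)))
        \<in> borel_measurable (count_space J \<Otimes>\<^sub>M sample_law M fo n)"
    proof (rule measurable_pair_measure_countable1[OF J])
      fix j assume j: "j \<in> J"
      then show "(\<lambda>y. ennreal (a (fst (j, y))) * (\<integral>\<^sup>+\<theta>\<in>{\<theta> \<in> \<Theta> (fst (j, y)). s < hellinger M (f (fst (j, y)) \<theta>) fo}.
          ennreal (\<Prod>i<n. f (fst (j, y)) \<theta> (snd (j, y) i) / fo (snd (j, y) i)) \<partial>\<pi> (fst (j, y))))
          \<in> borel_measurable (sample_law M fo n)"
        using borel_measurable_model_mass[OF fo _ meas[OF j] sets_hellinger_gt[OF j]] prior[OF j] by simp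
    qed
    from measurable_compose[OF measurable_pair_swap' this]
    show "(\<lambda>(X, j). ennreal (a j) * (\<integral>\<^sup>+\<theta>\<in>{\<theta> \<in> \<Theta> j. s < hellinger M (f j \<theta>) fo}.
        ennreal (\<Prod>i<n. f j \<theta> (X i) / fo (X i)) \<partial>\<pi> j)) \<in> borel_measurable (sample_law M fo n \<Otimes>\<^sub>M count_space J)"
      by (simp add: case_prod_beta)
  qed
qed

text \<open>\<open>R\<close> separates models with tests from models without. A tested model has at
  most \<open>exp (\<eta> j) = exp (2 * \<eta> j) * exp (- \<eta> j)\<close> tests per shell; the
  first factor is at most \<open>exp (2 * R)\<close> and the second is summable over
  \<open>J\<close>. An untested model has weight at most
  \<open>\<alpha> * exp (- \<kappa> * R) * exp (- \<eta> j)\<close>, again summable.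
  \<open>R\<close> stays free because the two errors pull it in opposite directions.\<close>

lemma sieve_mass_exceptional_set:
  fixes A m \<eta> a :: "'j \<Rightarrow> real" and s R \<alpha> \<kappa> :: real
  assumes cov: "\<And>j r \<delta> \<theta>. j \<in> J \<Longrightarrow> r > 0 \<Longrightarrow> 0 < \<delta> \<Longrightarrow> \<delta> \<le> 0.0056 * r \<Longrightarrow> \<theta> \<in> \<Theta> j \<Longrightarrow>
      ereal_of_enat (covering_number (\<Theta> j) (\<lambda>\<theta> \<eta>. sup_log_dist M (f j \<theta>) (f j \<eta>))
        (hellinger_param_ball M (\<Theta> j) (f j) \<theta> r) \<delta>) \<le> ereal ((A j * r / \<delta>) powr m j)"
    and N: "\<And>j. j \<in> J \<Longrightarrow> (A j / 0.0056) powr m j \<le> exp (\<eta> j)"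
    and sum\<eta>: "(\<integral>\<^sup>+j. ennreal (exp (- \<eta> j)) \<partial>count_space J) \<le> 1"
    and suma: "(\<integral>\<^sup>+j. ennreal (a j) \<partial>count_space J) \<le> 1"
    and a: "\<And>j. j \<in> J \<Longrightarrow> a j = \<alpha> * exp (- (1 + \<kappa>) * \<eta> j)" and \<alpha>: "0 \<le> \<alpha>" and \<kappa>: "0 \<le> \<kappa>"
    and s: "0 < s" and large: "1 \<le> real n * (s\<^sup>2 / 8)"
  obtains E where "E \<in> sets (sample_law M fo n)"
    "emeasure (sample_law M fo n) E \<le> ennreal (2 * exp (2 * R - real n * (s\<^sup>2 / 8)))"
    "(\<integral>\<^sup>+X. sieve_mass fo J \<Theta> f \<pi> a n X (\<lambda>g. s < hellinger M g fo) * indicator (space (sample_law M fo n) - E) X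
        \<partial>sample_law M fo n) \<le> ennreal (exp (- (real n * (s\<^sup>2 / 8))) + \<alpha> * exp (- \<kappa> * R))"
proof -
  let ?S = "sample_law M fo n" and ?y = "real n * (s\<^sup>2 / 8)"
  let ?P = "\<lambda>j E. E \<in> sets ?S \<and> emeasure ?S E \<le> ennreal ((A j / 0.0056) powr m j * (2 * exp (- ?y))) \<and>
    (\<forall>\<theta>\<in>\<Theta> j. s < hellinger M (f j \<theta>) fo \<longrightarrow>
       (\<integral>\<^sup>+X. ennreal (\<Prod>i<n. f j \<theta> (X i) / fo (X i)) * indicator (space ?S - E) X \<partial>?S) \<le> ennreal (exp (- ?y)))"
  have ex: "\<forall>j\<in>J. \<exists>E. ?P j E"
  proof
    fix j assume j: "j \<in> J"
    show "\<exists>E. ?P j E"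
      by (rule hellinger_exterior_exceptional_set[OF dens[OF j] fo s cov[OF j] large]; (assumption | blast))
  qed
  from bchoice[OF ex] obtain E0 where E0: "\<forall>j\<in>J. ?P j (E0 j)" ..
  define E1 where "E1 j = (if \<eta> j \<le> R then E0 j else {})" for j
  have E1: "E1 j \<in> sets ?S" if "j \<in> J" for j using E0 that by (auto simp: E1_def)
  define E where "E = (\<Union>j\<in>J. E1 j)"
  have E: "E \<in> sets ?S" unfolding E_def using J E1 by (intro sets.countable_UN') auto
  show thesis
  proof (rule that[OF E])
    have "emeasure ?S E \<le> (\<integral>\<^sup>+j. emeasure ?S (E1 j) \<partial>count_space J)"
      unfolding E_def using J E1 by (rule emeasure_UN_le_nn_integral)
    also have "\<dots> \<le> (\<integral>\<^sup>+j. ennreal (2 * exp (2 * R - ?y)) * ennreal (exp (- \<eta> j)) \<partial>count_space J)"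
    proof (intro nn_integral_mono)
      fix j assume "j \<in> space (count_space J)"
      then have j: "j \<in> J" by simp
      show "emeasure ?S (E1 j) \<le> ennreal (2 * exp (2 * R - ?y)) * ennreal (exp (- \<eta> j))"
      proof (cases "\<eta> j \<le> R")
        case True
        have "emeasure ?S (E1 j) \<le> ennreal ((A j / 0.0056) powr m j * (2 * exp (- ?y)))"
          using E0 j True by (simp add: E1_def)
        also have "\<dots> \<le> ennreal (exp (\<eta> j) * (2 * exp (- ?y)))"
          using N[OF j] by (intro ennreal_leI mult_right_mono) auto
        also have "\<dots> = ennreal (2 * exp (\<eta> j - ?y))" using exp_add[of "\<eta> j" "- ?y"] by simp
        also have "\<dots> \<le> ennreal (2 * exp (2 * R - ?y + - \<eta> j))" using True by (intro ennreal_leI) simp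
        also have "\<dots> = ennreal (2 * exp (2 * R - ?y)) * ennreal (exp (- \<eta> j))"
          by (simp only: exp_add mult.assoc[symmetric]) (simp add: ennreal_mult)
        finally show ?thesis .
      qed (simp add: E1_def)
    qed
    also have "\<dots> = ennreal (2 * exp (2 * R - ?y)) * (\<integral>\<^sup>+j. ennreal (exp (- \<eta> j)) \<partial>count_space J)"
      by (intro nn_integral_cmult) simp
    also have "\<dots> \<le> ennreal (2 * exp (2 * R - ?y)) * 1" by (intro mult_left_mono sum\<eta>) simp
    finally show "emeasure ?S E \<le> ennreal (2 * exp (2 * R - ?y))" by simp
  next
    let ?I = "\<lambda>j X. \<integral>\<^sup>+\<theta>\<in>{\<theta> \<in> \<Theta> j. s < hellinger M (f j \<theta>) fo}. ennreal (\<Prod>i<n. f j \<theta> (X i) / fo (X i)) \<partial>\<pi> j"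
    have I_meas: "?I j \<in> borel_measurable ?S" if "j \<in> J" for j
      using borel_measurable_model_mass[OF fo _ meas[OF that] sets_hellinger_gt[OF that]] prior[OF that] by simp
    have E': "space ?S - E \<in> sets ?S" using E by auto
    have "(\<integral>\<^sup>+X. sieve_mass fo J \<Theta> f \<pi> a n X (\<lambda>g. s < hellinger M g fo) * indicator (space ?S - E) X \<partial>?S)
        = (\<integral>\<^sup>+X. (\<integral>\<^sup>+j. ennreal (a j) * ?I j X * indicator (space ?S - E) X \<partial>count_space J) \<partial>?S)"
      unfolding sieve_mass_def by (intro nn_integral_cong nn_integral_multc[symmetric]) simp
    also have "\<dots> = (\<integral>\<^sup>+j. (\<integral>\<^sup>+X. ennreal (a j) * ?I j X * indicator (space ?S - E) X \<partial>?S) \<partial>count_space J)"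
      using I_meas E' by (intro nn_integral_count_space_nn_integral J borel_measurable_times_ennreal
        borel_measurable_const borel_measurable_indicator)
    \<comment> \<open>Each model needs only one of the two summands; taking both avoids splitting
      \<open>J\<close>.\<close>
    also have "\<dots> \<le> (\<integral>\<^sup>+j. ennreal (exp (- ?y)) * ennreal (a j) + ennreal (\<alpha> * exp (- \<kappa> * R)) * ennreal (exp (- \<eta> j)) \<partial>count_space J)"
    proof (intro nn_integral_mono)
      fix j assume "j \<in> space (count_space J)"
      then have j: "j \<in> J" by simp
      have "(\<integral>\<^sup>+X. ennreal (a j) * ?I j X * indicator (space ?S - E) X \<partial>?S)
          = ennreal (a j) * (\<integral>\<^sup>+X. ?I j X * indicator (space ?S - E) X \<partial>?S)"
        unfolding mult.assoc using I_meas[OF j] E'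
        by (intro nn_integral_cmult borel_measurable_times_ennreal borel_measurable_indicator)
      also have "\<dots> \<le> ennreal (exp (- ?y)) * ennreal (a j) + ennreal (\<alpha> * exp (- \<kappa> * R)) * ennreal (exp (- \<eta> j))"
      proof (cases "\<eta> j \<le> R")
        case True
        have "(\<integral>\<^sup>+X. ?I j X * indicator (space ?S - E) X \<partial>?S) \<le> ennreal (exp (- ?y))"
        proof (rule model_mass_le[OF fo _ meas[OF j] sets_hellinger_gt[OF j] E'])
          show "prob_space (\<pi> j)" using prior j by blast
          fix \<theta> assume th: "\<theta> \<in> {\<theta> \<in> \<Theta> j. s < hellinger M (f j \<theta>) fo}"
          have "(\<integral>\<^sup>+X. ennreal (\<Prod>i<n. f j \<theta> (X i) / fo (X i)) * indicator (space ?S - E) X \<partial>?S)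
            \<le> (\<integral>\<^sup>+X. ennreal (\<Prod>i<n. f j \<theta> (X i) / fo (X i)) * indicator (space ?S - E0 j) X \<partial>?S)"
            using True j by (intro nn_integral_mono mult_left_mono) (auto simp: E_def E1_def split: split_indicator)
          also have "\<dots> \<le> ennreal (exp (- ?y))" using E0 j th by blast
          finally show "(\<integral>\<^sup>+X. ennreal (\<Prod>i<n. f j \<theta> (X i) / fo (X i)) * indicator (space ?S - E) X \<partial>?S) \<le> ennreal (exp (- ?y))" .
        qed
        then have "ennreal (a j) * (\<integral>\<^sup>+X. ?I j X * indicator (space ?S - E) X \<partial>?S) \<le> ennreal (a j) * ennreal (exp (- ?y))"
          by (rule mult_left_mono) simp
        then show ?thesis by (simp add: mult.commute add_increasing2)
      next
        case False
        have "(\<integral>\<^sup>+X. ?I j X * indicator (space ?S - E) X \<partial>?S) \<le> 1"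
        proof (rule model_mass_le[OF fo _ meas[OF j] sets_hellinger_gt[OF j] E'])
          show "prob_space (\<pi> j)" using prior j by blast
          fix \<theta> assume th: "\<theta> \<in> {\<theta> \<in> \<Theta> j. s < hellinger M (f j \<theta>) fo}"
          have "(\<integral>\<^sup>+X. ennreal (\<Prod>i<n. f j \<theta> (X i) / fo (X i)) * indicator (space ?S - E) X \<partial>?S)
            \<le> (\<integral>\<^sup>+X. ennreal (\<Prod>i<n. f j \<theta> (X i) / fo (X i)) \<partial>?S)"
            by (intro nn_integral_mono) (auto split: split_indicator)
          also have "\<dots> \<le> 1" using dens[OF j] th by (intro likelihood_ratio_expectation_le_1 fo) auto
          finally show "(\<integral>\<^sup>+X. ennreal (\<Prod>i<n. f j \<theta> (X i) / fo (X i)) * indicator (space ?S - E) X \<partial>?S) \<le> 1" .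
        qed
        then have "ennreal (a j) * (\<integral>\<^sup>+X. ?I j X * indicator (space ?S - E) X \<partial>?S) \<le> ennreal (a j) * 1"
          by (rule mult_left_mono) simp
        also have "\<dots> \<le> ennreal (\<alpha> * exp (- \<kappa> * R) * exp (- \<eta> j))"
        proof -
          have "\<kappa> * R \<le> \<kappa> * \<eta> j" using False \<kappa> by (intro mult_left_mono) auto
          then have "exp (- (1 + \<kappa>) * \<eta> j) \<le> exp (- \<kappa> * R + - \<eta> j)" by (simp add: algebra_simps)
          then have "\<alpha> * exp (- (1 + \<kappa>) * \<eta> j) \<le> \<alpha> * exp (- \<kappa> * R + - \<eta> j)" using \<alpha> by (rule mult_left_mono)
          then show ?thesis unfolding a[OF j] exp_add mult_1_right mult.assoc by (rule ennreal_leI)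
        qed
        also have "\<dots> = ennreal (\<alpha> * exp (- \<kappa> * R)) * ennreal (exp (- \<eta> j))" using \<alpha> by (intro ennreal_mult) auto
        finally show ?thesis by (rule order_trans) simp
      qed
      finally show "(\<integral>\<^sup>+X. ennreal (a j) * ?I j X * indicator (space ?S - E) X \<partial>?S)
        \<le> ennreal (exp (- ?y)) * ennreal (a j) + ennreal (\<alpha> * exp (- \<kappa> * R)) * ennreal (exp (- \<eta> j))" .
    qed
    also have "\<dots> = ennreal (exp (- ?y)) * (\<integral>\<^sup>+j. ennreal (a j) \<partial>count_space J)
        + ennreal (\<alpha> * exp (- \<kappa> * R)) * (\<integral>\<^sup>+j. ennreal (exp (- \<eta> j)) \<partial>count_space J)"
      by (subst nn_integral_add) (simp_all add: nn_integral_cmult)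
    also have "\<dots> \<le> ennreal (exp (- ?y)) * 1 + ennreal (\<alpha> * exp (- \<kappa> * R)) * 1"
      by (intro add_mono mult_left_mono suma sum\<eta>) auto
    also have "\<dots> = ennreal (exp (- ?y) + \<alpha> * exp (- \<kappa> * R))" using \<alpha> by (simp add: ennreal_plus)
    finally show "(\<integral>\<^sup>+X. sieve_mass fo J \<Theta> f \<pi> a n X (\<lambda>g. s < hellinger M g fo) * indicator (space ?S - E) X \<partial>?S)
        \<le> ennreal (exp (- ?y) + \<alpha> * exp (- \<kappa> * R))" .
  qed
qed

end

section \<open>Evidence and prior mass\<close>

lemma borel_measurable_log_ratio:
  assumes [measurable]: "g \<in> borel_measurable M" "h \<in> borel_measurable M"
  shows "(\<lambda>x. log_ratio (g x) (h x)) \<in> borel_measurable M"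
  unfolding log_ratio_def by measurable

lemma AE_density_prob_density_pos:
  assumes fo: "prob_density M fo"
  shows "AE x in density M (\<lambda>x. ennreal (fo x)). 0 < fo x"
proof -
  have [measurable]: "fo \<in> borel_measurable M" using fo by (rule prob_densityD)
  show ?thesis by (subst AE_density) auto
qed

lemma AE_density_of_AE:
  assumes fo: "prob_density M fo" and "AE x in M. 0 < fo x \<longrightarrow> Q x"
  shows "AE x in density M (\<lambda>x. ennreal (fo x)). Q x"
proof -
  have [measurable]: "fo \<in> borel_measurable M" using fo by (rule prob_densityD)
  show ?thesis using assms(2) by (subst AE_density) auto
qed

lemma AE_of_AE_density:
  assumes fo: "prob_density M fo" and "AE x in density M (\<lambda>x. ennreal (fo x)). Q x"
  shows "AE x in M. 0 < fo x \<longrightarrow> Q x"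
proof -
  have [measurable]: "fo \<in> borel_measurable M" using fo by (rule prob_densityD)
  show ?thesis using assms(2) by (subst (asm) AE_density) auto
qed

text \<open>Where exactly one of \<open>g\<close> and \<open>h\<close> vanishes, the squared log
  ratio is infinite, so a finite integral confines such points to a null set of the law of
  \<open>fo\<close>. Applied along \<open>fo\<close>, \<open>b\<close>, \<open>g\<close>, this
  yields the positivity that real logarithms require.\<close>

lemma sq_log_integral_finite_AE:
  assumes fo: "prob_density M fo" and g: "prob_density M g" and h: "prob_density M h"
    and fin: "sq_log_integral M fo g h \<le> ereal v"
  shows "AE x in density M (\<lambda>x. ennreal (fo x)). g x = 0 \<longleftrightarrow> h x = 0"
proof (rule AE_density_of_AE[OF fo])
  have [measurable]: "fo \<in> borel_measurable M" using fo by (rule prob_densityD)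
  have [measurable]: "(\<lambda>x. log_ratio (g x) (h x)) \<in> borel_measurable M"
    using g h by (intro borel_measurable_log_ratio) (auto dest: prob_densityD(1))
  let ?F = "\<lambda>x. e2ennreal (ereal (fo x) * (log_ratio (g x) (h x))\<^sup>2)"
  have F: "?F \<in> borel_measurable M" unfolding power2_eq_square by measurable
  have "(\<integral>\<^sup>+x. ?F x \<partial>M) \<noteq> \<infinity>" using fin by (auto simp: sq_log_integral_def)
  then have "AE x in M. ?F x \<noteq> \<infinity>" by (rule nn_integral_noteq_infinite[OF F])
  then show "AE x in M. 0 < fo x \<longrightarrow> (g x = 0 \<longleftrightarrow> h x = 0)"
  proof eventually_elim
    case (elim x)
    show ?case
    proof
      assume "0 < fo x"
      then show "g x = 0 \<longleftrightarrow> h x = 0" using elim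
        by (auto simp: log_ratio_def power2_eq_square split: if_splits)
    qed
  qed
qed

lemma log_ratio_pos: "0 < a \<Longrightarrow> 0 < b \<Longrightarrow> log_ratio a b = ereal (ln (a / b))"
  by (simp add: log_ratio_def)

lemma sq_log_integral_eq:
  assumes fo: "prob_density M fo" and g: "prob_density M g" and h: "prob_density M h"
    and pos: "AE x in density M (\<lambda>x. ennreal (fo x)). 0 < g x \<and> 0 < h x"
  shows "sq_log_integral M fo g h =
    enn2ereal (\<integral>\<^sup>+x. ennreal ((ln (g x / h x))\<^sup>2) \<partial>density M (\<lambda>x. ennreal (fo x)))"
proof -
  have [measurable]: "fo \<in> borel_measurable M" "g \<in> borel_measurable M" "h \<in> borel_measurable M"
    using fo g h by (auto dest: prob_densityD(1))
  have "AE x in M. e2ennreal (ereal (fo x) * (log_ratio (g x) (h x))\<^sup>2)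
      = ennreal (fo x) * ennreal ((ln (g x / h x))\<^sup>2)"
    using AE_of_AE_density[OF fo pos] AE_space
  proof eventually_elim
    case (elim x)
    show ?case
    proof (cases "fo x = 0")
      \<comment> \<open>In \<open>ereal\<close>, 0 times the squared log ratio is 0 even where the
        latter is infinite.\<close>
      case True
      then show ?thesis by (simp add: zero_ereal_def[symmetric])
    next
      case False
      then have "0 < fo x" using elim(2) prob_densityD(2)[OF fo, of x] by simp
      then show ?thesis using elim(1)
        by (simp add: log_ratio_pos power2_eq_square e2ennreal_ereal ennreal_mult[symmetric])
    qed
  qed
  from nn_integral_cong_AE[OF this] show ?thesis
    unfolding sq_log_integral_def by (subst nn_integral_density) simp_all
qed

lemma KL_div_eq:
  assumes fo: "prob_density M fo" and g: "prob_density M g"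
    and pos: "AE x in density M (\<lambda>x. ennreal (fo x)). 0 < g x"
    and int: "integrable (density M (\<lambda>x. ennreal (fo x))) (\<lambda>x. ln (fo x / g x))"
  shows "KL_div M fo g = ereal (\<integral>x. ln (fo x / g x) \<partial>density M (\<lambda>x. ennreal (fo x)))"
proof -
  let ?P = "density M (\<lambda>x. ennreal (fo x))" and ?L = "\<lambda>x. ln (fo x / g x)"
  have [measurable]: "fo \<in> borel_measurable M" "g \<in> borel_measurable M"
    using fo g by (auto dest: prob_densityD(1))
  have ae: "AE x in M. ereal (fo x) * log_ratio (fo x) (g x) = ereal (fo x * ?L x) \<and> 0 \<le> fo x"
    using AE_of_AE_density[OF fo pos] AE_space
  proof eventually_elim
    case (elim x)
    have "0 \<le> fo x" using elim(2) prob_densityD(2)[OF fo, of x] by simp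
    then show ?case
      using elim(1) by (cases "fo x = 0") (auto simp: log_ratio_pos zero_ereal_def[symmetric])
  qed
  have 1: "(\<integral>\<^sup>+x. e2ennreal (ereal (fo x) * log_ratio (fo x) (g x)) \<partial>M) = (\<integral>\<^sup>+x. ennreal (?L x) \<partial>?P)"
    by (subst nn_integral_density)
       (use ae in \<open>auto intro!: nn_integral_cong_AE elim!: AE_mp simp: e2ennreal_ereal ennreal_mult'\<close>)
  have 2: "(\<integral>\<^sup>+x. e2ennreal (- (ereal (fo x) * log_ratio (fo x) (g x))) \<partial>M) = (\<integral>\<^sup>+x. ennreal (- ?L x) \<partial>?P)"
    by (subst nn_integral_density)
       (use ae in \<open>auto intro!: nn_integral_cong_AE elim!: AE_mp simp: e2ennreal_ereal ennreal_mult'[symmetric]\<close>)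
  have fin: "(\<integral>\<^sup>+x. ennreal (?L x) \<partial>?P) < \<infinity>" "(\<integral>\<^sup>+x. ennreal (- ?L x) \<partial>?P) < \<infinity>"
    using int by (auto simp: real_integrable_def top.not_eq_extremum)
  have e: "enn2ereal z = ereal (enn2real z)" if "z < \<infinity>" for z
    using that by (cases z) auto
  show ?thesis
    unfolding KL_div_def 1 2 e[OF fin(1)] e[OF fin(2)] using real_lebesgue_integral_def[OF int] by simp
qed

text \<open>The second moment goes through the approximating density \<open>b\<close>:
  \<open>ln (fo / g) = ln (fo / b) + ln (b / g)\<close>, and the square of a sum is at most twice
  the sum of the squares. The first moment has no such bound by the divergence at \<open>b\<close>;
  it comes from the hypothesis that the divergence is controlled by the second moment.
  \<open>\<bar>K\<bar>\<close> appears because the sign of \<open>K\<close> is unknown.\<close>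

lemma log_likelihood_moments:
  assumes fo: "prob_density M fo" and b: "prob_density M b" and g: "prob_density M g"
    and vb: "KL_var M fo b \<le> ereal v" and vg: "sq_log_integral M fo b g \<le> ereal w"
    and KL: "KL_div M fo g \<le> ereal K * KL_var M fo g"
  defines "P \<equiv> density M (\<lambda>x. ennreal (fo x))"
  shows "AE x in P. 0 < g x / fo x"
    and "integrable P (\<lambda>x. - ln (g x / fo x))"
    and "integrable P (\<lambda>x. (- ln (g x / fo x))\<^sup>2)"
    and "(\<integral>x. (- ln (g x / fo x))\<^sup>2 \<partial>P) \<le> 2 * v + 2 * w"
    and "(\<integral>x. - ln (g x / fo x) \<partial>P) \<le> \<bar>K\<bar> * (2 * v + 2 * w)"
proof -
  interpret P: prob_space P unfolding P_def using fo by (rule prob_space_prob_density)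
  have fm[measurable]: "fo \<in> borel_measurable M" "b \<in> borel_measurable M" "g \<in> borel_measurable M"
    using fo b g by (auto dest: prob_densityD(1))
  have [measurable_cong]: "sets P = sets M" by (simp add: P_def)
  have sp: "AE x in P. 0 \<le> b x \<and> 0 \<le> g x"
    by (rule AE_I2) (use b g in \<open>auto simp: P_def dest: prob_densityD(2)\<close>)
  have pos: "AE x in P. 0 < fo x \<and> 0 < b x \<and> 0 < g x"
    using AE_density_prob_density_pos[OF fo] sp
      sq_log_integral_finite_AE[OF fo fo b vb[unfolded KL_var_def]] sq_log_integral_finite_AE[OF fo b g vg]
    unfolding P_def[symmetric] by eventually_elim auto
  show "AE x in P. 0 < g x / fo x" using pos by eventually_elim simp
  have vb0: "(\<integral>\<^sup>+x. ennreal ((ln (fo x / b x))\<^sup>2) \<partial>P) \<le> ennreal v"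
  proof -
    have "enn2ereal (\<integral>\<^sup>+x. ennreal ((ln (fo x / b x))\<^sup>2) \<partial>P) \<le> ereal v"
      using vb pos unfolding KL_var_def P_def by (subst (asm) sq_log_integral_eq[OF fo fo b]) auto
    then show ?thesis by (metis e2ennreal_enn2ereal e2ennreal_ereal e2ennreal_mono)
  qed
  have vg0: "(\<integral>\<^sup>+x. ennreal ((ln (b x / g x))\<^sup>2) \<partial>P) \<le> ennreal w"
  proof -
    have "enn2ereal (\<integral>\<^sup>+x. ennreal ((ln (b x / g x))\<^sup>2) \<partial>P) \<le> ereal w"
      using vg pos unfolding P_def by (subst (asm) sq_log_integral_eq[OF fo b g]) auto
    then show ?thesis by (metis e2ennreal_enn2ereal e2ennreal_ereal e2ennreal_mono)
  qed
  have nonneg: "0 \<le> v" "0 \<le> w"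
  proof -
    have "0 \<le> KL_var M fo b" "0 \<le> sq_log_integral M fo b g" by (simp_all add: KL_var_def sq_log_integral_def)
    then show "0 \<le> v" "0 \<le> w" using vb vg by (metis ereal_less_eq(5) order_trans)+
  qed
  have "(\<integral>\<^sup>+x. ennreal ((- ln (g x / fo x))\<^sup>2) \<partial>P)
    \<le> (\<integral>\<^sup>+x. 2 * ennreal ((ln (fo x / b x))\<^sup>2) + 2 * ennreal ((ln (b x / g x))\<^sup>2) \<partial>P)"
  proof (rule nn_integral_mono_AE)
    show "AE x in P. ennreal ((- ln (g x / fo x))\<^sup>2) \<le> 2 * ennreal ((ln (fo x / b x))\<^sup>2) + 2 * ennreal ((ln (b x / g x))\<^sup>2)"
      using pos
    proof eventually_elim
      case (elim x)
      define p q where "p = ln (fo x / b x)" and "q = ln (b x / g x)"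
      have "- ln (g x / fo x) = p + q" using elim by (simp add: ln_div p_def q_def)
      moreover have "(p + q)\<^sup>2 \<le> 2 * p\<^sup>2 + 2 * q\<^sup>2"
        using zero_le_power2[of "p - q"] by (simp add: power2_eq_square algebra_simps)
      ultimately have "ennreal ((- ln (g x / fo x))\<^sup>2) \<le> ennreal (2 * p\<^sup>2 + 2 * q\<^sup>2)" by (metis ennreal_leI)
      also have "\<dots> = 2 * ennreal (p\<^sup>2) + 2 * ennreal (q\<^sup>2)" by (simp add: ennreal_plus ennreal_mult)
      finally show ?case by (simp add: p_def q_def)
    qed
  qed
  also have "\<dots> = 2 * (\<integral>\<^sup>+x. ennreal ((ln (fo x / b x))\<^sup>2) \<partial>P) + 2 * (\<integral>\<^sup>+x. ennreal ((ln (b x / g x))\<^sup>2) \<partial>P)"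
    by (subst nn_integral_add) (simp_all add: nn_integral_cmult)
  also have "\<dots> \<le> 2 * ennreal v + 2 * ennreal w" by (intro add_mono mult_left_mono vb0 vg0) auto
  also have "\<dots> = ennreal (2 * v + 2 * w)" using nonneg by (simp add: ennreal_plus ennreal_mult)
  finally have sq: "(\<integral>\<^sup>+x. ennreal ((- ln (g x / fo x))\<^sup>2) \<partial>P) \<le> ennreal (2 * v + 2 * w)" .
  show int2: "integrable P (\<lambda>x. (- ln (g x / fo x))\<^sup>2)"
  proof (rule integrableI_bounded)
    show "(\<lambda>x. (- ln (g x / fo x))\<^sup>2) \<in> borel_measurable P" by measurable
    show "(\<integral>\<^sup>+x. ennreal (norm ((- ln (g x / fo x))\<^sup>2)) \<partial>P) < \<infinity>"
      using le_less_trans[OF sq ennreal_less_top] by simp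
  qed
  show int1: "integrable P (\<lambda>x. - ln (g x / fo x))"
  proof (rule Bochner_Integration.integrable_bound[where f="\<lambda>x. 1 + (- ln (g x / fo x))\<^sup>2"])
    show "integrable P (\<lambda>x. 1 + (- ln (g x / fo x))\<^sup>2)" using int2 by simp
    show "AE x in P. norm (- ln (g x / fo x)) \<le> norm (1 + (- ln (g x / fo x))\<^sup>2)"
    proof (rule AE_I2)
      fix x
      define z where "z = \<bar>ln (g x / fo x)\<bar>"
      have "z \<le> 1 + z\<^sup>2" using zero_le_power2[of "z - 1 / 2"] by (simp add: power2_eq_square algebra_simps)
      then show "norm (- ln (g x / fo x)) \<le> norm (1 + (- ln (g x / fo x))\<^sup>2)" by (simp add: z_def)
    qed
  qed measurable
  let ?W = "\<integral>x. (- ln (g x / fo x))\<^sup>2 \<partial>P"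
  have Weq: "(\<integral>\<^sup>+x. ennreal ((- ln (g x / fo x))\<^sup>2) \<partial>P) = ennreal ?W"
    using int2 by (intro nn_integral_eq_integral) auto
  show W: "?W \<le> 2 * v + 2 * w" using sq nonneg unfolding Weq by (subst (asm) ennreal_le_iff) auto
  have W0: "0 \<le> ?W" by simp
  have neg: "AE x in P. ln (fo x / g x) = - ln (g x / fo x)"
    using pos by eventually_elim (simp add: ln_div)
  have int3: "integrable P (\<lambda>x. ln (fo x / g x))"
  proof (rule integrable_cong_AE_imp[OF int1])
    show "AE x in P. - ln (g x / fo x) = ln (fo x / g x)" using neg by eventually_elim simp
  qed measurable
  have KLeq: "KL_div M fo g = ereal (\<integral>x. - ln (g x / fo x) \<partial>P)"
  proof -
    have "KL_div M fo g = ereal (\<integral>x. ln (fo x / g x) \<partial>P)"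
      using pos int3 unfolding P_def by (intro KL_div_eq fo g) auto
    also have "(\<integral>x. ln (fo x / g x) \<partial>P) = (\<integral>x. - ln (g x / fo x) \<partial>P)"
      using neg by (intro integral_cong_AE) auto
    finally show ?thesis .
  qed
  have "KL_var M fo g = enn2ereal (\<integral>\<^sup>+x. ennreal ((ln (fo x / g x))\<^sup>2) \<partial>P)"
    using pos unfolding KL_var_def P_def by (intro sq_log_integral_eq fo g) auto
  also have "(\<integral>\<^sup>+x. ennreal ((ln (fo x / g x))\<^sup>2) \<partial>P) = ennreal ?W"
    unfolding Weq[symmetric] using neg by (intro nn_integral_cong_AE) (auto elim!: AE_mp)
  finally have "KL_var M fo g = ereal ?W" using W0 by (simp add: enn2ereal_ennreal)
  then have "(\<integral>x. - ln (g x / fo x) \<partial>P) \<le> K * ?W" using KL unfolding KLeq by simp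
  also have "\<dots> \<le> \<bar>K\<bar> * (2 * v + 2 * w)" using W W0 by (intro mult_mono) auto
  finally show "(\<integral>x. - ln (g x / fo x) \<partial>P) \<le> \<bar>K\<bar> * (2 * v + 2 * w)" .
qed

text \<open>A union bound read backwards: at most \<open>N\<close> balls cover a space of mass 1,
  and each has at most \<rho> times the mass \<open>b\<close> of the reference ball. Cover centres
  lie in \<open>T\<close>, so the ratio bound applies to them.\<close>

lemma prior_ball_lower_bound:
  assumes \<nu>: "prob_space \<nu>" "space \<nu> = T"
    and cov: "ereal_of_enat (covering_number T (\<lambda>\<theta> \<eta>. ereal (d \<theta> \<eta>)) T \<epsilon>) \<le> ereal N"
    and meas: "\<And>\<theta>. \<theta> \<in> T \<Longrightarrow> {\<eta> \<in> T. d \<theta> \<eta> \<le> \<epsilon>} \<in> sets \<nu>"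
    and ratio: "\<And>\<theta>. \<theta> \<in> T \<Longrightarrow> measure \<nu> {\<eta> \<in> T. d \<theta> \<eta> \<le> \<epsilon>} \<le> \<rho> * b"
    and "0 \<le> \<rho>" "0 \<le> b"
  shows "1 \<le> N * \<rho> * b"
proof -
  interpret prob_space \<nu> by fact
  obtain S where S: "finite S" "S \<subseteq> T" "T \<subseteq> (\<Union>c\<in>S. {\<theta>\<in>T. ereal (d c \<theta>) \<le> ereal \<epsilon>})" "real (card S) \<le> N"
    using cov by (rule covering_numberE)
  have "1 = measure \<nu> (\<Union>c\<in>S. {\<theta>\<in>T. d c \<theta> \<le> \<epsilon>})"
  proof -
    have "(\<Union>c\<in>S. {\<theta>\<in>T. d c \<theta> \<le> \<epsilon>}) = space \<nu>" using S \<nu> by auto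
    then show ?thesis by (simp add: prob_space)
  qed
  also have "\<dots> \<le> (\<Sum>c\<in>S. measure \<nu> {\<theta>\<in>T. d c \<theta> \<le> \<epsilon>})"
    using S meas by (intro finite_measure_subadditive_finite) auto
  also have "\<dots> \<le> (\<Sum>c\<in>S. \<rho> * b)" using S ratio by (intro sum_mono) auto
  also have "\<dots> = real (card S) * (\<rho> * b)" by simp
  also have "\<dots> \<le> N * (\<rho> * b)" using S \<open>0 \<le> \<rho>\<close> \<open>0 \<le> b\<close> by (intro mult_right_mono) auto
  finally show ?thesis by (simp add: mult.assoc)
qed

text \<open>The equation for \<gamma> says
  \<open>sqrt (1 - 4 * \<gamma>) / \<gamma> = 0.13 / 0.0056\<close>, so the logarithm in
  \<open>sieve_eta\<close> is \<open>L = ln (1072.5 * A j)\<close>. From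
  \<open>A j \<ge> 0.0056\<close> its argument is at least 6.006, beyond \<open>exp 1\<close>, so
  \<open>L \<ge> 1\<close> and multiples of \<open>m j\<close> are absorbed by
  \<open>m j * L\<close>. The last bound converts expressions \<open>(A powr b * K) powr m\<close>
  into exponentials of multiples of \<eta>.\<close>

lemma
  fixes \<gamma> :: real
  assumes \<gamma>: "0 < \<gamma>" "\<gamma> < 1 / 4" "0.13 * \<gamma> / sqrt (1 - 4 * \<gamma>) = 0.0056"
    and A: "A j \<ge> 0.0056" and m: "m j \<ge> 1" and C: "C j \<ge> 0"
  shows sieve_eta_ge_C: "C j \<le> sieve_eta \<gamma> A m C j"
    and sieve_eta_ge_entropy: "m j * ln (A j / 0.0056) \<le> sieve_eta \<gamma> A m C j"
    and sieve_eta_ge_log: "\<And>b k. 0 \<le> b \<Longrightarrow> m j * (b * ln (A j) + k) \<le> (b + \<bar>k\<bar>) * sieve_eta \<gamma> A m C j"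
proof -
  define L where "L = ln (46.2 * A j * sqrt (1 - 4 * \<gamma>) / \<gamma>)"
  have sq: "0 < sqrt (1 - 4 * \<gamma>)" using \<gamma> by simp
  have q: "sqrt (1 - 4 * \<gamma>) / \<gamma> = 0.13 / 0.0056" using \<gamma> sq by (simp add: field_simps)
  have "46.2 * A j * sqrt (1 - 4 * \<gamma>) / \<gamma> = 46.2 * A j * (0.13 / 0.0056)"
    unfolding q[symmetric] by simp
  also have "\<dots> = 1072.5 * A j" by simp
  finally have Leq: "L = ln (1072.5 * A j)" unfolding L_def by (rule arg_cong)
  have "exp 1 \<le> (3::real)" using exp_le by simp
  also have "\<dots> \<le> 1072.5 * A j" using A by simp
  finally have "ln (exp 1) \<le> L" unfolding Leq using A by (subst ln_le_cancel_iff) auto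
  then have L1: "1 \<le> L" by simp
  have LA: "ln (A j / 0.0056) \<le> L" "ln (A j) \<le> L" unfolding Leq using A by (auto intro!: ln_mono)
  have mL: "0 \<le> m j * L" using m L1 by simp
  have g: "1 \<le> 1 / (1 - 4 * \<gamma>)" using \<gamma> by (simp add: field_simps)
  have "4 * (m j * L) * 1 + 8 * C j * 1 \<le> 4 * (m j * L) * (1 / (1 - 4 * \<gamma>)) + 8 * C j * (1 / (1 - 4 * \<gamma>))"
    using mL C g by (intro add_mono mult_left_mono) auto
  then have eta: "4 * (m j * L) + 8 * C j \<le> sieve_eta \<gamma> A m C j"
    by (simp add: sieve_eta_def L_def)
  show "C j \<le> sieve_eta \<gamma> A m C j" using eta mL C by linarith
  have "m j * ln (A j / 0.0056) \<le> m j * L" using LA m by (intro mult_left_mono) auto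
  then show "m j * ln (A j / 0.0056) \<le> sieve_eta \<gamma> A m C j" using eta mL C by linarith
  fix b k :: real assume b: "0 \<le> b"
  have "b * ln (A j) + k \<le> b * L + \<bar>k\<bar> * L"
    using b LA L1 mult_left_mono[OF LA(2) b] mult_left_mono[OF L1, of "\<bar>k\<bar>"] by linarith
  then have "m j * (b * ln (A j) + k) \<le> m j * (b * L + \<bar>k\<bar> * L)" using m by (intro mult_left_mono) auto
  also have "\<dots> = (b + \<bar>k\<bar>) * (m j * L)" by (simp add: algebra_simps)
  also have "\<dots> \<le> (b + \<bar>k\<bar>) * sieve_eta \<gamma> A m C j" using b eta mL C by (intro mult_left_mono) auto
  finally show "m j * (b * ln (A j) + k) \<le> (b + \<bar>k\<bar>) * sieve_eta \<gamma> A m C j" .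
qed

text \<open>The deviation is \<open>t = \<epsilon>^2\<close>, of the same order as the moment
  bounds, so the failure probability is of order \<open>1 / (n * \<epsilon>^2)\<close>.
  \<open>V\<close> collects \<open>2 * \<epsilon>^2\<close> for the step from \<open>fo\<close> to
  \<beta> and \<open>2 * \<bar>K'\<bar> * \<epsilon>^2\<close> for the step from \<beta> to a
  parameter in its ball.\<close>

lemma model_evidence_lower_bound:
  fixes f :: "'t \<Rightarrow> 's \<Rightarrow> real" and d :: "'t \<Rightarrow> 't \<Rightarrow> real" and n :: nat and \<epsilon> K' K'' V :: real
  assumes fo: "prob_density M fo" and \<nu>: "prob_space \<nu>" "space \<nu> = T"
    and dens: "\<And>\<theta>. \<theta> \<in> T \<Longrightarrow> prob_density M (f \<theta>)"
    and meas: "(\<lambda>(\<theta>, x). f \<theta> x) \<in> borel_measurable (\<nu> \<Otimes>\<^sub>M M)"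
    and \<beta>: "\<beta> \<in> T" and \<epsilon>: "0 < \<epsilon>" and n: "0 < n"
    and var: "KL_var M fo (f \<beta>) \<le> ereal (\<epsilon>\<^sup>2)"
    and d: "\<And>\<theta>. \<theta> \<in> T \<Longrightarrow> 0 \<le> d \<beta> \<theta>"
    and sq: "\<And>\<theta>. \<theta> \<in> T \<Longrightarrow> sq_log_integral M fo (f \<beta>) (f \<theta>) \<le> ereal (K' * (d \<beta> \<theta>)\<^sup>2)"
    and KL: "\<And>\<theta>. \<theta> \<in> T \<Longrightarrow> KL_div M fo (f \<theta>) \<le> ereal K'' * KL_var M fo (f \<theta>)"
    and B: "{\<theta> \<in> T. d \<beta> \<theta> \<le> \<epsilon>} \<in> sets \<nu>" "0 < measure \<nu> {\<theta> \<in> T. d \<beta> \<theta> \<le> \<epsilon>}"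
  defines "V \<equiv> 2 + 2 * \<bar>K'\<bar>"
  obtains E where "E \<in> sets (sample_law M fo n)"
    "measure (sample_law M fo n) E \<le> 2 * V / (n * \<epsilon>\<^sup>2)"
    "\<And>X. X \<in> space (sample_law M fo n) - E \<Longrightarrow>
       ennreal (measure \<nu> {\<theta> \<in> T. d \<beta> \<theta> \<le> \<epsilon>} / 2 * exp (- (n * \<epsilon>\<^sup>2) * (\<bar>K''\<bar> * V + 1))) \<le>
         (\<integral>\<^sup>+\<theta>\<in>{\<theta> \<in> T. d \<beta> \<theta> \<le> \<epsilon>}. ennreal (\<Prod>i<n. f \<theta> (X i) / fo (X i)) \<partial>\<nu>)"
proof -
  let ?P = "density M (\<lambda>x. ennreal (fo x))" and ?B = "{\<theta> \<in> T. d \<beta> \<theta> \<le> \<epsilon>}"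
  have [measurable]: "fo \<in> borel_measurable M" using fo by (rule prob_densityD)
  note meas[measurable]
  have [measurable_cong]: "sets ?P = sets M" by simp
  have q: "(\<lambda>(\<theta>, x). f \<theta> x / fo x) \<in> borel_measurable (\<nu> \<Otimes>\<^sub>M ?P)" by measurable
  have sq': "sq_log_integral M fo (f \<beta>) (f \<theta>) \<le> ereal (\<bar>K'\<bar> * \<epsilon>\<^sup>2)" if "\<theta> \<in> ?B" for \<theta>
  proof -
    have "K' * (d \<beta> \<theta>)\<^sup>2 \<le> \<bar>K'\<bar> * (d \<beta> \<theta>)\<^sup>2" by (intro mult_right_mono) auto
    also have "\<dots> \<le> \<bar>K'\<bar> * \<epsilon>\<^sup>2" using that d by (intro mult_left_mono power_mono) auto
    finally have "ereal (K' * (d \<beta> \<theta>)\<^sup>2) \<le> ereal (\<bar>K'\<bar> * \<epsilon>\<^sup>2)" by simp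
    then show ?thesis using sq[of \<theta>] that by (auto intro: order_trans)
  qed
  have Veq: "2 * \<epsilon>\<^sup>2 + 2 * (\<bar>K'\<bar> * \<epsilon>\<^sup>2) = V * \<epsilon>\<^sup>2" by (simp add: V_def algebra_simps)
  have mom: "AE x in ?P. 0 < f \<theta> x / fo x" "integrable ?P (\<lambda>x. - ln (f \<theta> x / fo x))"
    "integrable ?P (\<lambda>x. (- ln (f \<theta> x / fo x))\<^sup>2)"
    "(\<integral>x. (- ln (f \<theta> x / fo x))\<^sup>2 \<partial>?P) \<le> V * \<epsilon>\<^sup>2"
    "(\<integral>x. - ln (f \<theta> x / fo x) \<partial>?P) \<le> \<bar>K''\<bar> * (V * \<epsilon>\<^sup>2)" if "\<theta> \<in> ?B" for \<theta>
  proof -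
    have th: "\<theta> \<in> T" using that by simp
    note log_likelihood_moments[OF fo dens[OF \<beta>] dens[OF th] var sq'[OF that] KL[OF th], unfolded Veq]
    then show "AE x in ?P. 0 < f \<theta> x / fo x" "integrable ?P (\<lambda>x. - ln (f \<theta> x / fo x))"
      "integrable ?P (\<lambda>x. (- ln (f \<theta> x / fo x))\<^sup>2)"
      "(\<integral>x. (- ln (f \<theta> x / fo x))\<^sup>2 \<partial>?P) \<le> V * \<epsilon>\<^sup>2"
      "(\<integral>x. - ln (f \<theta> x / fo x) \<partial>?P) \<le> \<bar>K''\<bar> * (V * \<epsilon>\<^sup>2)" by blast+
  qed
  obtain E where E: "E \<in> sets (Pi\<^sub>M {..<n} (\<lambda>_. ?P))"
    "measure (Pi\<^sub>M {..<n} (\<lambda>_. ?P)) E \<le> 2 * (V * \<epsilon>\<^sup>2) / (n * (\<epsilon>\<^sup>2)\<^sup>2)"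
    "\<And>X. X \<in> space (Pi\<^sub>M {..<n} (\<lambda>_. ?P)) - E \<Longrightarrow>
       ennreal (measure \<nu> ?B / 2 * exp (- n * (\<bar>K''\<bar> * (V * \<epsilon>\<^sup>2) + \<epsilon>\<^sup>2))) \<le>
         (\<integral>\<^sup>+\<theta>\<in>?B. ennreal (\<Prod>i<n. f \<theta> (X i) / fo (X i)) \<partial>\<nu>)"
  proof (rule evidence_lower_bound[OF prob_space_prob_density[OF fo] \<nu>(1) B(1) q])
    show "0 < \<epsilon>\<^sup>2" using \<epsilon> by simp
  qed (use mom n B(2) in \<open>assumption | auto\<close>)+
  show thesis
  proof (rule that[of E])
    show "E \<in> sets (sample_law M fo n)" using E(1) by (simp add: sample_law_def)
    have "2 * (V * \<epsilon>\<^sup>2) / (n * (\<epsilon>\<^sup>2)\<^sup>2) = 2 * V / (n * \<epsilon>\<^sup>2)" using \<epsilon> by (simp add: power2_eq_square)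
    then show "measure (sample_law M fo n) E \<le> 2 * V / (n * \<epsilon>\<^sup>2)" using E(2) by (simp add: sample_law_def)
  next
    fix X assume "X \<in> space (sample_law M fo n) - E"
    then have "X \<in> space (Pi\<^sub>M {..<n} (\<lambda>_. ?P)) - E" by (simp add: sample_law_def)
    from E(3)[OF this]
    show "ennreal (measure \<nu> ?B / 2 * exp (- (n * \<epsilon>\<^sup>2) * (\<bar>K''\<bar> * V + 1))) \<le>
         (\<integral>\<^sup>+\<theta>\<in>?B. ennreal (\<Prod>i<n. f \<theta> (X i) / fo (X i)) \<partial>\<nu>)"
      by (simp add: algebra_simps)
  qed
qed

lemma sieve_mass_ge_model:
  assumes "j \<in> J" "B \<subseteq> \<Theta> j"
  shows "ennreal (a j) * (\<integral>\<^sup>+\<theta>\<in>B. ennreal (\<Prod>i<n. f j \<theta> (X i) / fo (X i)) \<partial>\<pi> j)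
    \<le> sieve_mass fo J \<Theta> f \<pi> a n X (\<lambda>_. True)"
proof -
  let ?I = "\<lambda>j. ennreal (a j) * (\<integral>\<^sup>+\<theta>\<in>{\<theta> \<in> \<Theta> j. True}. ennreal (\<Prod>i<n. f j \<theta> (X i) / fo (X i)) \<partial>\<pi> j)"
  have "ennreal (a j) * (\<integral>\<^sup>+\<theta>\<in>B. ennreal (\<Prod>i<n. f j \<theta> (X i) / fo (X i)) \<partial>\<pi> j) \<le> ?I j"
    using assms(2) by (intro mult_left_mono nn_integral_mono) (auto split: split_indicator)
  also have "\<dots> = (\<integral>\<^sup>+k. ?I j * indicator {j} k \<partial>count_space J)"
    using assms(1) by (subst nn_integral_cmult_indicator) auto
  also have "\<dots> \<le> (\<integral>\<^sup>+k. ?I k \<partial>count_space J)"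
    by (intro nn_integral_mono) (auto split: split_indicator)
  finally show ?thesis by (simp add: sieve_mass_def)
qed

text \<open>The integral of the numerator is controlled only where no test rejects, hence the
  restriction to \<open>F\<close>.\<close>

lemma Markov_inequality_restricted:
  fixes g :: "'x \<Rightarrow> ennreal"
  assumes [measurable]: "g \<in> borel_measurable S" "F \<in> sets S"
    and le: "(\<integral>\<^sup>+X. g X * indicator F X \<partial>S) \<le> ennreal (c * \<tau>)" and "0 < \<tau>" "0 \<le> c"
  shows "emeasure S {X \<in> F. ennreal \<tau> \<le> g X} \<le> ennreal c"
proof -
  have "{X \<in> F. ennreal \<tau> \<le> g X} \<subseteq> {X \<in> F. 1 \<le> ennreal (1 / \<tau>) * g X}"
  proof safe
    fix X assume "ennreal \<tau> \<le> g X"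
    then have "ennreal (1 / \<tau>) * ennreal \<tau> \<le> ennreal (1 / \<tau>) * g X" by (rule mult_left_mono) simp
    then show "1 \<le> ennreal (1 / \<tau>) * g X" using \<open>0 < \<tau>\<close> by (simp flip: ennreal_mult)
  qed
  moreover have "{X \<in> F. 1 \<le> ennreal (1 / \<tau>) * g X} \<in> sets S"
  proof -
    have "{X \<in> F. 1 \<le> ennreal (1 / \<tau>) * g X} = F \<inter> {X \<in> space S. 1 \<le> ennreal (1 / \<tau>) * g X}"
      using sets.sets_into_space[OF assms(2)] by auto
    then show ?thesis by simp
  qed
  ultimately have "emeasure S {X \<in> F. ennreal \<tau> \<le> g X} \<le> emeasure S {X \<in> F. 1 \<le> ennreal (1 / \<tau>) * g X}"
    by (rule emeasure_mono)
  also have "\<dots> \<le> ennreal (1 / \<tau>) * (\<integral>\<^sup>+X. g X * indicator F X \<partial>S)"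
    by (intro nn_integral_Markov_inequality) measurable
  also have "\<dots> \<le> ennreal (1 / \<tau>) * ennreal (c * \<tau>)" by (intro mult_left_mono le) simp
  also have "\<dots> = ennreal c" using \<open>0 < \<tau>\<close> \<open>0 \<le> c\<close> by (simp flip: ennreal_mult)
  finally show ?thesis .
qed

section \<open>Choice of the constants and assembly\<close>

theorem theorem1:
  fixes M :: "'s measure" and f\<^sub>o :: "'s \<Rightarrow> real"
    and J :: "'j set" and p :: "'j \<Rightarrow> nat"
    and \<Theta> :: "'j \<Rightarrow> (nat \<Rightarrow> real) set"
    and f :: "'j \<Rightarrow> (nat \<Rightarrow> real) \<Rightarrow> 's \<Rightarrow> real"
    and \<pi> :: "'j \<Rightarrow> (nat \<Rightarrow> real) measure"
    and A m C :: "'j \<Rightarrow> real" and \<alpha> \<gamma> :: real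
    and jn :: "nat \<Rightarrow> 'j" and \<beta> :: "nat \<Rightarrow> nat \<Rightarrow> real" and \<epsilon> :: "nat \<Rightarrow> real"
    and d :: "'j \<Rightarrow> (nat \<Rightarrow> real) \<Rightarrow> (nat \<Rightarrow> real) \<Rightarrow> real"
    and K0' K0'' b1 K4 b2 K5 :: real
  assumes "prob_density M f\<^sub>o"
    and "countable J"
    and "\<And>j. j \<in> J \<Longrightarrow> \<Theta> j \<subseteq> topspace (Euclidean_space (p j))"
    and "\<And>j \<theta>. j \<in> J \<Longrightarrow> \<theta> \<in> \<Theta> j \<Longrightarrow> prob_density M (f j \<theta>)"
    and "\<And>j. j \<in> J \<Longrightarrow> prob_space (\<pi> j) \<and> space (\<pi> j) = \<Theta> j"
    and "\<And>j. j \<in> J \<Longrightarrow> (\<lambda>(\<theta>, x). f j \<theta> x) \<in> borel_measurable (\<pi> j \<Otimes>\<^sub>M M)"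
    \<comment> \<open>(1)\<close>
    and "\<And>j. j \<in> J \<Longrightarrow> A j \<ge> 0.0056 \<and> m j \<ge> 1"
    and "\<And>j r \<delta> \<theta>. j \<in> J \<Longrightarrow> r > 0 \<Longrightarrow> 0 < \<delta> \<Longrightarrow> \<delta> \<le> 0.0056 * r \<Longrightarrow> \<theta> \<in> \<Theta> j \<Longrightarrow>
           ereal_of_enat (covering_number (\<Theta> j) (\<lambda>\<theta> \<eta>. sup_log_dist M (f j \<theta>) (f j \<eta>))
              (hellinger_param_ball M (\<Theta> j) (f j) \<theta> r) \<delta>)
           \<le> ereal ((A j * r / \<delta>) powr m j)"
    and "\<And>j. j \<in> J \<Longrightarrow> C j \<ge> 0"
    and "(\<lambda>j. exp (- C j)) summable_on J" and "(\<Sum>\<^sub>\<infinity>j\<in>J. exp (- C j)) \<le> 1"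
    and "0 < \<gamma>" and "\<gamma> < 1 / 4" and "0.13 * \<gamma> / sqrt (1 - 4 * \<gamma>) = 0.0056"
    and "(sieve_weight \<gamma> \<alpha> A m C has_sum 1) J"
    \<comment> \<open>(2)\<close>
    and "\<And>n. n \<ge> 1 \<Longrightarrow> jn n \<in> J \<and> \<beta> n \<in> \<Theta> (jn n) \<and> \<epsilon> n > 0"
    and "\<And>n. n \<ge> 1 \<Longrightarrow>
           max (KL_div M f\<^sub>o (f (jn n) (\<beta> n))) (KL_var M f\<^sub>o (f (jn n) (\<beta> n)))
             + ereal (sieve_eta \<gamma> A m C (jn n) / real n) \<le> ereal ((\<epsilon> n)\<^sup>2)"
    \<comment> \<open>(3)\<close>
    and "\<And>n. n \<ge> 1 \<Longrightarrow> Metric_space (\<Theta> (jn n)) (d (jn n))"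
    and "\<And>n \<eta> \<theta>. n \<ge> 1 \<Longrightarrow> \<eta> \<in> \<Theta> (jn n) \<Longrightarrow> \<theta> \<in> \<Theta> (jn n) \<Longrightarrow>
           sq_log_integral M f\<^sub>o (f (jn n) \<eta>) (f (jn n) \<theta>) \<le> ereal (K0' * (d (jn n) \<eta> \<theta>)\<^sup>2)"
    and "\<And>n \<theta>. n \<ge> 1 \<Longrightarrow> \<theta> \<in> \<Theta> (jn n) \<Longrightarrow>
           KL_div M f\<^sub>o (f (jn n) \<theta>) \<le> ereal K0'' * KL_var M f\<^sub>o (f (jn n) \<theta>)"
    \<comment> \<open>(4)\<close>
    and "b1 \<ge> 0" and "K4 > 0"
    and "\<And>n. n \<ge> 1 \<Longrightarrow>
           ereal_of_enat (covering_number (\<Theta> (jn n)) (\<lambda>\<theta> \<eta>. ereal (d (jn n) \<theta> \<eta>)) (\<Theta> (jn n)) (\<epsilon> n))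
           \<le> ereal ((A (jn n) powr b1 * K4) powr m (jn n))"
    \<comment> \<open>(5)\<close>
    and "b2 \<ge> 0" and "K5 > 0"
    and "\<And>n \<theta>. n \<ge> 1 \<Longrightarrow> \<theta> \<in> \<Theta> (jn n) \<Longrightarrow>
           Metric_space.mcball (\<Theta> (jn n)) (d (jn n)) \<theta> (\<epsilon> n) \<in> sets (\<pi> (jn n))"
    and "\<And>n. n \<ge> 1 \<Longrightarrow>
           measure (\<pi> (jn n)) (Metric_space.mcball (\<Theta> (jn n)) (d (jn n)) (\<beta> n) (\<epsilon> n)) > 0"
    and "\<And>n \<theta>. n \<ge> 1 \<Longrightarrow> \<theta> \<in> \<Theta> (jn n) \<Longrightarrow>
           measure (\<pi> (jn n)) (Metric_space.mcball (\<Theta> (jn n)) (d (jn n)) \<theta> (\<epsilon> n))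
           / measure (\<pi> (jn n)) (Metric_space.mcball (\<Theta> (jn n)) (d (jn n)) (\<beta> n) (\<epsilon> n))
           \<le> (A (jn n) powr b2 * K5) powr m (jn n)"
    \<comment> \<open>(6)\<close>
    and "\<epsilon> \<longlonglongrightarrow> 0" and "filterlim (\<lambda>n. real n * (\<epsilon> n)\<^sup>2) at_top sequentially"
  shows "\<exists>c K1 K2 :: real. c > 0 \<and> K1 > 0 \<and> K2 > 0 \<and>
    (\<exists>E. (\<forall>n. E n \<in> sets (sample_law M f\<^sub>o n)) \<and>
         (\<lambda>n. measure (sample_law M f\<^sub>o n) (E n)) \<longlonglongrightarrow> 0 \<and>
         (\<forall>n\<ge>1. \<forall>X\<in>space (sample_law M f\<^sub>o n) - E n.
            sieve_posterior f\<^sub>o J \<Theta> f \<pi> (sieve_weight \<gamma> \<alpha> A m C) n X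
              (\<lambda>g. hellinger M g f\<^sub>o > K1 * \<epsilon> n)
            \<le> ennreal (c * exp (- K2 * real n * (\<epsilon> n)\<^sup>2))))"
proof -
  define \<eta> where "\<eta> = sieve_eta \<gamma> A m C"
  define a where "a = sieve_weight \<gamma> \<alpha> A m C"
  define \<kappa> where "\<kappa> = (1 - 4 * \<gamma>) / 8"
  note fo = assms(1) and J = assms(2) and dens = assms(4) and prior = assms(5) and meas = assms(6)
    and Am = assms(7) and cov = assms(8) and C = assms(9) and \<gamma> = assms(12-14)
  have \<kappa>: "0 < \<kappa>" "\<kappa> \<le> 1 / 8" using \<gamma> by (auto simp: \<kappa>_def)
  have a_eq: "a j = \<alpha> * exp (- (1 + \<kappa>) * \<eta> j)" for j
    by (simp add: a_def sieve_weight_def \<eta>_def \<kappa>_def)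
  have \<eta>C: "C j \<le> \<eta> j" and \<eta>N: "m j * ln (A j / 0.0056) \<le> \<eta> j"
    and \<eta>log: "\<And>b k. 0 \<le> b \<Longrightarrow> m j * (b * ln (A j) + k) \<le> (b + \<bar>k\<bar>) * \<eta> j" if "j \<in> J" for j
    using sieve_eta_ge_C[OF \<gamma>, of A j m C] sieve_eta_ge_entropy[OF \<gamma>, of A j m C]
      sieve_eta_ge_log[OF \<gamma>, of A j m C] Am[OF that] C[OF that] by (auto simp: \<eta>_def)
  have \<eta>0: "0 \<le> \<eta> j" if "j \<in> J" for j using \<eta>C[OF that] C[OF that] by linarith
  have a_sum: "(a has_sum 1) J" using assms(15) by (simp add: a_def)
  \<comment> \<open>The normalization fixes the sign: nonpositive weights cannot sum to 1.\<close>
  have \<alpha>: "0 < \<alpha>"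
  proof (rule ccontr)
    assume "\<not> 0 < \<alpha>"
    then have "a j \<le> 0" for j by (simp add: a_eq mult_nonpos_nonneg)
    then have "1 \<le> (0::real)" by (intro has_sum_mono[OF a_sum has_sum_0[of J "\<lambda>_. 0"]]) auto
    then show False by simp
  qed
  have suma: "(\<integral>\<^sup>+j. ennreal (a j) \<partial>count_space J) \<le> 1"
    using nn_integral_count_space_has_sum[OF a_sum] \<alpha> by (simp add: a_eq)
  have "(\<integral>\<^sup>+j. ennreal (exp (- \<eta> j)) \<partial>count_space J) \<le> (\<integral>\<^sup>+j. ennreal (exp (- C j)) \<partial>count_space J)"
    using \<eta>C by (intro nn_integral_mono ennreal_leI) auto
  also have "\<dots> = ennreal (\<Sum>\<^sub>\<infinity>j\<in>J. exp (- C j))"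
    using has_sum_infsum[OF assms(10)] by (intro nn_integral_count_space_has_sum) auto
  also have "\<dots> \<le> 1" using assms(11) by simp
  finally have sum\<eta>: "(\<integral>\<^sup>+j. ennreal (exp (- \<eta> j)) \<partial>count_space J) \<le> 1" .
  have N: "(A j / 0.0056) powr m j \<le> exp (\<eta> j)" if "j \<in> J" for j
    using \<eta>N[OF that] Am[OF that] by (simp add: powr_def)
  define V where "V = 2 + 2 * \<bar>K0'\<bar>"
  define K6 where "K6 = b1 + b2 + \<bar>ln (K4 * K5)\<bar>"
  \<comment> \<open>The exponents lost in the denominator: 2 for the prior weight of the model
    \<open>jn n\<close>, \<open>K6\<close> for the prior mass of the ball around
    \<open>\<beta> n\<close>, and the rest for the likelihood ratio on that ball.\<close>
  define K where "K = 2 + K6 + (\<bar>K0''\<bar> * V + 1)"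
  \<comment> \<open>\<open>T\<close> is the square of \<open>K1\<close>. It makes
    \<open>\<kappa> * (T / 32)\<close> equal to \<open>2 * (K + 1)\<close>, the exponent wanted for
    untested models.\<close>
  define T where "T = 64 * (K + 1) / \<kappa>"
  define x where "x n = real n * (\<epsilon> n)\<^sup>2" for n
  have V: "0 \<le> V" by (simp add: V_def)
  have K6: "0 \<le> K6" using assms(21,24) by (simp add: K6_def)
  have K: "0 < K" using V K6 by (simp add: K_def add_pos_nonneg)
  have T: "0 < T" using K \<kappa> by (simp add: T_def)
  have \<kappa>T: "\<kappa> * T = 64 * (K + 1)" using \<kappa> by (simp add: T_def)
  \<comment> \<open>In order: the probabilities of a small denominator, of a false rejection, and of
    a large numerator.\<close>
  define bnd where "bnd n = 2 * V / x n + 2 * exp (- (T / 16) * x n) + (1 + \<alpha>) * exp (- (K + 1) * x n)" for n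
  define good where "good n \<longleftrightarrow> n \<ge> 1 \<and> 1 \<le> T / 8 * x n" for n
  let ?c = "2 / \<alpha>" and ?K1 = "sqrt T" and ?K2 = "1::real"
  let ?post = "\<lambda>n X. sieve_posterior f\<^sub>o J \<Theta> f \<pi> a n X (\<lambda>g. hellinger M g f\<^sub>o > ?K1 * \<epsilon> n)"
  define ok where "ok n E \<longleftrightarrow> E \<in> sets (sample_law M f\<^sub>o n) \<and> measure (sample_law M f\<^sub>o n) E \<le> bnd n \<and>
      (\<forall>X\<in>space (sample_law M f\<^sub>o n) - E. ?post n X \<le> ennreal (?c * exp (- ?K2 * real n * (\<epsilon> n)\<^sup>2)))" for n E
  have step: "\<exists>E. ok n E"
    if good: "good n" for n
  proof -
    have n: "n \<ge> 1" and large: "1 \<le> T / 8 * x n" using good by (auto simp: good_def)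
    let ?S = "sample_law M f\<^sub>o n" and ?j = "jn n" and ?s = "?K1 * \<epsilon> n"
    interpret S: prob_space ?S using fo by (rule prob_space_sample_law)
    have j: "?j \<in> J" and \<beta>: "\<beta> n \<in> \<Theta> ?j" and \<epsilon>: "\<epsilon> n > 0" using assms(16)[OF n] by auto
    have x0: "0 < x n" using n \<epsilon> by (simp add: x_def)
    interpret d: Metric_space "\<Theta> ?j" "d ?j" by (rule assms(18)[OF n])
    have ball: "d.mcball \<theta> (\<epsilon> n) = {\<theta>' \<in> \<Theta> ?j. d ?j \<theta> \<theta>' \<le> \<epsilon> n}" if "\<theta> \<in> \<Theta> ?j" for \<theta>
      using that by (auto simp: d.mcball_def)
    let ?B = "{\<theta>' \<in> \<Theta> ?j. d ?j (\<beta> n) \<theta>' \<le> \<epsilon> n}"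
    have \<pi>j: "prob_space (\<pi> ?j)" "space (\<pi> ?j) = \<Theta> ?j" using prior[OF j] by auto
    let ?v = "KL_var M f\<^sub>o (f ?j (\<beta> n))"
    have two: "max (KL_div M f\<^sub>o (f ?j (\<beta> n))) ?v + ereal (\<eta> ?j / real n) \<le> ereal ((\<epsilon> n)\<^sup>2)"
      using assms(17)[OF n] by (simp add: \<eta>_def)
    \<comment> \<open>Since the maximum is at least \<open>?v \<ge> 0\<close> and
      \<open>\<eta> ?j \<ge> 0\<close>, assumption (2) bounds \<open>?v\<close> and
      \<open>\<eta> ?j / n\<close> separately by \<open>\<epsilon>^2\<close>.\<close>
    have v0: "0 \<le> ?v" by (simp add: KL_var_def sq_log_integral_def)
    have "?v + 0 \<le> max (KL_div M f\<^sub>o (f ?j (\<beta> n))) ?v + ereal (\<eta> ?j / real n)"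
      using \<eta>0[OF j] by (intro add_mono) auto
    then have var: "?v \<le> ereal ((\<epsilon> n)\<^sup>2)" using two by simp
    have "0 + ereal (\<eta> ?j / real n) \<le> max (KL_div M f\<^sub>o (f ?j (\<beta> n))) ?v + ereal (\<eta> ?j / real n)"
      using v0 by (intro add_mono) (auto simp: le_max_iff_disj)
    from order_trans[OF this two] have "\<eta> ?j / real n \<le> (\<epsilon> n)\<^sup>2" by (simp only: add_0_left ereal_less_eq)
    then have \<eta>x: "\<eta> ?j \<le> x n" using n by (simp add: x_def field_simps)
    have B_pos: "0 < measure (\<pi> ?j) ?B" using assms(27)[OF n] by (simp add: ball[OF \<beta>])
    have B_sets: "{\<theta>' \<in> \<Theta> ?j. d ?j \<theta> \<theta>' \<le> \<epsilon> n} \<in> sets (\<pi> ?j)" if "\<theta> \<in> \<Theta> ?j" for \<theta>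
      using assms(26)[OF n that] by (simp add: ball[OF that])

    have prior_mass: "exp (- K6 * x n) \<le> measure (\<pi> ?j) ?B"
    proof -
      have Aj: "0 < A ?j" using Am[OF j] by auto
      let ?N = "(A ?j powr b1 * K4) powr m ?j" and ?\<rho> = "(A ?j powr b2 * K5) powr m ?j"
      have "1 \<le> ?N * ?\<rho> * measure (\<pi> ?j) ?B"
      proof (rule prior_ball_lower_bound[OF \<pi>j assms(23)[OF n] B_sets])
        fix \<theta> assume th: "\<theta> \<in> \<Theta> ?j"
        show "measure (\<pi> ?j) {\<eta> \<in> \<Theta> ?j. d ?j \<theta> \<eta> \<le> \<epsilon> n} \<le> ?\<rho> * measure (\<pi> ?j) ?B"
          using assms(28)[OF n th] B_pos by (simp add: ball[OF th] ball[OF \<beta>] divide_le_eq)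
      qed auto
      also have "?N * ?\<rho> = exp (m ?j * ((b1 + b2) * ln (A ?j) + ln (K4 * K5)))"
        using Aj assms(22,25)
        by (simp add: powr_def ln_mult ln_powr exp_add[symmetric] algebra_simps)
      also have "\<dots> \<le> exp (K6 * x n)"
      proof -
        have "m ?j * ((b1 + b2) * ln (A ?j) + ln (K4 * K5)) \<le> K6 * \<eta> ?j"
          unfolding K6_def using assms(21,24) by (intro \<eta>log j) auto
        also have "\<dots> \<le> K6 * x n" using \<eta>x K6 by (rule mult_left_mono)
        finally show ?thesis by simp
      qed
      finally have "1 \<le> exp (K6 * x n) * measure (\<pi> ?j) ?B" by (simp add: mult_right_mono)
      then show ?thesis by (simp add: exp_minus field_simps)
    qed

    have n0: "0 < n" using n by simp
    have dn: "0 \<le> d ?j (\<beta> n) \<theta>" for \<theta> by simp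
    have "\<exists>E. E \<in> sets ?S \<and> measure ?S E \<le> 2 * V / x n \<and> (\<forall>X\<in>space ?S - E.
       ennreal (measure (\<pi> ?j) ?B / 2 * exp (- x n * (\<bar>K0''\<bar> * V + 1))) \<le>
         (\<integral>\<^sup>+\<theta>\<in>?B. ennreal (\<Prod>i<n. f ?j \<theta> (X i) / f\<^sub>o (X i)) \<partial>\<pi> ?j))"
      unfolding x_def V_def
      by (rule model_evidence_lower_bound[where T="\<Theta> ?j" and f="f ?j" and \<nu>="\<pi> ?j" and d="d ?j" and \<beta>="\<beta> n"
          and \<epsilon>="\<epsilon> n" and K'=K0' and K''=K0'' and n=n,
          OF fo \<pi>j dens[OF j] meas[OF j] \<beta> \<epsilon> n0 var dn assms(19)[OF n \<beta>] assms(20)[OF n] B_sets[OF \<beta>] B_pos];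
          (assumption | blast))
    then obtain E1 where E1: "E1 \<in> sets ?S" "measure ?S E1 \<le> 2 * V / x n"
      and ev: "\<And>X. X \<in> space ?S - E1 \<Longrightarrow>
       ennreal (measure (\<pi> ?j) ?B / 2 * exp (- x n * (\<bar>K0''\<bar> * V + 1))) \<le>
         (\<integral>\<^sup>+\<theta>\<in>?B. ennreal (\<Prod>i<n. f ?j \<theta> (X i) / f\<^sub>o (X i)) \<partial>\<pi> ?j)"
      by blast
    have mass_ge: "ennreal (\<alpha> / 2 * exp (- K * x n)) \<le> sieve_mass f\<^sub>o J \<Theta> f \<pi> a n X (\<lambda>_. True)"
      if X: "X \<in> space ?S - E1" for X
    proof -
      \<comment> \<open>This is the 2 in \<open>K\<close>: \<open>1 + \<kappa> \<le> 2\<close>, and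
        (2) gives \<open>\<eta> ?j \<le> x n\<close>.\<close>
      have "(1 + \<kappa>) * \<eta> ?j \<le> 2 * x n" using \<eta>x \<eta>0[OF j] \<kappa> by (intro mult_mono) auto
      then have a_ge: "\<alpha> * exp (- 2 * x n) \<le> a ?j" using \<alpha> by (simp add: a_eq algebra_simps)
      have a0: "0 \<le> a ?j" using \<alpha> by (simp add: a_eq)
      have "\<alpha> / 2 * exp (- K * x n)
          = (\<alpha> * exp (- 2 * x n)) * (exp (- K6 * x n) / 2 * exp (- x n * (\<bar>K0''\<bar> * V + 1)))"
        by (simp add: K_def exp_add[symmetric] algebra_simps)
      also have "\<dots> \<le> a ?j * (measure (\<pi> ?j) ?B / 2 * exp (- x n * (\<bar>K0''\<bar> * V + 1)))"
        using a_ge a0 prior_mass \<alpha> by (intro mult_mono) auto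
      finally have "ennreal (\<alpha> / 2 * exp (- K * x n))
          \<le> ennreal (a ?j) * ennreal (measure (\<pi> ?j) ?B / 2 * exp (- x n * (\<bar>K0''\<bar> * V + 1)))"
        using a0 by (subst ennreal_mult[symmetric]) (auto intro: ennreal_leI)
      also have "\<dots> \<le> ennreal (a ?j) * (\<integral>\<^sup>+\<theta>\<in>?B. ennreal (\<Prod>i<n. f ?j \<theta> (X i) / f\<^sub>o (X i)) \<partial>\<pi> ?j)"
        by (intro mult_left_mono ev X) simp
      also have "\<dots> \<le> sieve_mass f\<^sub>o J \<Theta> f \<pi> a n X (\<lambda>_. True)"
        using j by (intro sieve_mass_ge_model) auto
      finally show ?thesis .
    qed

    have s: "0 < ?s" using T \<epsilon> by simp
    have y: "real n * (?s\<^sup>2 / 8) = T / 8 * x n" using T by (simp add: x_def power_mult_distrib)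
    let ?mass = "\<lambda>X. sieve_mass f\<^sub>o J \<Theta> f \<pi> a n X (\<lambda>g. ?s < hellinger M g f\<^sub>o)"
    have large': "1 \<le> real n * (?s\<^sup>2 / 8)" using large by (simp only: y)
    \<comment> \<open>With \<open>R = T / 32 * x n\<close>, the cost \<open>2 * R\<close> is half of
      the test exponent \<open>T / 8 * x n\<close>; the other half is left for the probability of a
      false rejection.\<close>
    obtain E2 where E2: "E2 \<in> sets ?S"
      "emeasure ?S E2 \<le> ennreal (2 * exp (2 * (T / 32 * x n) - real n * (?s\<^sup>2 / 8)))"
      "(\<integral>\<^sup>+X. ?mass X * indicator (space ?S - E2) X \<partial>?S)
        \<le> ennreal (exp (- (real n * (?s\<^sup>2 / 8))) + \<alpha> * exp (- \<kappa> * (T / 32 * x n)))"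
      by (rule sieve_mass_exceptional_set[OF fo J dens prior meas cov N sum\<eta> suma a_eq
            less_imp_le[OF \<alpha>] less_imp_le[OF \<kappa>(1)] s large', where R="T / 32 * x n"]; (assumption | blast))
    have E2_prob: "measure ?S E2 \<le> 2 * exp (- (T / 16) * x n)"
      using E2(2) unfolding y by (simp add: S.emeasure_eq_measure algebra_simps)
    \<comment> \<open>The integral of the numerator is at most a constant times
      \<open>\<tau> * \<tau>\<close>: one factor becomes the threshold in Markov's inequality, the
      other the probability of exceeding it.\<close>
    define \<tau> where "\<tau> = exp (- (K + 1) * x n)"
    have "(\<integral>\<^sup>+X. ?mass X * indicator (space ?S - E2) X \<partial>?S) \<le> ennreal (((1 + \<alpha>) * \<tau>) * \<tau>)"
    proof -
      have eq: "\<kappa> * (T / 32 * x n) = 2 * (K + 1) * x n"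
      proof -
        have "\<kappa> * (T / 32 * x n) = (\<kappa> * T) * (x n / 32)" by simp
        also have "\<dots> = 2 * (K + 1) * x n" unfolding \<kappa>T by simp
        finally show ?thesis .
      qed
      \<comment> \<open>The contribution of tested models decays faster than that of untested ones,
        so the latter determines the rate.\<close>
      have "\<kappa> * (T / 32 * x n) \<le> (1 / 8) * (T / 32 * x n)" using \<kappa> T x0 by (intro mult_right_mono) auto
      also have "\<dots> \<le> T / 8 * x n" using T x0 by simp
      finally have "exp (- (T / 8 * x n)) \<le> exp (- \<kappa> * (T / 32 * x n))" by simp
      then have le: "exp (- (T / 8 * x n)) + \<alpha> * exp (- \<kappa> * (T / 32 * x n)) \<le> (1 + \<alpha>) * exp (- \<kappa> * (T / 32 * x n))"
        by (simp add: algebra_simps)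
      have \<tau>\<tau>: "exp (- \<kappa> * (T / 32 * x n)) = \<tau> * \<tau>"
        unfolding \<tau>_def exp_add[symmetric] mult_minus_left eq by (simp add: algebra_simps)
      from order_trans[OF E2(3)[unfolded y] ennreal_leI[OF le]] show ?thesis
        by (simp only: \<tau>\<tau> mult.assoc)
    qed
    moreover have mass_meas: "?mass \<in> borel_measurable ?S"
      by (rule borel_measurable_sieve_mass[OF fo J dens prior meas])
    ultimately have E3_prob: "emeasure ?S {X \<in> space ?S - E2. ennreal \<tau> \<le> ?mass X} \<le> ennreal ((1 + \<alpha>) * \<tau>)"
      using E2(1) \<alpha> by (intro Markov_inequality_restricted) (auto simp: \<tau>_def)
    define E3 where "E3 = {X \<in> space ?S - E2. ennreal \<tau> \<le> ?mass X}"
    have E3: "E3 \<in> sets ?S"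
    proof -
      have "E3 = {X \<in> space ?S. ennreal \<tau> \<le> ?mass X} - E2" by (auto simp: E3_def)
      then show ?thesis using mass_meas E2(1) by (auto intro!: sets.Diff)
    qed
    have E3_prob': "measure ?S E3 \<le> (1 + \<alpha>) * \<tau>"
    proof -
      have "0 \<le> (1 + \<alpha>) * \<tau>" using \<alpha> by (simp add: \<tau>_def)
      then show ?thesis
        using E3_prob[folded E3_def] by (simp only: S.emeasure_eq_measure ennreal_le_iff)
    qed
    show ?thesis
      unfolding ok_def
    proof (intro exI conjI ballI)
      show "E1 \<union> E2 \<union> E3 \<in> sets ?S" using E1 E2 E3 by auto
      have "measure ?S (E1 \<union> E2 \<union> E3) \<le> measure ?S E1 + measure ?S E2 + measure ?S E3"
        using measure_Un_le[of "E1 \<union> E2" ?S E3] measure_Un_le[of E1 ?S E2] E1 E2 E3 by auto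
      then show "measure ?S (E1 \<union> E2 \<union> E3) \<le> bnd n"
        using E1(2) E2_prob E3_prob' by (simp add: bnd_def \<tau>_def)
    next
      fix X assume X: "X \<in> space ?S - (E1 \<union> E2 \<union> E3)"
      then have num: "?mass X \<le> ennreal \<tau>" by (auto simp: E3_def)
      have den: "ennreal (\<alpha> / 2 * exp (- K * x n)) \<le> sieve_mass f\<^sub>o J \<Theta> f \<pi> a n X (\<lambda>_. True)"
        using X by (intro mass_ge) auto
      have d0: "0 < \<alpha> / 2 * exp (- K * x n)" using \<alpha> by simp
      have "?post n X \<le> ennreal (\<tau> / (\<alpha> / 2 * exp (- K * x n)))"
        unfolding sieve_posterior_def
      proof (rule divide_le_posI_ennreal)
        show "0 < sieve_mass f\<^sub>o J \<Theta> f \<pi> a n X (\<lambda>_. True)"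
          using d0 by (intro less_le_trans[OF _ den]) simp
        have "ennreal \<tau> = ennreal (\<tau> / (\<alpha> / 2 * exp (- K * x n)) * (\<alpha> / 2 * exp (- K * x n)))"
          using \<alpha> by simp
        also have "\<dots> = ennreal (\<tau> / (\<alpha> / 2 * exp (- K * x n))) * ennreal (\<alpha> / 2 * exp (- K * x n))"
          using d0 by (intro ennreal_mult) (auto simp: \<tau>_def)
        also have "\<dots> \<le> ennreal (\<tau> / (\<alpha> / 2 * exp (- K * x n))) * sieve_mass f\<^sub>o J \<Theta> f \<pi> a n X (\<lambda>_. True)"
          using den by (rule mult_left_mono) simp
        finally show "?mass X \<le> sieve_mass f\<^sub>o J \<Theta> f \<pi> a n X (\<lambda>_. True) * ennreal (\<tau> / (\<alpha> / 2 * exp (- K * x n)))"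
          using num by (simp add: mult.commute)
      qed
      \<comment> \<open>The exponent \<open>K + 1\<close> of \<tau> exceeds that of the denominator
        by one, which yields \<open>?K2 = 1\<close>; \<open>?c\<close> is the inverse of the factor
        \<open>\<alpha> / 2\<close>.\<close>
      also have "\<tau> / (\<alpha> / 2 * exp (- K * x n)) = ?c * exp (- ?K2 * real n * (\<epsilon> n)\<^sup>2)"
      proof -
        have "\<tau> = exp (- K * x n) * exp (- x n)" by (simp add: \<tau>_def exp_add[symmetric] algebra_simps)
        then show ?thesis using \<alpha> by (simp add: x_def)
      qed
      finally show "?post n X \<le> ennreal (?c * exp (- ?K2 * real n * (\<epsilon> n)\<^sup>2))" .
    qed
  qed

  \<comment> \<open>For the finitely many \<open>n\<close> that are not good, the exceptional set is
    the whole space: the posterior bound is then vacuous and the limit is unaffected.\<close>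
  define E where "E n = (if good n then SOME E. ok n E else space (sample_law M f\<^sub>o n))" for n
  have "ok n (E n)" if "good n" for n
    using someI_ex[OF step[OF that]] that by (simp add: E_def)
  then have E: "E n \<in> sets (sample_law M f\<^sub>o n)" "measure (sample_law M f\<^sub>o n) (E n) \<le> bnd n"
      "\<And>X. X \<in> space (sample_law M f\<^sub>o n) - E n \<Longrightarrow>
        ?post n X \<le> ennreal (?c * exp (- ?K2 * real n * (\<epsilon> n)\<^sup>2))"
    if "good n" for n
    using that unfolding ok_def by blast+
  have E_bad: "E n = space (sample_law M f\<^sub>o n)" if "\<not> good n" for n using that by (simp add: E_def)
  have x_lim: "filterlim x at_top sequentially" using assms(30) by (simp add: x_def [abs_def])
  have "eventually (\<lambda>n. 8 / T \<le> x n) sequentially" using x_lim by (simp add: filterlim_at_top)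
  then have ev_good: "eventually good sequentially"
    using eventually_ge_at_top[of 1] by eventually_elim (use T in \<open>simp add: good_def field_simps\<close>)
  have bnd_lim: "bnd \<longlonglongrightarrow> 0"
  proof -
    have e: "(\<lambda>n. exp (- q * x n)) \<longlonglongrightarrow> 0" if "0 < q" for q
    proof -
      have "filterlim (\<lambda>n. q * x n) at_top sequentially"
        using x_lim that by (rule filterlim_tendsto_pos_mult_at_top[OF tendsto_const, rotated])
      then have "filterlim (\<lambda>n. - (q * x n)) at_bot sequentially"
        by (simp add: filterlim_uminus_at_top)
      from filterlim_compose[OF exp_at_bot this] show ?thesis by simp
    qed
    have "(\<lambda>n. 2 * V / x n) \<longlonglongrightarrow> 0"
      using x_lim by (intro real_tendsto_divide_at_top[OF tendsto_const]) 
    then have "(\<lambda>n. 2 * V / x n + 2 * exp (- (T / 16) * x n) + (1 + \<alpha>) * exp (- (K + 1) * x n)) \<longlonglongrightarrow> 0 + 2 * 0 + (1 + \<alpha>) * 0"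
      using T K by (intro tendsto_intros e) auto
    then show ?thesis by (simp add: bnd_def [abs_def])
  qed
  have "eventually (\<lambda>n. 0 \<le> measure (sample_law M f\<^sub>o n) (E n)) sequentially" by simp
  moreover have "eventually (\<lambda>n. measure (sample_law M f\<^sub>o n) (E n) \<le> bnd n) sequentially"
    by (rule eventually_mono[OF ev_good E(2)])
  ultimately have E_lim: "(\<lambda>n. measure (sample_law M f\<^sub>o n) (E n)) \<longlonglongrightarrow> 0"
    by (rule tendsto_sandwich[OF _ _ tendsto_const bnd_lim])
  show ?thesis
  proof (rule exI[of _ ?c], rule exI[of _ ?K1], rule exI[of _ ?K2], intro conjI exI[of _ E] allI impI ballI)
    show "0 < ?c" "0 < ?K1" "0 < ?K2" using \<alpha> T by auto
    show "E n \<in> sets (sample_law M f\<^sub>o n)" for n using E(1)[of n] E_bad[of n] by (cases "good n") auto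
    show "(\<lambda>n. measure (sample_law M f\<^sub>o n) (E n)) \<longlonglongrightarrow> 0" by (rule E_lim)
  next
    fix n X assume "X \<in> space (sample_law M f\<^sub>o n) - E n"
    then show "sieve_posterior f\<^sub>o J \<Theta> f \<pi> (sieve_weight \<gamma> \<alpha> A m C) n X (\<lambda>g. hellinger M g f\<^sub>o > ?K1 * \<epsilon> n)
      \<le> ennreal (?c * exp (- ?K2 * real n * (\<epsilon> n)\<^sup>2))"
      using E(3)[of n X] E_bad[of n] by (cases "good n") (auto simp: a_def)
  qed
qed

end
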